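(* Consider either of the test models (Layer Model with Fault or Channelized Model) with piecewise continuous permeability, with a prior $\mu_0$ on $u\in U$ that is Gaussian on the variables $\log\kappa_i$ and satisfies $\mu_0(U)=1$. For $y,y'\in Y$ let $\mu,\mu'\ll\mu_0$ be the resulting posterior distributions, with $\frac{d\mu}{d\mu_0}(u)=\frac1Z\exp(-\Phi(u;y))$, $Z=\int_U\exp(-\Phi(u;y))\mu_0(du)$, and $\frac{d\mu'}{d\mu_0}(u)=\frac1{Z'}\exp(-\Phi(u;y'))$, $Z'=\int_U\exp(-\Phi(u;y'))\mu_0(du)$. Then for every fixed $r>0$ there are constants $C_i=C_i(r)$, $i=1,2$, such that for all $y,y'\in Y$ with $\max\{|y|_\Gamma,|y'|_\Gamma\}<r$, $$d_{TV}(\mu,\mu')\le C_1|y-y'|_\Gamma,\qquad d_{Hell}(\mu,\mu')\le C_2|y-y'|_\Gamma.$$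
   Context: Let $D=(0,1)^2$ with points $(x,y)$, $V=H^1_0(D)$ with norm $\|p\|_V=\|\nabla p\|_{L^2(D)}$, $V^*$ its dual, and $X=\{g\in L^\infty(D;\mathbb{R}) : \operatorname{ess\,inf}_D g>0\}$. Fix $f\in V^*$. For $\kappa\in X$ let $G(\kappa)=p\in V$ be the unique weak solution of $-\nabla\cdot(\kappa\nabla p)=f$ in $D$, $p=0$ on $\partial D$. Let $L:V\to Y=\mathbb{R}^J$, $L(p)=(l_1(p),\dots,l_J(p))^T$ with fixed $l_j\in V^*$. The unknown is $u=(u_g,u_\kappa)\in U=U_g\times U_\kappa$, $F(u)=\kappa=\sum_{i=1}^n\kappa_i\chi_{D_i}$ where the $D_i$ are determined by $u_g$, and $\mathcal{G}=L\circ G\circ F:U\to Y$. $\Gamma$ is a symmetric positive definite $J\times J$ matrix, $|\cdot|_\Gamma=|\Gamma^{-1/2}\cdot|$, and $\Phi(u;y)=\frac12|y-\mathcal{G}(u)|_\Gamma^2$. Geometries. (1) Layer Model with Fault ($n\ge 2$ layers): $u_g=(a,b,c)\in U_g=A^2\times[-c^\star,c^\star]$ with $c^\star>0$ and $A=\{\mathbf{x}\in\mathbb{R}^{n-1}:\sum_{i=1}^{n-1}x_i\le1,\ x_i\ge0\}$. Here $a_i$ and $b_i$ are the thicknesses of layer $i$ at the right side $x=1$ and the left side $x=0$ of $D$, with layers numbered from top to bottom. For $1\le i\le n-1$ put $h_i(x)=\sum_{k=1}^i\big(b_k(1-x)+a_kx\big)$, and let the depth (distance below the top of $D$) of the interface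 between layers $i$ and $i+1$ be $S_i(x)=h_i(x)+c$ for $x<\frac12$ and $S_i(x)=h_i(x)$ for $x>\frac12$. With $S_0=-\infty$, $S_n=+\infty$, $D_i=\{(x,y)\in D: x\ne\frac12,\ S_{i-1}(x)<1-y<S_i(x)\}$. (2) Channelized Model ($n=2$): $u_g=(d_1,\dots,d_5)\in U_g=\prod_{i=1}^5[d_i^-,d_i^+]$, with $[d_3^-,d_3^+]\subset(-\pi/2,\pi/2)$ and $d_5^-\ge0$. $D_1=\{(x,y)\in D: g(x)<y<g(x)+d_5\}$, where $g(x)=d_1\sin(d_2x)+\tan(d_3)x+d_4$, and $D_2=D\setminus\overline{D_1}$. Continuous permeability: $u_\kappa=(\log\kappa_1,\dots,\log\kappa_n)\in U_\kappa=C(\overline{D};\mathbb{R}^n)$ with the sup norm; $U$ is a subset of the separable Banach space $\mathcal{B}=\mathbb{R}^m\times C(\overline{D};\mathbb{R}^n)$ ($m=2n-1$ for the layer model, $m=5$ for the channelized model), with its Borel $\sigma$-algebra. Prior: under $\mu_0$, $u_g$ is uniformly distributed on $U_g$, and the fields $\log\kappa_i$ are independent of each other and of $u_g$, with Gaussian laws $\mu_0^i=N(m_i,C_i)$ satisfying $\mu_0^i(C(\overline{D};\mathbb{R}))=1$. Metrics: with $\nu$ any common reference measure dominating $\mu,\mu'$, $d_{Hell}(\mu,\mu')=\Big(\frac12\int_U\big(\sqrt{d\mu/d\nu}-\sqrt{d\mu'/d\nu}\big)^2d\nu\Big)^{1/2}$ and $d_{TV}(\mu,\mu')=\frac12\int_U\big|\frac{d\mu}{d\nu}-\frac{d\mu'}{d\nu}\big|d\nu$.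 *)

theory Defs
  imports "HOL-Probability.Probability"
begin

section \<open>The domain \<open>D\<close> and continuous functions on its closure\<close>

definition dom_D :: "(real \<times> real) set" where
  "dom_D = {0<..<1} \<times> {0<..<1}"

typedef closed_square = "closure dom_D"
  morphisms point_of at_point
proof -
  have "(1/2, 1/2) \<in> dom_D"
    by (simp add: dom_D_def)
  then show ?thesis
    using closure_subset by blast
qed

instantiation closed_square :: metric_space
begin

definition dist_closed_square :: "closed_square \<Rightarrow> closed_square \<Rightarrow> real" where
  "dist_closed_square s t = dist (point_of s) (point_of t)"

definition uniformity_closed_square :: "(closed_square \<times> closed_square) filter" where
  "uniformity_closed_square = (INF e\<in>{0<..}. principal {(s, t). dist s t < e})"

definition open_closed_square :: "closed_square set \<Rightarrow> bool" where
  "open_closed_square S = (\<forall>s\<in>S. \<forall>\<^sub>F (s', t) in uniformity. s' = s \<longrightarrow> t \<in> S)"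

instance
proof
  fix s t u :: closed_square
  show "dist s t = 0 \<longleftrightarrow> s = t"
    by (simp add: dist_closed_square_def point_of_inject)
  show "dist s t \<le> dist s u + dist t u"
    by (simp add: dist_closed_square_def dist_triangle2)
qed (rule uniformity_closed_square_def open_closed_square_def)+

end

lemma compact_closed_square: "compact (UNIV :: closed_square set)"
proof -
  have "bounded (closure dom_D)"
    unfolding dom_D_def by (intro bounded_closure bounded_Times bounded_Ioo)
  then have "compact (closure dom_D)"
    by (simp add: compact_eq_bounded_closed)
  moreover have "continuous_on (closure dom_D) at_point"
    unfolding continuous_on_iff
    by (auto simp: dist_closed_square_def at_point_inverse)
  moreover have "at_point ` closure dom_D = UNIV"
    by (metis (no_types, lifting) UNIV_eq_I image_eqI point_of point_of_inverse)
  ultimately show ?thesis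
    by (metis compact_continuous_image)
qed

text \<open>
  As \<open>closed_square\<close> is compact, \<open>closed_square \<Rightarrow>\<^sub>C 'a\<close> is the space of all continuous functions
  from the closure of \<open>D\<close> to \<open>'a\<close>, with the sup norm.
\<close>

definition comp_field :: "'n::finite \<Rightarrow> (closed_square \<Rightarrow>\<^sub>C (real^'n)) \<Rightarrow> (closed_square \<Rightarrow>\<^sub>C real)" where
  "comp_field i v = Bcontfun (\<lambda>s. apply_bcontfun v s $ i)"

lemma apply_comp_field: "apply_bcontfun (comp_field i v) s = apply_bcontfun v s $ i"
proof -
  have "bounded (range (\<lambda>s. apply_bcontfun v s $ i))"
    using bounded_linear_image[OF bounded_apply_bcontfun[of v] bounded_linear_vec_nth[of i]]
    by (simp add: image_image)
  then have "(\<lambda>s. apply_bcontfun v s $ i) \<in> bcontfun"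
    by (auto simp: bcontfun_def intro!: continuous_intros)
  then show ?thesis
    by (simp add: comp_field_def Bcontfun_inverse)
qed

section \<open>The space \<open>V\<close>, its dual, and the forward problem\<close>

text \<open>
  Elements of Lebesgue and Sobolev spaces are represented by functions on the plane; only their
  values almost everywhere in \<open>D\<close> matter.
\<close>

definition L2 :: "(real \<times> real \<Rightarrow> 'a::euclidean_space) \<Rightarrow> bool" where
  "L2 p \<longleftrightarrow> p \<in> borel_measurable (lebesgue_on dom_D) \<and>
     integrable (lebesgue_on dom_D) (\<lambda>z. (norm (p z))\<^sup>2)"

definition L2_norm :: "(real \<times> real \<Rightarrow> 'a::euclidean_space) \<Rightarrow> real" where
  "L2_norm p = sqrt (LINT z|lebesgue_on dom_D. (norm (p z))\<^sup>2)"

primrec Ck :: "nat \<Rightarrow> (real \<times> real \<Rightarrow> real) \<Rightarrow> bool" where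
  "Ck 0 \<phi> \<longleftrightarrow> continuous_on UNIV \<phi>"
| "Ck (Suc k) \<phi> \<longleftrightarrow> (\<exists>g. (\<forall>z. GDERIV \<phi> z :> g z) \<and> Ck k (\<lambda>z. fst (g z)) \<and> Ck k (\<lambda>z. snd (g z)))"

definition test_function :: "(real \<times> real \<Rightarrow> real) \<Rightarrow> bool" where
  "test_function \<phi> \<longleftrightarrow> (\<forall>k. Ck k \<phi>) \<and>
     (\<exists>K. compact K \<and> K \<subseteq> dom_D \<and> (\<forall>z. z \<notin> K \<longrightarrow> \<phi> z = 0))"

definition weak_gradient :: "(real \<times> real \<Rightarrow> real) \<Rightarrow> (real \<times> real \<Rightarrow> real \<times> real) \<Rightarrow> bool" where
  "weak_gradient p g \<longleftrightarrow>
     (\<forall>\<phi> \<psi>. test_function \<phi> \<and> (\<forall>z. GDERIV \<phi> z :> \<psi> z) \<longrightarrow>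
        (LINT z|lebesgue_on dom_D. p z *\<^sub>R \<psi> z) = - (LINT z|lebesgue_on dom_D. \<phi> z *\<^sub>R g z))"

definition H1 :: "(real \<times> real \<Rightarrow> real) set" where
  "H1 = {p. L2 p \<and> (\<exists>g. L2 g \<and> weak_gradient p g)}"

text \<open>The weak gradient is unique up to null sets, so the choice is immaterial.\<close>

definition grad :: "(real \<times> real \<Rightarrow> real) \<Rightarrow> (real \<times> real \<Rightarrow> real \<times> real)" where
  "grad p = (SOME g. L2 g \<and> weak_gradient p g)"

definition H1_norm :: "(real \<times> real \<Rightarrow> real) \<Rightarrow> real" where
  "H1_norm p = sqrt ((L2_norm p)\<^sup>2 + (L2_norm (grad p))\<^sup>2)"

definition H10 :: "(real \<times> real \<Rightarrow> real) set" where
  "H10 = {p \<in> H1. \<exists>\<phi>. (\<forall>k::nat. test_function (\<phi> k)) \<and> (\<lambda>k. H1_norm (\<lambda>z. p z - \<phi> k z)) \<longlonglongrightarrow> 0}"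

definition V_norm :: "(real \<times> real \<Rightarrow> real) \<Rightarrow> real" where
  "V_norm p = L2_norm (grad p)"

text \<open>
  Linearity and boundedness force a functional in \<open>V_dual\<close> to take the same value on
  representatives that agree almost everywhere in \<open>D\<close>.
\<close>

definition V_dual :: "((real \<times> real \<Rightarrow> real) \<Rightarrow> real) set" where
  "V_dual = {l. (\<forall>p\<in>H10. \<forall>q\<in>H10. l (\<lambda>z. p z + q z) = l p + l q) \<and>
     (\<forall>c. \<forall>p\<in>H10. l (\<lambda>z. c * p z) = c * l p) \<and>
     (\<exists>B. \<forall>p\<in>H10. \<bar>l p\<bar> \<le> B * V_norm p)}"

definition weak_solution ::
    "((real \<times> real \<Rightarrow> real) \<Rightarrow> real) \<Rightarrow> (real \<times> real \<Rightarrow> real) \<Rightarrow> (real \<times> real \<Rightarrow> real) \<Rightarrow> bool" where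
  "weak_solution f \<kappa> p \<longleftrightarrow> p \<in> H10 \<and>
     (\<forall>v\<in>H10. (LINT z|lebesgue_on dom_D. \<kappa> z * (grad p z \<bullet> grad v z)) = f v)"

text \<open>
  For \<open>\<kappa>\<close> essentially bounded with positive essential infimum, the weak solution exists and is
  unique up to null sets.
\<close>

definition G_map ::
    "((real \<times> real \<Rightarrow> real) \<Rightarrow> real) \<Rightarrow> (real \<times> real \<Rightarrow> real) \<Rightarrow> (real \<times> real \<Rightarrow> real)" where
  "G_map f \<kappa> = (SOME p. weak_solution f \<kappa> p)"

text \<open>
  A geometry is a map \<open>R\<close> sending the geometric parameter \<open>u\<^sub>g\<close> and the index \<open>i\<close> to the
  region \<open>D\<^sub>i\<close>. The second component of \<open>u\<close> is the vector of log-permeabilities.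
\<close>

definition F_map :: "('g \<Rightarrow> 'n::finite \<Rightarrow> (real \<times> real) set) \<Rightarrow>
    'g \<times> (closed_square \<Rightarrow>\<^sub>C (real^'n)) \<Rightarrow> (real \<times> real \<Rightarrow> real)" where
  "F_map R u = (\<lambda>z. \<Sum>i\<in>UNIV. exp (comp_field i (snd u) (at_point z)) * indicator (R (fst u) i) z)"

definition obs_map :: "((real \<times> real \<Rightarrow> real) \<Rightarrow> real) \<Rightarrow>
    ('j::finite \<Rightarrow> (real \<times> real \<Rightarrow> real) \<Rightarrow> real) \<Rightarrow> ('g \<Rightarrow> 'n::finite \<Rightarrow> (real \<times> real) set) \<Rightarrow>
    'g \<times> (closed_square \<Rightarrow>\<^sub>C (real^'n)) \<Rightarrow> real^'j" where
  "obs_map f l R u = (\<chi> j. l j (G_map f (F_map R u)))"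

section \<open>Geometries\<close>

text \<open>
  In the layer model the finite linear orders \<open>'k\<close> and \<open>'n\<close> index the \<open>n - 1\<close> interfaces and the
  \<open>n\<close> layers from top to bottom, so \<open>CARD('n) = CARD('k) + 1\<close>.
  A parameter is a triple \<open>(a, b, c)\<close>.
\<close>

definition number :: "'i::{finite,linorder} \<Rightarrow> nat" where
  "number i = card {j. j \<le> i}"

definition thickness_set :: "(real^'k) set" where
  "thickness_set = {x. (\<Sum>i\<in>UNIV. x $ i) \<le> 1 \<and> (\<forall>i. 0 \<le> x $ i)}"

type_synonym 'k layer_param = "(real, 'k) vec \<times> (real, 'k) vec \<times> real"

definition layer_params :: "real \<Rightarrow> 'k::finite layer_param set" where
  "layer_params cstar = thickness_set \<times> thickness_set \<times> {-cstar..cstar}"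

definition layer_height :: "real^'k::{finite,linorder} \<Rightarrow> real^'k::{finite,linorder} \<Rightarrow>
    nat \<Rightarrow> real \<Rightarrow> real" where
  "layer_height a b i x = (\<Sum>k | number k \<le> i. b $ k * (1 - x) + a $ k * x)"

definition interface_depth :: "'k::{finite,linorder} layer_param \<Rightarrow> nat \<Rightarrow> real \<Rightarrow> ereal" where
  "interface_depth = (\<lambda>(a, b, c) i x.
     if i = 0 then - \<infinity>
     else if i = CARD('k) + 1 then \<infinity>
     else if x < 1/2 then ereal (layer_height a b i x + c)
     else ereal (layer_height a b i x))"

definition layer_region :: "'k::{finite,linorder} layer_param \<Rightarrow>
    'n::{finite,linorder} \<Rightarrow> (real \<times> real) set" where
  "layer_region u\<^sub>g i = {(x, y) \<in> dom_D. x \<noteq> 1/2 \<and>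
     interface_depth u\<^sub>g (number i - 1) x < ereal (1 - y) \<and>
     ereal (1 - y) < interface_depth u\<^sub>g (number i) x}"

definition channel_curve :: "real^5 \<Rightarrow> real \<Rightarrow> real" where
  "channel_curve d x = d $ 1 * sin (d $ 2 * x) + tan (d $ 3) * x + d $ 4"

definition channel :: "real^5 \<Rightarrow> (real \<times> real) set" where
  "channel d = {(x, y) \<in> dom_D. channel_curve d x < y \<and> y < channel_curve d x + d $ 5}"

definition channel_region :: "real^5 \<Rightarrow> 2 \<Rightarrow> (real \<times> real) set" where
  "channel_region d i = (if i = 1 then channel d else dom_D - closure (channel d))"

definition channel_params :: "real^5 \<Rightarrow> real^5 \<Rightarrow> (real^5) set" where
  "channel_params dm dp = {d. \<forall>i. d $ i \<in> {dm $ i..dp $ i}}"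

section \<open>Prior, likelihood and posterior\<close>

text \<open>The one-dimensional normal law; a vanishing variance gives a point mass.\<close>

definition normal_law :: "real \<Rightarrow> real \<Rightarrow> real measure" where
  "normal_law m v = (if v = 0 then return borel m else density lborel (normal_density m (sqrt v)))"

text \<open>
  The Gaussian measure \<open>N(m, C)\<close> on a Banach space; the covariance operator acts on the dual and
  satisfies \<open>\<phi> (C \<psi>) = Cov(\<phi>, \<psi>)\<close>.
\<close>

definition gaussian_measure ::
    "'a::real_normed_vector \<Rightarrow> (('a \<Rightarrow>\<^sub>L real) \<Rightarrow>\<^sub>L 'a) \<Rightarrow> 'a measure \<Rightarrow> bool" where
  "gaussian_measure m C M \<longleftrightarrow> sets M = sets borel \<and> prob_space M \<and>
     (\<forall>\<phi> \<psi>. blinfun_apply \<phi> (blinfun_apply C \<psi>) = blinfun_apply \<psi> (blinfun_apply C \<phi>)) \<and>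
     (\<forall>\<phi>. 0 \<le> blinfun_apply \<phi> (blinfun_apply C \<phi>)) \<and>
     (\<forall>\<phi>. distr M borel (blinfun_apply \<phi>) =
        normal_law (blinfun_apply \<phi> m) (blinfun_apply \<phi> (blinfun_apply C \<phi>)))"

text \<open>
  The prior is a probability measure on the Borel sets of \<open>U = Ug \<times> UNIV\<close>. The last clause is the
  joint independence of \<open>u\<^sub>g\<close> (index \<open>None\<close>) and the fields \<open>log \<kappa>\<^sub>i\<close> (index \<open>Some i\<close>).
\<close>

definition is_prior :: "'g::euclidean_space set \<Rightarrow> ('n::finite \<Rightarrow> closed_square \<Rightarrow>\<^sub>C real) \<Rightarrow>
    ('n \<Rightarrow> ((closed_square \<Rightarrow>\<^sub>C real) \<Rightarrow>\<^sub>L real) \<Rightarrow>\<^sub>L (closed_square \<Rightarrow>\<^sub>C real)) \<Rightarrow>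
    ('g \<times> (closed_square \<Rightarrow>\<^sub>C (real^'n))) measure \<Rightarrow> bool" where
  "is_prior Ug m C \<mu>0 \<longleftrightarrow>
     prob_space \<mu>0 \<and> sets \<mu>0 = sets (restrict_space borel (Ug \<times> UNIV)) \<and>
     distr \<mu>0 borel fst = uniform_measure lborel Ug \<and>
     (\<forall>i. gaussian_measure (m i) (C i) (distr \<mu>0 borel (\<lambda>u. comp_field i (snd u)))) \<and>
     prob_space.indep_sets \<mu>0
       (\<lambda>k. case k of
          None \<Rightarrow> {fst -` A \<inter> space \<mu>0 | A. A \<in> sets borel}
        | Some i \<Rightarrow> {(\<lambda>u. comp_field i (snd u)) -` A \<inter> space \<mu>0 | A. A \<in> sets borel})
       UNIV"

definition spd :: "real^'j^'j \<Rightarrow> bool" where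
  "spd \<Gamma> \<longleftrightarrow> transpose \<Gamma> = \<Gamma> \<and> (\<forall>v. v \<noteq> 0 \<longrightarrow> 0 < v \<bullet> (\<Gamma> *v v))"

definition matrix_sqrt :: "real^'j^'j \<Rightarrow> real^'j^'j" where
  "matrix_sqrt \<Gamma> = (THE R. spd R \<and> R ** R = \<Gamma>)"

definition norm_wrt :: "real^'j^'j \<Rightarrow> real^'j \<Rightarrow> real" where
  "norm_wrt \<Gamma> v = norm (matrix_inv (matrix_sqrt \<Gamma>) *v v)"

definition potential :: "real^'j^'j \<Rightarrow> ('u \<Rightarrow> real^'j) \<Rightarrow> 'u \<Rightarrow> real^'j \<Rightarrow> real" where
  "potential \<Gamma> \<G> u y = 1/2 * (norm_wrt \<Gamma> (y - \<G> u))\<^sup>2"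

definition evidence :: "real^'j^'j \<Rightarrow> ('u \<Rightarrow> real^'j) \<Rightarrow> 'u measure \<Rightarrow> real^'j \<Rightarrow> real" where
  "evidence \<Gamma> \<G> \<mu>0 y = (LINT u|\<mu>0. exp (- potential \<Gamma> \<G> u y))"

definition posterior :: "real^'j^'j \<Rightarrow> ('u \<Rightarrow> real^'j) \<Rightarrow> 'u measure \<Rightarrow> real^'j \<Rightarrow> 'u measure" where
  "posterior \<Gamma> \<G> \<mu>0 y =
     density \<mu>0 (\<lambda>u. ennreal (1 / evidence \<Gamma> \<G> \<mu>0 y * exp (- potential \<Gamma> \<G> u y)))"

section \<open>Metrics on measures\<close>

definition common_reference :: "'u measure \<Rightarrow> 'u measure \<Rightarrow> 'u measure \<Rightarrow> bool" where
  "common_reference \<nu> \<mu> \<mu>' \<longleftrightarrow> sigma_finite_measure \<nu> \<and>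
     sets \<mu> = sets \<nu> \<and> sets \<mu>' = sets \<nu> \<and>
     absolutely_continuous \<nu> \<mu> \<and> absolutely_continuous \<nu> \<mu>'"

definition d_TV :: "'u measure \<Rightarrow> 'u measure \<Rightarrow> 'u measure \<Rightarrow> real" where
  "d_TV \<nu> \<mu> \<mu>' =
     1/2 * (LINT u|\<nu>. \<bar>enn2real (RN_deriv \<nu> \<mu> u) - enn2real (RN_deriv \<nu> \<mu>' u)\<bar>)"

definition d_Hell :: "'u measure \<Rightarrow> 'u measure \<Rightarrow> 'u measure \<Rightarrow> real" where
  "d_Hell \<nu> \<mu> \<mu>' =
     sqrt (1/2 * (LINT u|\<nu>.
       (sqrt (enn2real (RN_deriv \<nu> \<mu> u)) - sqrt (enn2real (RN_deriv \<nu> \<mu>' u)))\<^sup>2))"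

end

theory Submission
  imports Defs "HOL-Real_Asymp.Real_Asymp"
begin

text \<open>
  The forward map is continuous, hence Borel measurable, and the likelihood depends on the data in a
  Lipschitz way with a constant that is uniform in \<open>u\<close>; these two facts give the theorem.

  Continuity. Off a null set of points \<open>z\<close> (the boundaries of the regions), the region containing \<open>z\<close> does not
  change under small changes of the geometric parameter (\<open>layer_region_stable\<close>,
  \<open>channel_region_stable\<close>). So if \<open>u\<^sub>k\<close> tends to \<open>u\<close>, the permeabilities converge almost everywhere,
  within common bounds \<open>0 < c \<le> \<kappa> \<le> K\<close>. Testing the difference of the weak formulations with
  the difference of the solutions bounds its norm in \<open>V\<close> by the norm of \<open>(\<kappa> - \<kappa>\<^sub>k) \<nabla>p\<close> in
  \<open>L\<^sup>2\<close>, which tends to \<open>0\<close> by dominated convergence (\<open>weak_solution_functional_tendsto\<close>).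

  The solution operator picks a weak solution, so weak solutions must be shown to exist. This is the
  Riesz representation theorem for the energy form on \<open>V\<close>. It needs that \<open>V\<close> is complete
  (\<open>V_complete\<close>), which comes from the completeness of \<open>L\<^sup>2\<close> and the Poincare inequality, and that the
  gradient is a well-defined linear operator, which comes from the fundamental lemma of the calculus
  of variations (\<open>AE_eq_0_if_test_integrals_0\<close>) and an explicit family of smooth bumps.

  Lipschitz dependence. The function \<open>s \<mapsto> exp (- s\<^sup>2 / 2)\<close> is Lipschitz on the whole line, and the
  misfit \<open>|y - G(u)|\<close> is Lipschitz in \<open>y\<close> by the triangle inequality. So the likelihood, its
  square root and the evidence \<open>Z(y)\<close> are Lipschitz in \<open>y\<close>. For \<open>|y| < r\<close> the evidence is at least
  the integral of \<open>exp (- (r + |G(u)|)\<^sup>2 / 2)\<close>, a positive number. The densities of the posteriors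
  and their square roots therefore differ by at most a multiple of \<open>|y - y'|\<close>, uniformly in \<open>u\<close>
  (\<open>posterior_Lipschitz\<close>). Neither distance depends on the reference measure
  (\<open>distances_via_prior\<close>).
\<close>

section \<open>Square-integrable functions on \<open>D\<close>\<close>

abbreviation leb_D :: "(real \<times> real) measure" where
  "leb_D \<equiv> lebesgue_on dom_D"

lemma dom_D_box: "dom_D = box (0, 0) (1, 1)"
  by (auto simp: dom_D_def box_prod greaterThanLessThan_def box_real)

lemma open_dom_D: "open dom_D"
  unfolding dom_D_box by (rule open_box)

lemma dom_D_borel [measurable]: "dom_D \<in> sets borel"
  by (simp add: open_dom_D)

lemma finite_measure_leb_D: "finite_measure leb_D"
  by (rule finite_measure_lebesgue_on) (simp add: dom_D_box)

interpretation leb_D: finite_measure leb_D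
  by (rule finite_measure_leb_D)

lemma borel_measurable_leb_D:
  fixes f :: "real \<times> real \<Rightarrow> 'a::topological_space"
  shows "f \<in> borel_measurable borel \<Longrightarrow> f \<in> borel_measurable leb_D"
  by (intro measurable_restrict_space1 measurable_completion) simp

lemma L2_measurable: "L2 g \<Longrightarrow> g \<in> borel_measurable leb_D"
  by (simp add: L2_def)

lemma L2_integrable_power2: "L2 g \<Longrightarrow> integrable leb_D (\<lambda>z. (norm (g z))\<^sup>2)"
  by (simp add: L2_def)

lemma L2_norm_nonneg: "0 \<le> L2_norm g"
  by (simp add: L2_norm_def)

lemma power2_L2_norm: "(L2_norm g)\<^sup>2 = (LINT z|leb_D. (norm (g z))\<^sup>2)"
  by (simp add: L2_norm_def)

lemma L2_norm_cong_AE: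
  assumes "L2 g" "L2 h" "AE z in leb_D. g z = h z"
  shows "L2_norm g = L2_norm h"
proof -
  have "(LINT z|leb_D. (norm (g z))\<^sup>2) = (LINT z|leb_D. (norm (h z))\<^sup>2)"
    using assms by (intro integral_cong_AE) (auto simp: L2_def)
  then show ?thesis
    by (simp add: L2_norm_def)
qed

lemma L2_dominated:
  fixes g :: "real \<times> real \<Rightarrow> 'a::euclidean_space" and h :: "real \<times> real \<Rightarrow> 'b::euclidean_space"
  assumes "L2 h" "g \<in> borel_measurable leb_D" "AE z in leb_D. norm (g z) \<le> c * norm (h z)"
  shows "L2 g"
  unfolding L2_def
proof (intro conjI)
  show "integrable leb_D (\<lambda>z. (norm (g z))\<^sup>2)"
  proof (rule Bochner_Integration.integrable_bound)
    show "integrable leb_D (\<lambda>z. c\<^sup>2 * (norm (h z))\<^sup>2)"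
      using L2_integrable_power2[OF assms(1)] by simp
    show "AE z in leb_D. norm ((norm (g z))\<^sup>2) \<le> norm (c\<^sup>2 * (norm (h z))\<^sup>2)"
      using assms(3)
    proof eventually_elim
      case (elim z)
      then have "(norm (g z))\<^sup>2 \<le> (c * norm (h z))\<^sup>2"
        by (rule power_mono) simp
      then show ?case
        by (simp add: power_mult_distrib)
    qed
  qed (use assms(2) in measurable)
qed (fact assms(2))

lemma L2_norm_mono:
  fixes g :: "real \<times> real \<Rightarrow> 'a::euclidean_space" and h :: "real \<times> real \<Rightarrow> 'b::euclidean_space"
  assumes "L2 g" "L2 h" "AE z in leb_D. norm (g z) \<le> c * norm (h z)" "0 \<le> c"
  shows "L2_norm g \<le> c * L2_norm h"
proof -
  have "(L2_norm g)\<^sup>2 \<le> (LINT z|leb_D. c\<^sup>2 * (norm (h z))\<^sup>2)"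
    unfolding power2_L2_norm
  proof (rule integral_mono_AE[OF L2_integrable_power2[OF assms(1)]])
    show "integrable leb_D (\<lambda>z. c\<^sup>2 * (norm (h z))\<^sup>2)"
      using L2_integrable_power2[OF assms(2)] by simp
    show "AE z in leb_D. (norm (g z))\<^sup>2 \<le> c\<^sup>2 * (norm (h z))\<^sup>2"
      using assms(3)
    proof eventually_elim
      case (elim z)
      then show ?case
        using power_mono[of "norm (g z)" "c * norm (h z)" 2] by (simp add: power_mult_distrib)
    qed
  qed
  also have "\<dots> = (c * L2_norm h)\<^sup>2"
    by (simp add: power_mult_distrib power2_L2_norm)
  finally show ?thesis
    by (rule power2_le_imp_le) (simp add: assms(4) L2_norm_nonneg)
qed

lemma L2_bounded:
  fixes g :: "real \<times> real \<Rightarrow> 'a::euclidean_space"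
  assumes "g \<in> borel_measurable leb_D" "AE z in leb_D. norm (g z) \<le> c"
  shows "L2 g"
proof (rule L2_dominated[where h = "\<lambda>_. 1::real" and c = c])
  show "L2 (\<lambda>_::real \<times> real. 1::real)"
    by (simp add: L2_def)
qed (use assms in auto)

lemma L2_norm_mult_integrable:
  fixes g :: "real \<times> real \<Rightarrow> 'a::euclidean_space" and h :: "real \<times> real \<Rightarrow> 'b::euclidean_space"
  assumes "L2 g" "L2 h"
  shows "integrable leb_D (\<lambda>z. norm (g z) * norm (h z))"
proof (rule Bochner_Integration.integrable_bound)
  show "integrable leb_D (\<lambda>z. (norm (g z))\<^sup>2 + (norm (h z))\<^sup>2)"
    using assms by (simp add: L2_def)
  show "(\<lambda>z. norm (g z) * norm (h z)) \<in> borel_measurable leb_D"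
    using L2_measurable[OF assms(1)] L2_measurable[OF assms(2)] by measurable
  show "AE z in leb_D. norm (norm (g z) * norm (h z)) \<le> norm ((norm (g z))\<^sup>2 + (norm (h z))\<^sup>2)"
  proof (rule AE_I2)
    fix z
    have "2 * (norm (g z) * norm (h z)) \<le> (norm (g z))\<^sup>2 + (norm (h z))\<^sup>2"
      using sum_squares_bound[of "norm (g z)" "norm (h z)"] by (simp add: mult.assoc)
    moreover have "0 \<le> norm (g z) * norm (h z)" by simp
    ultimately have "norm (g z) * norm (h z) \<le> (norm (g z))\<^sup>2 + (norm (h z))\<^sup>2"
      by linarith
    then show "norm (norm (g z) * norm (h z)) \<le> norm ((norm (g z))\<^sup>2 + (norm (h z))\<^sup>2)"
      by simp
  qed
qed

text \<open>The discriminant inequality; for \<open>0 < c\<close> the polynomial takes its minimum at \<open>t = b / c\<close>.\<close>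

lemma quadratic_nonneg_imp:
  fixes a b c :: real
  assumes "\<And>t. 0 \<le> a - 2 * t * b + t\<^sup>2 * c" "0 \<le> c"
  shows "b\<^sup>2 \<le> a * c"
proof (cases "c = 0")
  case True
  have "b = 0"
  proof (rule ccontr)
    assume "b \<noteq> 0"
    \<comment> \<open>At this \<open>t\<close> the polynomial, which is affine, takes the value \<open>- 1\<close>.\<close>
    then show False
      using assms(1)[of "(a + 1) / (2 * b)"] True by (simp add: field_simps)
  qed
  then show ?thesis
    using True by simp
next
  case False
  then have "0 \<le> (a - 2 * (b / c) * b + (b / c)\<^sup>2 * c) * c"
    using assms(1)[of "b / c"] assms(2) by (intro mult_nonneg_nonneg)
  also have "\<dots> = a * c - b\<^sup>2"
    using False by (simp add: field_simps power2_eq_square)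
  finally show ?thesis by simp
qed

lemma L2_Cauchy_Schwarz:
  fixes g :: "real \<times> real \<Rightarrow> 'a::euclidean_space" and h :: "real \<times> real \<Rightarrow> 'b::euclidean_space"
  assumes "L2 g" "L2 h"
  shows "(LINT z|leb_D. norm (g z) * norm (h z)) \<le> L2_norm g * L2_norm h"
proof -
  let ?I = "LINT z|leb_D. norm (g z) * norm (h z)"
  have "?I\<^sup>2 \<le> (L2_norm g)\<^sup>2 * (L2_norm h)\<^sup>2"
  proof (rule quadratic_nonneg_imp)
    fix t :: real
    have "(LINT z|leb_D. (norm (g z))\<^sup>2 - 2 * t * (norm (g z) * norm (h z)) + t\<^sup>2 * (norm (h z))\<^sup>2)
        = (L2_norm g)\<^sup>2 - 2 * t * ?I + t\<^sup>2 * (L2_norm h)\<^sup>2"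
      unfolding power2_L2_norm
      using L2_integrable_power2[OF assms(1)] L2_integrable_power2[OF assms(2)]
        L2_norm_mult_integrable[OF assms] by simp
    moreover have "0 \<le> (LINT z|leb_D.
        (norm (g z))\<^sup>2 - 2 * t * (norm (g z) * norm (h z)) + t\<^sup>2 * (norm (h z))\<^sup>2)"
    proof (rule integral_nonneg_AE, rule AE_I2)
      fix z
      have "(norm (g z))\<^sup>2 - 2 * t * (norm (g z) * norm (h z)) + t\<^sup>2 * (norm (h z))\<^sup>2
          = (norm (g z) - t * norm (h z))\<^sup>2"
        by (simp add: power2_eq_square algebra_simps)
      then show "0 \<le> (norm (g z))\<^sup>2 - 2 * t * (norm (g z) * norm (h z)) + t\<^sup>2 * (norm (h z))\<^sup>2"
        by simp
    qed
    ultimately show "0 \<le> (L2_norm g)\<^sup>2 - 2 * t * ?I + t\<^sup>2 * (L2_norm h)\<^sup>2"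
      by simp
  qed simp
  then have "?I\<^sup>2 \<le> (L2_norm g * L2_norm h)\<^sup>2"
    by (simp add: power_mult_distrib)
  then show ?thesis
    by (rule power2_le_imp_le) (simp add: L2_norm_nonneg)
qed

lemma L2_scaleR:
  fixes g :: "real \<times> real \<Rightarrow> 'a::euclidean_space"
  assumes "L2 g"
  shows "L2 (\<lambda>z. c *\<^sub>R g z)" and "L2_norm (\<lambda>z. c *\<^sub>R g z) = \<bar>c\<bar> * L2_norm g"
  using assms by (auto simp: L2_def L2_norm_def power_mult_distrib real_sqrt_mult)

lemma L2_add:
  fixes g h :: "real \<times> real \<Rightarrow> 'a::euclidean_space"
  assumes "L2 g" "L2 h"
  shows "L2 (\<lambda>z. g z + h z)" and "L2_norm (\<lambda>z. g z + h z) \<le> L2_norm g + L2_norm h"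
proof -
  have m: "(\<lambda>z. g z + h z) \<in> borel_measurable leb_D"
    using L2_measurable[OF assms(1)] L2_measurable[OF assms(2)] by measurable
  have i: "integrable leb_D (\<lambda>z. (norm (g z))\<^sup>2 + 2 * (norm (g z) * norm (h z)) + (norm (h z))\<^sup>2)"
    using L2_integrable_power2[OF assms(1)] L2_integrable_power2[OF assms(2)]
      L2_norm_mult_integrable[OF assms] by simp
  have le: "(norm (g z + h z))\<^sup>2 \<le> (norm (g z))\<^sup>2 + 2 * (norm (g z) * norm (h z)) + (norm (h z))\<^sup>2" for z
  proof -
    have "(norm (g z + h z))\<^sup>2 \<le> (norm (g z) + norm (h z))\<^sup>2"
      by (intro power_mono norm_triangle_ineq norm_ge_zero)
    then show ?thesis
      by (simp add: power2_eq_square algebra_simps)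
  qed
  show L: "L2 (\<lambda>z. g z + h z)"
    unfolding L2_def
  proof (intro conjI m Bochner_Integration.integrable_bound[OF i] AE_I2)
    fix z
    show "norm ((norm (g z + h z))\<^sup>2)
        \<le> norm ((norm (g z))\<^sup>2 + 2 * (norm (g z) * norm (h z)) + (norm (h z))\<^sup>2)"
      using le[of z] by simp
  qed (use m in measurable)
  have "(L2_norm (\<lambda>z. g z + h z))\<^sup>2
      \<le> (LINT z|leb_D. (norm (g z))\<^sup>2 + 2 * (norm (g z) * norm (h z)) + (norm (h z))\<^sup>2)"
    unfolding power2_L2_norm
    by (rule integral_mono[OF L2_integrable_power2[OF L] i le])
  also have "\<dots> = (L2_norm g)\<^sup>2 + 2 * (LINT z|leb_D. norm (g z) * norm (h z)) + (L2_norm h)\<^sup>2"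
    unfolding power2_L2_norm
    using L2_integrable_power2[OF assms(1)] L2_integrable_power2[OF assms(2)]
      L2_norm_mult_integrable[OF assms] by simp
  also have "\<dots> \<le> (L2_norm g + L2_norm h)\<^sup>2"
    using L2_Cauchy_Schwarz[OF assms] by (simp add: power2_eq_square algebra_simps)
  finally show "L2_norm (\<lambda>z. g z + h z) \<le> L2_norm g + L2_norm h"
    by (rule power2_le_imp_le) (simp add: L2_norm_nonneg)
qed

lemma L2_diff:
  fixes g h :: "real \<times> real \<Rightarrow> 'a::euclidean_space"
  assumes "L2 g" "L2 h"
  shows "L2 (\<lambda>z. g z - h z)"
  using L2_add(1)[OF assms(1) L2_scaleR(1)[OF assms(2), of "-1"]] by simp

lemma L2_norm_minus_commute: "L2_norm (\<lambda>z. g z - h z) = L2_norm (\<lambda>z. h z - g z)"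
  by (simp add: L2_norm_def norm_minus_commute)

lemma L2_scaleR_integral:
  fixes g :: "real \<times> real \<Rightarrow> 'a::euclidean_space" and a :: "real \<times> real \<Rightarrow> real"
  assumes "L2 a" "L2 g"
  shows "integrable leb_D (\<lambda>z. a z *\<^sub>R g z)"
    and "norm (LINT z|leb_D. a z *\<^sub>R g z) \<le> L2_norm a * L2_norm g"
proof -
  have m: "(\<lambda>z. a z *\<^sub>R g z) \<in> borel_measurable leb_D"
    using L2_measurable[OF assms(1)] L2_measurable[OF assms(2)] by measurable
  show "integrable leb_D (\<lambda>z. a z *\<^sub>R g z)"
    by (rule Bochner_Integration.integrable_bound[OF L2_norm_mult_integrable[OF assms] m]) simp
  have "norm (LINT z|leb_D. a z *\<^sub>R g z) \<le> (LINT z|leb_D. norm (a z) * norm (g z))"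
    using integral_norm_bound[of leb_D "\<lambda>z. a z *\<^sub>R g z"] by simp
  also have "\<dots> \<le> L2_norm a * L2_norm g"
    by (rule L2_Cauchy_Schwarz[OF assms])
  finally show "norm (LINT z|leb_D. a z *\<^sub>R g z) \<le> L2_norm a * L2_norm g" .
qed

lemma L2_inner_integral:
  fixes g h :: "real \<times> real \<Rightarrow> 'a::euclidean_space"
  assumes "L2 g" "L2 h"
  shows "integrable leb_D (\<lambda>z. g z \<bullet> h z)"
    and "\<bar>LINT z|leb_D. g z \<bullet> h z\<bar> \<le> L2_norm g * L2_norm h"
proof -
  have m: "(\<lambda>z. g z \<bullet> h z) \<in> borel_measurable leb_D"
    by (intro borel_measurable_inner L2_measurable assms)
  show i: "integrable leb_D (\<lambda>z. g z \<bullet> h z)"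
    by (rule Bochner_Integration.integrable_bound[OF L2_norm_mult_integrable[OF assms] m])
      (simp add: abs_mult Cauchy_Schwarz_ineq2)
  have "\<bar>LINT z|leb_D. g z \<bullet> h z\<bar> \<le> (LINT z|leb_D. norm (g z \<bullet> h z))"
    using integral_norm_bound[of leb_D "\<lambda>z. g z \<bullet> h z"] by simp
  also have "\<dots> \<le> (LINT z|leb_D. norm (g z) * norm (h z))"
    by (rule integral_mono[OF integrable_norm[OF i] L2_norm_mult_integrable[OF assms]])
      (simp add: Cauchy_Schwarz_ineq2)
  also have "\<dots> \<le> L2_norm g * L2_norm h"
    by (rule L2_Cauchy_Schwarz[OF assms])
  finally show "\<bar>LINT z|leb_D. g z \<bullet> h z\<bar> \<le> L2_norm g * L2_norm h" .
qed

lemma L2_integrable: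
  fixes g :: "real \<times> real \<Rightarrow> 'a::euclidean_space"
  assumes "L2 g"
  shows "integrable leb_D g" and "(LINT z|leb_D. norm (g z)) \<le> L2_norm (\<lambda>_. 1::real) * L2_norm g"
proof -
  have 1: "L2 (\<lambda>_::real \<times> real. 1::real)"
    by (rule L2_bounded[where c = 1]) auto
  show "integrable leb_D g"
    using L2_scaleR_integral(1)[OF 1 assms] by simp
  show "(LINT z|leb_D. norm (g z)) \<le> L2_norm (\<lambda>_. 1::real) * L2_norm g"
    using L2_Cauchy_Schwarz[OF 1 assms] by simp
qed

lemma fast_subsequence:
  fixes d :: "nat \<Rightarrow> nat \<Rightarrow> real"
  assumes "\<And>e. 0 < e \<Longrightarrow> \<exists>N. \<forall>m\<ge>N. \<forall>n\<ge>N. d m n < e"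
  obtains s :: "nat \<Rightarrow> nat" where "strict_mono s" "\<And>k. d (s (Suc k)) (s k) < (1/2) ^ k"
proof -
  have "\<exists>N. \<forall>k. \<forall>m\<ge>N k. \<forall>n\<ge>N k. d m n < (1/2) ^ k"
    using assms[of "(1/2) ^ _"] by (intro choice) auto
  then obtain N where N: "\<And>k m n. N k \<le> m \<Longrightarrow> N k \<le> n \<Longrightarrow> d m n < (1/2) ^ k"
    by blast
  define s where "s = rec_nat (N 0) (\<lambda>k r. max (Suc r) (N (Suc k)))"
  have s: "s (Suc k) = max (Suc (s k)) (N (Suc k))" for k
    by (simp add: s_def)
  have sN: "N k \<le> s k" for k
    by (cases k) (auto simp: s_def)
  have "strict_mono s"
    by (rule strict_monoI_Suc) (simp add: s less_max_iff_disj)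
  moreover have "d (s (Suc k)) (s k) < (1/2) ^ k" for k
  proof (rule N)
    show "N k \<le> s k" by (rule sN)
    then show "N k \<le> s (Suc k)" by (simp add: s le_max_iff_disj)
  qed
  ultimately show ?thesis by (rule that)
qed

text \<open>
  Riesz--Fischer. A subsequence whose successive distances are summable converges almost
  everywhere, because the sum of the absolute differences is integrable; Fatou's lemma turns the
  Cauchy estimate into convergence in mean square to the pointwise limit.
\<close>

lemma L2_complete:
  fixes g :: "nat \<Rightarrow> real \<times> real \<Rightarrow> 'a::euclidean_space"
  assumes L2: "\<And>k. L2 (g k)"
    and Cauchy: "\<And>e. 0 < e \<Longrightarrow> \<exists>N. \<forall>m\<ge>N. \<forall>n\<ge>N. L2_norm (\<lambda>z. g m z - g n z) < e"
  shows "\<exists>h. L2 h \<and> (\<lambda>k. L2_norm (\<lambda>z. g k z - h z)) \<longlonglongrightarrow> 0"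
proof -
  obtain s where s: "strict_mono s"
    and fast: "\<And>k. L2_norm (\<lambda>z. g (s (Suc k)) z - g (s k) z) < (1/2) ^ k"
    using fast_subsequence[OF Cauchy] by metis
  have [measurable]: "g k \<in> borel_measurable leb_D" for k
    by (rule L2_measurable[OF L2])
  let ?d = "\<lambda>k z. g (s (Suc k)) z - g (s k) z"
  have d: "L2 (?d k)" for k
    by (rule L2_diff[OF L2 L2])
  let ?c = "L2_norm (\<lambda>_. 1::real)"
  have int_d: "(LINT z|leb_D. norm (?d k z)) \<le> ?c * (1/2) ^ k" for k
    using L2_integrable(2)[OF d, of k] fast[of k] L2_norm_nonneg[of "\<lambda>_. 1::real"]
    by (meson less_imp_le mult_left_mono order_trans)
  have "(\<integral>\<^sup>+z. (\<Sum>k. ennreal (norm (?d k z))) \<partial>leb_D) = (\<Sum>k. \<integral>\<^sup>+z. ennreal (norm (?d k z)) \<partial>leb_D)"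
    by (rule nn_integral_suminf) measurable
  also have "\<dots> = (\<Sum>k. ennreal (LINT z|leb_D. norm (?d k z)))"
    by (intro suminf_cong nn_integral_eq_integral) (auto intro: L2_integrable(1)[OF d])
  also have "\<dots> \<le> (\<Sum>k. ennreal (?c * (1/2) ^ k))"
    by (intro suminf_le ennreal_leI int_d) auto
  also have "\<dots> = ennreal (\<Sum>k. ?c * (1/2) ^ k)"
    by (intro suminf_ennreal2) (auto intro!: mult_nonneg_nonneg L2_norm_nonneg summable_mult summable_geometric)
  also have "\<dots> < \<infinity>"
    by simp
  finally have "(\<integral>\<^sup>+z. (\<Sum>k. ennreal (norm (?d k z))) \<partial>leb_D) \<noteq> \<infinity>"
    by auto
  then have "AE z in leb_D. (\<Sum>k. ennreal (norm (?d k z))) \<noteq> \<infinity>"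
    by (intro nn_integral_PInf_AE) auto
  then have conv: "AE z in leb_D. convergent (\<lambda>k. g (s k) z)"
  proof eventually_elim
    case (elim z)
    then have "summable (\<lambda>k. norm (?d k z))"
      by (intro summable_suminf_not_top) (auto simp: top_ennreal_def)
    then have "summable (\<lambda>k. ?d k z)"
      by (rule summable_norm_cancel)
    then have "convergent (\<lambda>n. (\<Sum>k<n. ?d k z) + g (s 0) z)"
      by (intro convergent_add convergent_const) (simp add: summable_iff_convergent)
    moreover have "(\<Sum>k<n. ?d k z) + g (s 0) z = g (s n) z" for n
      using sum_lessThan_telescope[of "\<lambda>k. g (s k) z" n] by (simp add: algebra_simps)
    ultimately show ?case
      by simp
  qed
  define h where "h z = lim (\<lambda>k. g (s k) z)" for z
  have h_meas [measurable]: "h \<in> borel_measurable leb_D"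
    unfolding h_def by measurable
  have lim: "AE z in leb_D. (\<lambda>k. g (s k) z) \<longlonglongrightarrow> h z"
    using conv by eventually_elim (simp add: h_def convergent_LIMSEQ_iff)
  have Fatou: "(\<integral>\<^sup>+z. ennreal ((norm (g m z - h z))\<^sup>2) \<partial>leb_D) \<le> ennreal (e\<^sup>2)"
    if e: "0 < e" and N: "\<And>n. n \<ge> N \<Longrightarrow> L2_norm (\<lambda>z. g m z - g n z) < e" for m e N
  proof -
    have "(\<integral>\<^sup>+z. ennreal ((norm (g m z - h z))\<^sup>2) \<partial>leb_D)
        = (\<integral>\<^sup>+z. liminf (\<lambda>k. ennreal ((norm (g m z - g (s k) z))\<^sup>2)) \<partial>leb_D)"
    proof (rule nn_integral_cong_AE)
      show "AE z in leb_D. ennreal ((norm (g m z - h z))\<^sup>2)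
          = liminf (\<lambda>k. ennreal ((norm (g m z - g (s k) z))\<^sup>2))"
        using lim
      proof eventually_elim
        case (elim z)
        then have "(\<lambda>k. ennreal ((norm (g m z - g (s k) z))\<^sup>2)) \<longlonglongrightarrow> ennreal ((norm (g m z - h z))\<^sup>2)"
          by (intro tendsto_intros tendsto_ennrealI)
        then show ?case
          by (intro lim_imp_Liminf[symmetric]) auto
      qed
    qed
    also have "\<dots> \<le> liminf (\<lambda>k. \<integral>\<^sup>+z. ennreal ((norm (g m z - g (s k) z))\<^sup>2) \<partial>leb_D)"
      by (rule nn_integral_liminf) measurable
    also have "\<dots> \<le> liminf (\<lambda>k. ennreal (e\<^sup>2))"
    proof (rule Liminf_mono)
      show "\<forall>\<^sub>F k in sequentially. (\<integral>\<^sup>+z. ennreal ((norm (g m z - g (s k) z))\<^sup>2) \<partial>leb_D) \<le> ennreal (e\<^sup>2)"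
        using eventually_ge_at_top[of N]
      proof eventually_elim
        case (elim k)
        then have "N \<le> s k"
          using seq_suble[OF s, of k] by simp
        then have "(L2_norm (\<lambda>z. g m z - g (s k) z))\<^sup>2 \<le> e\<^sup>2"
          using N by (intro power_mono L2_norm_nonneg less_imp_le)
        moreover have "(\<integral>\<^sup>+z. ennreal ((norm (g m z - g (s k) z))\<^sup>2) \<partial>leb_D)
            = ennreal ((L2_norm (\<lambda>z. g m z - g (s k) z))\<^sup>2)"
          unfolding power2_L2_norm
          by (intro nn_integral_eq_integral L2_integrable_power2 L2_diff L2) auto
        ultimately show ?case
          by (simp add: ennreal_leI)
      qed
    qed
    also have "\<dots> = ennreal (e\<^sup>2)"
      by (simp add: Liminf_const)
    finally show ?thesis .
  qed
  have close: "L2 (\<lambda>z. g m z - h z) \<and> L2_norm (\<lambda>z. g m z - h z) \<le> e"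
    if e: "0 < e" and N: "\<And>n. n \<ge> N \<Longrightarrow> L2_norm (\<lambda>z. g m z - g n z) < e" for m e N
  proof
    have F: "(\<integral>\<^sup>+z. ennreal ((norm (g m z - h z))\<^sup>2) \<partial>leb_D) \<le> ennreal (e\<^sup>2)"
      by (rule Fatou[OF e]) (rule N)
    then have "(\<integral>\<^sup>+z. ennreal ((norm (g m z - h z))\<^sup>2) \<partial>leb_D) < \<infinity>"
      by (rule le_less_trans) simp
    then have "integrable leb_D (\<lambda>z. (norm (g m z - h z))\<^sup>2)"
      by (intro integrableI_nonneg) auto
    then show *: "L2 (\<lambda>z. g m z - h z)"
      by (simp add: L2_def)
    have "ennreal ((L2_norm (\<lambda>z. g m z - h z))\<^sup>2) \<le> ennreal (e\<^sup>2)"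
      using F unfolding power2_L2_norm
      by (subst (asm) nn_integral_eq_integral[OF L2_integrable_power2[OF *]]) auto
    then have "(L2_norm (\<lambda>z. g m z - h z))\<^sup>2 \<le> e\<^sup>2"
      by (simp add: ennreal_le_iff)
    then show "L2_norm (\<lambda>z. g m z - h z) \<le> e"
      using e by (auto intro: power2_le_imp_le)
  qed
  obtain N where N: "\<And>m n. N \<le> m \<Longrightarrow> N \<le> n \<Longrightarrow> L2_norm (\<lambda>z. g m z - g n z) < 1"
    using Cauchy[of 1] by auto
  have "L2 (\<lambda>z. g N z - h z)"
    using close[of 1 N N] N by auto
  then have "L2 h"
    using L2_diff[OF L2[of N], of "\<lambda>z. g N z - h z"] by simp
  moreover have "(\<lambda>k. L2_norm (\<lambda>z. g k z - h z)) \<longlonglongrightarrow> 0"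
  proof (rule LIMSEQ_I)
    fix e :: real
    assume "0 < e"
    then obtain N where "\<And>m n. N \<le> m \<Longrightarrow> N \<le> n \<Longrightarrow> L2_norm (\<lambda>z. g m z - g n z) < e / 2"
      using Cauchy[of "e / 2"] by auto
    then have half: "L2_norm (\<lambda>z. g m z - h z) \<le> e / 2" if "N \<le> m" for m
      using close[of "e / 2" N m] that \<open>0 < e\<close> by auto
    have "L2_norm (\<lambda>z. g m z - h z) < e" if "N \<le> m" for m
      using half[OF that] \<open>0 < e\<close> by linarith
    then show "\<exists>N. \<forall>m\<ge>N. norm (L2_norm (\<lambda>z. g m z - h z) - 0) < e"
      by (intro exI[of _ N]) (auto simp: L2_norm_nonneg)
  qed
  ultimately show ?thesis
    by blast
qed

section \<open>Smooth bumps and the fundamental lemma of the calculus of variations\<close>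

text \<open>
  The functions \<open>flat m\<close> are the terms that occur in the derivatives of \<open>exp (- 1/t)\<close>, continued by
  \<open>0\<close> to \<open>t \<le> 0\<close>: the span of the family is closed under differentiation.
\<close>

definition flat :: "nat \<Rightarrow> real \<Rightarrow> real" where
  "flat m t = (if t \<le> 0 then 0 else inverse t ^ m * exp (- inverse t))"

lemma flat_tendsto_0: "(flat m \<longlongrightarrow> 0) (at_right 0)"
proof -
  have "((\<lambda>t::real. inverse t ^ m / exp (inverse t)) \<longlongrightarrow> 0) (at_right 0)"
    by (rule filterlim_compose[OF tendsto_power_div_exp_0 filterlim_inverse_at_top_right])
  moreover have "\<forall>\<^sub>F t::real in at_right 0. inverse t ^ m / exp (inverse t) = flat m t"
    by (auto simp: eventually_at_right_field flat_def exp_minus field_simps intro!: exI[of _ 1])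
  ultimately show ?thesis
    by (rule Lim_transform_eventually)
qed

lemma DERIV_flat: "(flat m has_real_derivative flat (Suc (Suc m)) t - m * flat (Suc m) t) (at t)"
proof (cases t "0::real" rule: linorder_cases)
  case less
  have "(flat m has_real_derivative 0) (at t)"
    by (rule has_field_derivative_transform_within_open[of "\<lambda>_. 0" 0 t "{..<0}"])
      (use less in \<open>auto simp: flat_def\<close>)
  then show ?thesis
    using less by (simp add: flat_def)
next
  case greater
  let ?d = "inverse t ^ m * (exp (- inverse t) * (inverse t * inverse t)) +
    real m * inverse t ^ (m - 1) * - (inverse t * inverse t) * exp (- inverse t)"
  have D: "((\<lambda>t. inverse t ^ m * exp (- inverse t)) has_real_derivative ?d) (at t)"
    using greater by (auto intro!: derivative_eq_intros)
  have "?d = flat (Suc (Suc m)) t - m * flat (Suc m) t"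
    using greater by (cases m) (auto simp: flat_def algebra_simps)
  with D have "((\<lambda>t. inverse t ^ m * exp (- inverse t)) has_real_derivative
      flat (Suc (Suc m)) t - m * flat (Suc m) t) (at t)"
    by metis
  then show ?thesis
    by (rule has_field_derivative_transform_within_open[where S = "{0<..}"])
      (use greater in \<open>auto simp: flat_def\<close>)
next
  case equal
  have "((\<lambda>h. (flat m h - flat m 0) / (h - 0)) \<longlongrightarrow> 0) (at_right 0)"
  proof (rule Lim_transform_eventually[OF flat_tendsto_0])
    show "\<forall>\<^sub>F h in at_right 0. flat (Suc m) h = (flat m h - flat m 0) / (h - 0)"
      by (auto simp: eventually_at_right_field flat_def field_simps intro!: exI[of _ 1])
  qed
  moreover have "((\<lambda>h. (flat m h - flat m 0) / (h - 0)) \<longlongrightarrow> 0) (at_left 0)"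
  proof (rule Lim_transform_eventually[OF tendsto_const])
    show "\<forall>\<^sub>F h in at_left 0. 0 = (flat m h - flat m 0) / (h - 0)"
      by (auto simp: eventually_at_left_field flat_def intro!: exI[of _ "-1"])
  qed
  ultimately have "((\<lambda>h. (flat m h - flat m 0) / (h - 0)) \<longlongrightarrow> 0) (at 0)"
    by (simp add: filterlim_split_at_real)
  then have "(flat m has_real_derivative 0) (at 0)"
    by (simp add: has_field_derivative_iff)
  then show ?thesis
    using equal by (simp add: flat_def)
qed

text \<open>
  This class contains the bumps and is closed under partial derivatives, so that \<open>Ck k\<close> follows for its
  members by induction on \<open>k\<close>.
\<close>

inductive flat_algebra :: "(real \<times> real \<Rightarrow> real) \<Rightarrow> bool" where
  flat: "flat_algebra (\<lambda>z. flat m (v \<bullet> z + c))"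
| const: "flat_algebra (\<lambda>z. c)"
| add: "flat_algebra \<phi> \<Longrightarrow> flat_algebra \<psi> \<Longrightarrow> flat_algebra (\<lambda>z. \<phi> z + \<psi> z)"
| mult: "flat_algebra \<phi> \<Longrightarrow> flat_algebra \<psi> \<Longrightarrow> flat_algebra (\<lambda>z. \<phi> z * \<psi> z)"

lemma flat_algebra_GDERIV:
  assumes "flat_algebra \<phi>"
  shows "\<exists>g. (\<forall>z. GDERIV \<phi> z :> g z) \<and> flat_algebra (\<lambda>z. fst (g z)) \<and> flat_algebra (\<lambda>z. snd (g z))"
  using assms
proof induction
  case (flat m v c)
  let ?D = "\<lambda>t. flat (Suc (Suc m)) t + (- real m) * flat (Suc m) t"
  have "GDERIV (\<lambda>z. v \<bullet> z + c) z :> v" for z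
    unfolding gderiv_def by (auto intro!: derivative_eq_intros simp: inner_commute)
  moreover have "(flat m has_real_derivative ?D t) (at t)" for t
    using DERIV_flat[of m t] by simp
  ultimately have "GDERIV (\<lambda>z. flat m (v \<bullet> z + c)) z :> ?D (v \<bullet> z + c) *\<^sub>R v" for z
    by (rule GDERIV_DERIV_compose)
  moreover have "flat_algebra (\<lambda>z. ?D (v \<bullet> z + c) * a)" for a
    by (intro flat_algebra.intros)
  ultimately show ?case
    by (intro exI[of _ "\<lambda>z. ?D (v \<bullet> z + c) *\<^sub>R v"]) simp
next
  case (const c)
  show ?case
    by (intro exI[of _ "\<lambda>z. 0"]) (auto intro: GDERIV_const flat_algebra.const)
next
  case (add \<phi> \<psi>)
  then obtain g h where
    "\<forall>z. GDERIV \<phi> z :> g z" "flat_algebra (\<lambda>z. fst (g z))" "flat_algebra (\<lambda>z. snd (g z))"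
    "\<forall>z. GDERIV \<psi> z :> h z" "flat_algebra (\<lambda>z. fst (h z))" "flat_algebra (\<lambda>z. snd (h z))"
    by blast
  then show ?case
    by (intro exI[of _ "\<lambda>z. g z + h z"]) (auto intro: GDERIV_add flat_algebra.add)
next
  case (mult \<phi> \<psi>)
  then obtain g h where
    "\<forall>z. GDERIV \<phi> z :> g z" "flat_algebra (\<lambda>z. fst (g z))" "flat_algebra (\<lambda>z. snd (g z))"
    "\<forall>z. GDERIV \<psi> z :> h z" "flat_algebra (\<lambda>z. fst (h z))" "flat_algebra (\<lambda>z. snd (h z))"
    by blast
  with mult.hyps show ?case
    by (intro exI[of _ "\<lambda>z. \<phi> z *\<^sub>R h z + \<psi> z *\<^sub>R g z"])
      (auto intro: GDERIV_mult flat_algebra.add flat_algebra.mult)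
qed

lemma GDERIV_continuous_on:
  assumes "\<And>z. GDERIV \<phi> z :> g z"
  shows "continuous_on S \<phi>"
  using assms unfolding gderiv_def
  by (meson continuous_at_imp_continuous_on has_derivative_continuous)

lemma flat_algebra_Ck: "flat_algebra \<phi> \<Longrightarrow> Ck k \<phi>"
proof (induction k arbitrary: \<phi>)
  case 0
  then show ?case
    using flat_algebra_GDERIV GDERIV_continuous_on by (metis Ck.simps(1))
next
  case (Suc k)
  then show ?case
    using flat_algebra_GDERIV[of \<phi>] by auto
qed

lemma test_function_measurable: "test_function \<phi> \<Longrightarrow> \<phi> \<in> borel_measurable leb_D"
  using Ck.simps(1) borel_measurable_continuous_onI borel_measurable_leb_D
  unfolding test_function_def by metis

text \<open>
  The bumps converge pointwise to the indicator of the box: inside the box all four arguments of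
  \<open>flat 0\<close> tend to infinity, where \<open>flat 0\<close> tends to \<open>1\<close>. The shift by \<open>-1\<close> keeps the supports
  compact in the box.
\<close>

definition box_bump :: "real \<times> real \<Rightarrow> real \<times> real \<Rightarrow> nat \<Rightarrow> real \<times> real \<Rightarrow> real" where
  "box_bump a b n z =
     flat 0 (n * (fst z - fst a) - 1) * flat 0 (n * (fst b - fst z) - 1) *
     (flat 0 (n * (snd z - snd a) - 1) * flat 0 (n * (snd b - snd z) - 1))"

lemma mem_box_pair:
  "z \<in> box a b \<longleftrightarrow> fst a < fst z \<and> fst z < fst b \<and> snd a < snd z \<and> snd z < (snd b :: real)"
  for a b z :: "real \<times> real"
  by (cases a; cases b; cases z) (auto simp: box_prod box_real)

lemma mem_cbox_pair:
  "z \<in> cbox a b \<longleftrightarrow> fst a \<le> fst z \<and> fst z \<le> fst b \<and> snd a \<le> snd z \<and> snd z \<le> (snd b :: real)"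
  for a b z :: "real \<times> real"
  by (cases a; cases b; cases z) (auto simp: cbox_Pair_eq)

lemma flat_0_bounds: "0 \<le> flat 0 t" "flat 0 t \<le> 1"
  by (auto simp: flat_def)

lemma flat_0_zero: "t \<le> 0 \<Longrightarrow> flat 0 t = 0"
  by (simp add: flat_def)

lemma test_function_box_bump:
  assumes "box a b \<subseteq> dom_D" "0 < n"
  shows "test_function (box_bump a b n)"
proof -
  have e: "box_bump a b n = (\<lambda>z. flat 0 ((real n, 0) \<bullet> z + (- n * fst a - 1)) *
      flat 0 ((- real n, 0) \<bullet> z + (n * fst b - 1)) *
      (flat 0 ((0, real n) \<bullet> z + (- n * snd a - 1)) * flat 0 ((0, - real n) \<bullet> z + (n * snd b - 1))))"
    by (auto simp: box_bump_def inner_Pair fun_eq_iff algebra_simps)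
  have "flat_algebra (box_bump a b n)"
    unfolding e by (intro flat_algebra.mult flat_algebra.flat)
  moreover define K where
    "K = cbox (fst a + 1 / n, snd a + 1 / n) (fst b - 1 / n, snd b - 1 / n)"
  have "compact K"
    by (simp add: K_def)
  moreover have "K \<subseteq> dom_D"
  proof -
    have "K \<subseteq> box a b"
    proof
      fix z assume "z \<in> K"
      moreover have "0 < 1 / real n" using assms by simp
      ultimately show "z \<in> box a b"
        unfolding K_def mem_box_pair mem_cbox_pair fst_conv snd_conv by linarith
    qed
    then show ?thesis using assms by blast
  qed
  moreover have "box_bump a b n z = 0" if "z \<notin> K" for z
  proof -
    have le: "real n * s - 1 \<le> 0" if "s \<le> 1 / real n" for s
      using that assms(2) by (simp add: field_simps)
    consider "fst z - fst a \<le> 1 / n" | "fst b - fst z \<le> 1 / n"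
      | "snd z - snd a \<le> 1 / n" | "snd b - snd z \<le> 1 / n"
      using \<open>z \<notin> K\<close> unfolding K_def mem_cbox_pair fst_conv snd_conv by linarith
    then show ?thesis
      by cases (simp_all add: box_bump_def flat_0_zero[OF le])
  qed
  ultimately show ?thesis
    unfolding test_function_def using flat_algebra_Ck by blast
qed

lemma box_bump_bounds: "0 \<le> box_bump a b n z" "box_bump a b n z \<le> 1"
  unfolding box_bump_def by (intro mult_nonneg_nonneg mult_le_one flat_0_bounds)+

lemma box_bump_tendsto: "(\<lambda>n. box_bump a b n z) \<longlonglongrightarrow> indicator (box a b) z"
proof (cases "z \<in> box a b")
  case True
  have one: "(\<lambda>n. flat 0 (real n * s - 1)) \<longlonglongrightarrow> 1" if "0 < s" for s
  proof -
    have top: "filterlim (\<lambda>n. real n * s - 1) at_top sequentially"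
      using that by real_asymp
    have "((\<lambda>t. exp (- inverse t)) \<longlongrightarrow> exp (- 0)) (at_top :: real filter)"
      by (intro tendsto_intros tendsto_inverse_0_at_top filterlim_ident)
    then have "((\<lambda>t. exp (- inverse t)) \<longlongrightarrow> 1) (at_top :: real filter)"
      by simp
    then have "(flat 0 \<longlongrightarrow> 1) at_top"
      by (rule Lim_transform_eventually)
        (auto simp: flat_def eventually_at_top_linorder intro!: exI[of _ 1])
    then show ?thesis
      using top by (rule filterlim_compose)
  qed
  have "(\<lambda>n. box_bump a b n z) \<longlonglongrightarrow> 1 * 1 * (1 * 1)"
    unfolding box_bump_def
    using True by (intro tendsto_mult one) (auto simp: mem_box_pair)
  then show ?thesis
    using True by simp
next
  case False
  have "real n * s - 1 \<le> 0" if "s \<le> 0" for s n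
    using that mult_nonneg_nonpos[of "real n" s] by simp
  then have "box_bump a b n z = 0" for n
    using False by (auto simp: mem_box_pair box_bump_def not_less flat_0_zero)
  then show ?thesis
    using False by simp
qed

lemma AE_leb_D_lborel: "AE z in lborel. P z \<Longrightarrow> AE z in leb_D. P z"
  by (subst AE_restrict_space_iff) (auto dest: AE_completion)

text \<open>
  Testing against bumps makes the integral of \<open>h\<close> vanish on every box, and boxes form an
  intersection-stable generator of the Borel sets.
\<close>

lemma AE_eq_0_if_test_integrals_0:
  fixes h :: "real \<times> real \<Rightarrow> 'a::euclidean_space"
  assumes int: "integrable leb_D h"
    and zero: "\<And>\<phi>. test_function \<phi> \<Longrightarrow> (LINT z|leb_D. \<phi> z *\<^sub>R h z) = 0"
  shows "AE z in leb_D. h z = 0"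
proof -
  have h_meas [measurable]: "h \<in> borel_measurable leb_D"
    using int by simp
  have ind_meas [measurable]: "(indicator A :: real \<times> real \<Rightarrow> real) \<in> borel_measurable leb_D"
    if "A \<in> sets borel" for A
    using that by (intro borel_measurable_leb_D) simp
  have ind_int: "integrable leb_D (\<lambda>z. indicat_real A z *\<^sub>R h z)" if "A \<in> sets borel" for A
  proof (rule Bochner_Integration.integrable_bound[OF int])
    show "(\<lambda>z. indicat_real A z *\<^sub>R h z) \<in> borel_measurable leb_D"
      by (intro borel_measurable_scaleR ind_meas h_meas that)
  qed (auto simp: indicator_def)
  have sub: "(LINT z|leb_D. indicat_real (box a b) z *\<^sub>R h z) = 0" if "box a b \<subseteq> dom_D" for a b
  proof -
    \<comment> \<open>Index \<open>0\<close> is excluded because the margin of the support is \<open>1 / n\<close>.\<close>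
    let ?\<phi> = "\<lambda>n. box_bump a b (Suc n)"
    have "(\<lambda>n. LINT z|leb_D. ?\<phi> n z *\<^sub>R h z) \<longlonglongrightarrow> (LINT z|leb_D. indicat_real (box a b) z *\<^sub>R h z)"
    proof (rule integral_dominated_convergence[where w = "\<lambda>z. norm (h z)"])
      show "AE z in leb_D. (\<lambda>n. ?\<phi> n z *\<^sub>R h z) \<longlonglongrightarrow> indicat_real (box a b) z *\<^sub>R h z"
        by (intro AE_I2 tendsto_scaleR tendsto_const LIMSEQ_Suc box_bump_tendsto)
      show "AE z in leb_D. norm (?\<phi> n z *\<^sub>R h z) \<le> norm (h z)" for n
        using box_bump_bounds[of a b "Suc n"] by (intro AE_I2) (simp add: mult_left_le_one_le)
      show "(\<lambda>z. ?\<phi> n z *\<^sub>R h z) \<in> borel_measurable leb_D" for n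
        using test_function_measurable[OF test_function_box_bump[OF that, of "Suc n"]] by simp
    qed (use int in auto)
    moreover have "(LINT z|leb_D. ?\<phi> n z *\<^sub>R h z) = 0" for n
      by (intro zero test_function_box_bump that) simp
    ultimately show ?thesis
      by (simp add: LIMSEQ_const_iff)
  qed
  have box: "(LINT z|leb_D. indicat_real (box a b) z *\<^sub>R h z) = 0" for a b
  proof -
    obtain c d where cd: "box a b \<inter> dom_D = box c d"
      unfolding dom_D_box box_Int_box by blast
    have "(LINT z|leb_D. indicat_real (box a b) z *\<^sub>R h z) = (LINT z|leb_D. indicat_real (box c d) z *\<^sub>R h z)"
      by (rule Bochner_Integration.integral_cong) (auto simp: indicator_def cd[symmetric])
    also have "\<dots> = 0"
      using cd by (intro sub) auto
    finally show ?thesis .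
  qed
  have D: "(LINT z|leb_D. h z) = 0"
  proof -
    have "(LINT z|leb_D. h z) = (LINT z|leb_D. indicat_real (box (0, 0) (1, 1)) z *\<^sub>R h z)"
      by (rule Bochner_Integration.integral_cong) (auto simp: dom_D_box)
    then show ?thesis
      by (simp add: box)
  qed
  have borel: "(LINT z|leb_D. indicat_real A z *\<^sub>R h z) = 0" if "A \<in> sets borel" for A
  proof -
    let ?G = "range (\<lambda>(a, b). box a b :: (real \<times> real) set)"
    have sets: "sigma_sets UNIV ?G = sets borel"
      by (simp add: borel_eq_box)
    have "Int_stable ?G"
      by (auto simp: Int_stable_def box_Int_box)
    moreover have "?G \<subseteq> Pow UNIV" "A \<in> sigma_sets UNIV ?G"
      using that sets by auto
    ultimately show ?thesis
    proof (induction rule: sigma_sets_induct_disjoint)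
      case (basic A)
      then show ?case using box by auto
    next
      case empty
      show ?case by simp
    next
      case (compl A)
      have "(LINT z|leb_D. indicat_real (UNIV - A) z *\<^sub>R h z)
          = (LINT z|leb_D. h z - indicat_real A z *\<^sub>R h z)"
        by (rule Bochner_Integration.integral_cong) (auto simp: indicator_def)
      also have "\<dots> = 0"
        using compl int ind_int by (simp add: D sets)
      finally show ?case .
    next
      case (union A)
      then have A: "A i \<in> sets borel" for i
        using sets by auto
      have AD: "A i \<inter> dom_D \<in> sets leb_D" for i
        using A[of i] by (auto simp: sets_restrict_space)
      have eq: "(LINT z|leb_D. indicat_real B z *\<^sub>R h z) = (LINT z:B \<inter> dom_D|leb_D. h z)" for B
        unfolding set_lebesgue_integral_def
        by (rule Bochner_Integration.integral_cong) (auto simp: indicator_def)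
      have "(LINT z:(\<Union>i. A i \<inter> dom_D)|leb_D. h z) = (\<Sum>i. LINT z:A i \<inter> dom_D|leb_D. h z)"
      proof (rule lebesgue_integral_countable_add[OF AD])
        show "A i \<inter> dom_D \<inter> (A j \<inter> dom_D) = {}" if "i \<noteq> j" for i j
          using union(1) that by (auto simp: disjoint_family_on_def)
        show "set_integrable leb_D (\<Union>i. A i \<inter> dom_D) h"
          unfolding set_integrable_def
          using sets.countable_UN[of "\<lambda>i. A i \<inter> dom_D" UNIV leb_D] AD int
          by (intro integrable_mult_indicator) auto
      qed
      also have "\<dots> = 0"
        using union(3) by (simp add: eq[symmetric])
      finally show ?case
        by (simp add: eq)
    qed
  qed
  have "AE z in leb_D. h z = (\<lambda>_. 0) z"
  proof (rule leb_D.density_unique_banach[OF int])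
    fix A assume A: "A \<in> sets leb_D"
    then have "A \<in> sets lebesgue"
      by (auto simp: sets_restrict_space)
    then obtain S N N' where S: "A = S \<union> N" "N \<subseteq> N'" "N' \<in> null_sets lborel" "S \<in> sets lborel"
      by (rule sets_completionE)
    have A_meas: "indicat_real A \<in> borel_measurable leb_D"
      using A by simp
    have S_meas: "indicat_real S \<in> borel_measurable leb_D"
      using S(4) by (intro ind_meas) simp
    have "AE z in leb_D. z \<notin> N'"
      by (rule AE_leb_D_lborel) (rule AE_not_in[OF S(3)])
    then have "(LINT z|leb_D. indicat_real A z *\<^sub>R h z) = (LINT z|leb_D. indicat_real S z *\<^sub>R h z)"
      using S(1,2) by (intro integral_cong_AE borel_measurable_scaleR h_meas A_meas S_meas)
        (auto simp: indicator_def)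
    also have "\<dots> = 0"
      using S by (intro borel) simp
    finally show "(LINT z:A|leb_D. h z) = (LINT z:A|leb_D. 0)"
      by (simp add: set_lebesgue_integral_def)
  qed simp
  then show ?thesis by simp
qed

section \<open>Integration by parts and the Poincare inequality for test functions\<close>

lemma continuous_bounded_on_dom_D:
  fixes g :: "real \<times> real \<Rightarrow> 'a::real_normed_vector"
  assumes "continuous_on UNIV g"
  obtains c where "\<And>z. z \<in> dom_D \<Longrightarrow> norm (g z) \<le> c"
proof -
  have "compact (g ` cbox (0, 0) (1, 1))"
    by (intro compact_continuous_image continuous_on_subset[OF assms] compact_cbox subset_UNIV)
  then obtain c where "\<forall>w \<in> g ` cbox (0, 0) (1, 1). norm w \<le> c"
    using compact_imp_bounded bounded_iff by blast
  then have "\<And>z. z \<in> cbox (0, 0) (1, 1) \<Longrightarrow> norm (g z) \<le> c"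
    by blast
  moreover have "dom_D \<subseteq> cbox (0, 0) (1, 1)"
    unfolding dom_D_box by (rule box_subset_cbox)
  ultimately show ?thesis
    using that by blast
qed

lemma L2_continuous:
  fixes g :: "real \<times> real \<Rightarrow> 'a::euclidean_space"
  assumes "continuous_on UNIV g"
  shows "L2 g"
proof -
  obtain c where "\<And>z. z \<in> dom_D \<Longrightarrow> norm (g z) \<le> c"
    using continuous_bounded_on_dom_D[OF assms] by blast
  then have "AE z in leb_D. norm (g z) \<le> c"
    by (intro AE_I2) simp
  then show ?thesis
    by (rule L2_bounded[OF borel_measurable_leb_D[OF borel_measurable_continuous_onI[OF assms]]])
qed

lemma test_functionE:
  assumes "test_function \<phi>" "\<And>z. GDERIV \<phi> z :> \<psi> z"
  obtains K where "continuous_on UNIV \<phi>" "continuous_on UNIV \<psi>" "compact K" "K \<subseteq> dom_D"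
    "\<And>z. z \<notin> K \<Longrightarrow> \<phi> z = 0"
proof -
  obtain K where K: "compact K" "K \<subseteq> dom_D" "\<And>z. z \<notin> K \<Longrightarrow> \<phi> z = 0"
    using assms(1) by (auto simp: test_function_def)
  have "Ck (Suc 0) \<phi>"
    using assms(1) unfolding test_function_def by blast
  then obtain g where g: "\<And>z. GDERIV \<phi> z :> g z"
    "continuous_on UNIV (\<lambda>z. fst (g z))" "continuous_on UNIV (\<lambda>z. snd (g z))"
    by auto
  have "\<psi> z = g z" for z
  proof -
    have "(\<lambda>h. h \<bullet> \<psi> z) = (\<lambda>h. h \<bullet> g z)"
      using has_derivative_unique assms(2)[of z] g(1)[of z] unfolding gderiv_def by blast
    then show ?thesis
      by (metis inner_commute vector_eq_ldot)
  qed
  moreover have "continuous_on UNIV (\<lambda>z. (fst (g z), snd (g z)))"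
    by (intro continuous_on_Pair g)
  ultimately have "continuous_on UNIV \<psi>"
    by simp
  moreover have "continuous_on UNIV \<phi>"
    by (rule GDERIV_continuous_on[OF assms(2)])
  ultimately show ?thesis
    using K that by blast
qed

lemma test_function_gradient:
  assumes "test_function \<phi>"
  obtains \<psi> where "\<And>z. GDERIV \<phi> z :> \<psi> z"
proof -
  have "Ck (Suc 0) \<phi>"
    using assms unfolding test_function_def by blast
  then show ?thesis
    using that by auto
qed

text \<open>
  By Fubini, each component reduces to integrals of a derivative over segments that cross the square
  parallel to a side, and \<open>w\<close> vanishes at both ends of them.
\<close>

lemma integral_gradient_eq_0:
  assumes grad: "\<And>z. GDERIV w z :> g z" and cont: "continuous_on UNIV g"
    and supp: "K \<subseteq> dom_D" "\<And>z. z \<notin> K \<Longrightarrow> w z = 0"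
  shows "(LINT z|leb_D. g z) = 0"
proof -
  have w0: "w z = 0" if "z \<notin> dom_D" for z
    using supp that by blast
  have int: "integrable leb_D g"
    by (intro L2_integrable L2_continuous cont)
  have HK: "(LINT z|leb_D. f z) = integral (cbox (0, 0) (1, 1)) f"
    if "integrable leb_D f" for f :: "real \<times> real \<Rightarrow> real"
  proof -
    have "(LINT z|leb_D. f z) = integral dom_D f"
      by (rule lebesgue_integral_eq_integral[OF that]) simp
    also have "\<dots> = integral (box (0, 0) (1, 1)) f"
      by (simp only: dom_D_box)
    also have "\<dots> = integral (cbox (0, 0) (1, 1)) f"
      by (rule integral_open_interval)
    finally show ?thesis .
  qed
  have cont1: "continuous_on S (\<lambda>z. fst (g z))" and cont2: "continuous_on S (\<lambda>z. snd (g z))" for S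
    by (intro continuous_on_fst continuous_on_snd continuous_on_subset[OF cont] subset_UNIV)+
  have zero2: "integral {0..1} (\<lambda>y. snd (g (x, y))) = 0" for x
  proof -
    have "((\<lambda>y. w (x, y)) has_vector_derivative snd (g (x, y))) (at y within {0..1})" for y
    proof -
      have "((\<lambda>y. w (x, y)) has_derivative (\<lambda>h. (0, h) \<bullet> g (x, y))) (at y within {0..1})"
        using has_derivative_compose[of "Pair x" "Pair 0" y "{0..1}" w "\<lambda>h. h \<bullet> g (x, y)"]
          has_derivative_Pair[OF has_derivative_const has_derivative_ident] grad[of "(x, y)"]
        unfolding gderiv_def by blast
      then show ?thesis
        unfolding has_vector_derivative_def by (simp add: inner_prod_def mult.commute)
    qed
    then have "((\<lambda>y. snd (g (x, y))) has_integral (w (x, 1) - w (x, 0))) {0..1}"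
      by (intro fundamental_theorem_of_calculus) auto
    then have "((\<lambda>y. snd (g (x, y))) has_integral 0) {0..1}"
      by (simp add: w0 dom_D_def)
    then show ?thesis
      by blast
  qed
  have zero1: "integral {0..1} (\<lambda>x. fst (g (x, y))) = 0" for y
  proof -
    have "((\<lambda>x. w (x, y)) has_vector_derivative fst (g (x, y))) (at x within {0..1})" for x
    proof -
      have "((\<lambda>x. w (x, y)) has_derivative (\<lambda>h. (h, 0) \<bullet> g (x, y))) (at x within {0..1})"
        using has_derivative_compose[of "\<lambda>x. (x, y)" "\<lambda>h. (h, 0)" x "{0..1}" w "\<lambda>h. h \<bullet> g (x, y)"]
          has_derivative_Pair[OF has_derivative_ident has_derivative_const] grad[of "(x, y)"]
        unfolding gderiv_def by blast
      then show ?thesis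
        unfolding has_vector_derivative_def by (simp add: inner_prod_def mult.commute)
    qed
    then have "((\<lambda>x. fst (g (x, y))) has_integral (w (1, y) - w (0, y))) {0..1}"
      by (intro fundamental_theorem_of_calculus) auto
    then have "((\<lambda>x. fst (g (x, y))) has_integral 0) {0..1}"
      by (simp add: w0 dom_D_def)
    then show ?thesis
      by blast
  qed
  have "(LINT z|leb_D. fst (g z)) = integral (cbox (0, 0) (1, 1)) (\<lambda>z. fst (g z))"
    using integrable_bounded_linear[OF bounded_linear_fst int] by (rule HK)
  also have "\<dots> = integral (cbox 0 1) (\<lambda>x. integral (cbox 0 1) (\<lambda>y. fst (g (x, y))))"
    by (rule integral_prod_continuous[OF cont1])
  also have "\<dots> = integral (cbox 0 1) (\<lambda>y. integral (cbox 0 1) (\<lambda>x. fst (g (x, y))))"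
    using cont1 by (intro integral_swap_continuous) (simp add: case_prod_unfold)
  also have "\<dots> = 0"
    by (simp add: zero1)
  finally have 1: "fst (LINT z|leb_D. g z) = 0"
    using integral_bounded_linear[OF bounded_linear_fst int] by simp
  have "(LINT z|leb_D. snd (g z)) = integral (cbox (0, 0) (1, 1)) (\<lambda>z. snd (g z))"
    using integrable_bounded_linear[OF bounded_linear_snd int] by (rule HK)
  also have "\<dots> = integral (cbox 0 1) (\<lambda>x. integral (cbox 0 1) (\<lambda>y. snd (g (x, y))))"
    by (rule integral_prod_continuous[OF cont2])
  also have "\<dots> = 0"
    by (simp add: zero2)
  finally have "snd (LINT z|leb_D. g z) = 0"
    using integral_bounded_linear[OF bounded_linear_snd int] by simp
  with 1 show ?thesis
    by (simp add: prod_eq_iff)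
qed

lemma weak_gradient_test_function:
  assumes "test_function \<phi>" "\<And>z. GDERIV \<phi> z :> \<psi> z"
  shows "weak_gradient \<phi> \<psi>"
  unfolding weak_gradient_def
proof (intro allI impI)
  fix \<eta> \<zeta> assume \<eta>: "test_function \<eta> \<and> (\<forall>z. GDERIV \<eta> z :> \<zeta> z)"
  obtain K where K: "continuous_on UNIV \<phi>" "continuous_on UNIV \<psi>" "compact K" "K \<subseteq> dom_D"
    "\<And>z. z \<notin> K \<Longrightarrow> \<phi> z = 0"
    using test_functionE[OF assms] by metis
  have \<eta>c: "continuous_on UNIV \<eta>" "continuous_on UNIV \<zeta>"
    using test_functionE[of \<eta> \<zeta>] \<eta> by metis+
  have L2: "L2 \<phi>" "L2 \<psi>" "L2 \<eta>" "L2 \<zeta>"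
    using K \<eta>c by (auto intro: L2_continuous)
  have "(LINT z|leb_D. \<phi> z *\<^sub>R \<zeta> z + \<eta> z *\<^sub>R \<psi> z) = 0"
  proof (rule integral_gradient_eq_0[of "\<lambda>z. \<phi> z * \<eta> z"])
    show "GDERIV (\<lambda>z. \<phi> z * \<eta> z) z :> \<phi> z *\<^sub>R \<zeta> z + \<eta> z *\<^sub>R \<psi> z" for z
      using assms(2) \<eta> by (intro GDERIV_mult) blast+
    show "continuous_on UNIV (\<lambda>z. \<phi> z *\<^sub>R \<zeta> z + \<eta> z *\<^sub>R \<psi> z)"
      by (intro continuous_intros K \<eta>c)
  qed (use K in auto)
  then show "(LINT z|leb_D. \<phi> z *\<^sub>R \<zeta> z) = - (LINT z|leb_D. \<eta> z *\<^sub>R \<psi> z)"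
    by (simp add: Bochner_Integration.integral_add L2_scaleR_integral(1) L2 eq_neg_iff_add_eq_0)
qed

text \<open>
  The first component of the gradient of \<open>x \<phi>\<^sup>2\<close> is \<open>\<phi>\<^sup>2 + 2 x \<phi> \<partial>\<^sub>x\<phi>\<close>, and its integral vanishes; as
  \<open>0 < x < 1\<close> on \<open>D\<close>, the Cauchy--Schwarz inequality gives the bound.
\<close>

lemma Poincare_test_function:
  assumes "test_function \<phi>" "\<And>z. GDERIV \<phi> z :> \<psi> z"
  shows "L2_norm \<phi> \<le> 2 * L2_norm \<psi>"
proof -
  obtain K where K: "continuous_on UNIV \<phi>" "continuous_on UNIV \<psi>" "compact K" "K \<subseteq> dom_D"
    "\<And>z. z \<notin> K \<Longrightarrow> \<phi> z = 0"
    using test_functionE[OF assms] by metis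
  have L2: "L2 \<phi>" "L2 \<psi>"
    using K by (auto intro: L2_continuous)
  let ?g = "\<lambda>z. fst z *\<^sub>R (\<phi> z *\<^sub>R \<psi> z + \<phi> z *\<^sub>R \<psi> z) + (\<phi> z * \<phi> z) *\<^sub>R (1, 0)"
  have g_cont: "continuous_on UNIV ?g"
    by (intro continuous_intros K)
  have "(LINT z|leb_D. ?g z) = 0"
  proof (rule integral_gradient_eq_0[of "\<lambda>z. fst z * (\<phi> z * \<phi> z)"])
    have "GDERIV fst z :> (1, 0)" for z :: "real \<times> real"
      unfolding gderiv_def by (auto intro!: derivative_eq_intros simp: inner_prod_def)
    then show "GDERIV (\<lambda>z. fst z * (\<phi> z * \<phi> z)) z :> ?g z" for z
      using assms(2) by (intro GDERIV_mult)
  qed (use K g_cont in auto)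
  moreover have "(LINT z|leb_D. fst (?g z)) = fst (LINT z|leb_D. ?g z)"
    by (rule integral_bounded_linear[OF bounded_linear_fst])
      (intro L2_integrable L2_continuous g_cont)
  ultimately have "(LINT z|leb_D. 2 * fst z * \<phi> z * fst (\<psi> z) + (\<phi> z)\<^sup>2) = 0"
    by (simp add: power2_eq_square algebra_simps)
  moreover have i1: "integrable leb_D (\<lambda>z. 2 * fst z * \<phi> z * fst (\<psi> z))"
    by (intro L2_integrable L2_continuous continuous_intros K)
  moreover have "integrable leb_D (\<lambda>z. (\<phi> z)\<^sup>2)"
    using L2_integrable_power2[OF L2(1)] by simp
  ultimately have "(L2_norm \<phi>)\<^sup>2 = - (LINT z|leb_D. 2 * fst z * \<phi> z * fst (\<psi> z))"
    by (simp add: power2_L2_norm)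
  also have "\<dots> \<le> (LINT z|leb_D. \<bar>2 * fst z * \<phi> z * fst (\<psi> z)\<bar>)"
    using integral_abs_bound[of leb_D "\<lambda>z. 2 * fst z * \<phi> z * fst (\<psi> z)"] by linarith
  also have "\<dots> \<le> (LINT z|leb_D. 2 * (norm (\<phi> z) * norm (\<psi> z)))"
  proof (rule integral_mono)
    fix z assume "z \<in> space leb_D"
    then have "\<bar>fst z\<bar> \<le> 1"
      by (auto simp: dom_D_def)
    then have "\<bar>fst z\<bar> * (\<bar>\<phi> z\<bar> * \<bar>fst (\<psi> z)\<bar>) \<le> 1 * (\<bar>\<phi> z\<bar> * norm (\<psi> z))"
      using norm_fst_le[of "fst (\<psi> z)" "snd (\<psi> z)"] by (intro mult_mono) auto
    then show "\<bar>2 * fst z * \<phi> z * fst (\<psi> z)\<bar> \<le> 2 * (norm (\<phi> z) * norm (\<psi> z))"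
      by (simp add: abs_mult)
  qed (use i1 L2_norm_mult_integrable[OF L2] in auto)
  also have "\<dots> \<le> 2 * (L2_norm \<phi> * L2_norm \<psi>)"
    using L2_Cauchy_Schwarz[OF L2] by simp
  finally have "L2_norm \<phi> * L2_norm \<phi> \<le> L2_norm \<phi> * (2 * L2_norm \<psi>)"
    by (simp add: power2_eq_square)
  then show ?thesis
    using L2_norm_nonneg[of \<phi>] L2_norm_nonneg[of \<psi>]
    by (cases "L2_norm \<phi> = 0") (auto simp: mult_le_cancel_left)
qed

lemma Ck_add: "Ck k \<phi> \<Longrightarrow> Ck k \<psi> \<Longrightarrow> Ck k (\<lambda>z. \<phi> z + \<psi> z)"
proof (induction k arbitrary: \<phi> \<psi>)
  case 0
  then show ?case by (auto intro: continuous_intros)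
next
  case (Suc k)
  then obtain g h where "\<forall>z. GDERIV \<phi> z :> g z" "Ck k (\<lambda>z. fst (g z))" "Ck k (\<lambda>z. snd (g z))"
    "\<forall>z. GDERIV \<psi> z :> h z" "Ck k (\<lambda>z. fst (h z))" "Ck k (\<lambda>z. snd (h z))"
    by auto
  then show ?case
    using Suc.IH by (auto intro!: exI[of _ "\<lambda>z. g z + h z"] GDERIV_add)
qed

lemma GDERIV_cmult: "GDERIV \<phi> z :> d \<Longrightarrow> GDERIV (\<lambda>z. c * \<phi> z) z :> c *\<^sub>R d"
  using GDERIV_mult[OF GDERIV_const[of c z], of \<phi> d] by simp

lemma Ck_cmult: "Ck k \<phi> \<Longrightarrow> Ck k (\<lambda>z. c * \<phi> z)"
proof (induction k arbitrary: \<phi>)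
  case 0
  then show ?case by (auto intro: continuous_intros)
next
  case (Suc k)
  then obtain g where "\<forall>z. GDERIV \<phi> z :> g z" "Ck k (\<lambda>z. fst (g z))" "Ck k (\<lambda>z. snd (g z))"
    by auto
  then show ?case
    using Suc.IH by (auto intro!: exI[of _ "\<lambda>z. c *\<^sub>R g z"] GDERIV_cmult)
qed

lemma test_function_add:
  assumes "test_function \<phi>" "test_function \<psi>"
  shows "test_function (\<lambda>z. \<phi> z + \<psi> z)"
proof -
  obtain K L where "compact K" "K \<subseteq> dom_D" "\<forall>z. z \<notin> K \<longrightarrow> \<phi> z = 0"
    "compact L" "L \<subseteq> dom_D" "\<forall>z. z \<notin> L \<longrightarrow> \<psi> z = 0"
    using assms unfolding test_function_def by blast
  then have "compact (K \<union> L) \<and> K \<union> L \<subseteq> dom_D \<and> (\<forall>z. z \<notin> K \<union> L \<longrightarrow> \<phi> z + \<psi> z = 0)"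
    by auto
  then show ?thesis
    using assms Ck_add unfolding test_function_def by blast
qed

lemma test_function_cmult:
  assumes "test_function \<phi>"
  shows "test_function (\<lambda>z. c * \<phi> z)"
proof -
  obtain K where "compact K" "K \<subseteq> dom_D" "\<forall>z. z \<notin> K \<longrightarrow> \<phi> z = 0"
    using assms unfolding test_function_def by blast
  then have "compact K \<and> K \<subseteq> dom_D \<and> (\<forall>z. z \<notin> K \<longrightarrow> c * \<phi> z = 0)"
    by auto
  then show ?thesis
    using assms Ck_cmult unfolding test_function_def by blast
qed

section \<open>The space \<open>V\<close> as a Hilbert space\<close>

lemma integral_scaleR_tendsto:
  fixes g :: "nat \<Rightarrow> real \<times> real \<Rightarrow> 'a::euclidean_space" and a :: "nat \<Rightarrow> real \<times> real \<Rightarrow> real"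
  shows "(\<And>k. L2 (g k)) \<Longrightarrow> L2 h \<Longrightarrow> L2 b \<Longrightarrow> (\<lambda>k. L2_norm (\<lambda>z. h z - g k z)) \<longlonglongrightarrow> 0 \<Longrightarrow>
      (\<lambda>k. LINT z|leb_D. b z *\<^sub>R g k z) \<longlonglongrightarrow> (LINT z|leb_D. b z *\<^sub>R h z)"
    and "(\<And>k. L2 (a k)) \<Longrightarrow> L2 b \<Longrightarrow> L2 h \<Longrightarrow> (\<lambda>k. L2_norm (\<lambda>z. b z - a k z)) \<longlonglongrightarrow> 0 \<Longrightarrow>
      (\<lambda>k. LINT z|leb_D. a k z *\<^sub>R h z) \<longlonglongrightarrow> (LINT z|leb_D. b z *\<^sub>R h z)"
proof -
  assume g: "\<And>k. L2 (g k)" and h: "L2 h" and b: "L2 b"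
    and lim: "(\<lambda>k. L2_norm (\<lambda>z. h z - g k z)) \<longlonglongrightarrow> 0"
  show "(\<lambda>k. LINT z|leb_D. b z *\<^sub>R g k z) \<longlonglongrightarrow> (LINT z|leb_D. b z *\<^sub>R h z)"
  proof (rule Lim_transform2[OF tendsto_const], rule Lim_null_comparison)
    show "\<forall>\<^sub>F k in sequentially. norm ((LINT z|leb_D. b z *\<^sub>R h z) - (LINT z|leb_D. b z *\<^sub>R g k z))
        \<le> L2_norm b * L2_norm (\<lambda>z. h z - g k z)"
    proof (intro always_eventually allI)
      fix k
      have "(LINT z|leb_D. b z *\<^sub>R h z) - (LINT z|leb_D. b z *\<^sub>R g k z) = (LINT z|leb_D. b z *\<^sub>R (h z - g k z))"
        using L2_scaleR_integral(1)[OF b h] L2_scaleR_integral(1)[OF b g]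
        by (simp add: scaleR_diff_right)
      then show "norm ((LINT z|leb_D. b z *\<^sub>R h z) - (LINT z|leb_D. b z *\<^sub>R g k z))
          \<le> L2_norm b * L2_norm (\<lambda>z. h z - g k z)"
        using L2_scaleR_integral(2)[OF b L2_diff[OF h g]] by simp
    qed
    show "(\<lambda>k. L2_norm b * L2_norm (\<lambda>z. h z - g k z)) \<longlonglongrightarrow> 0"
      using tendsto_mult_left[OF lim, of "L2_norm b"] by simp
  qed
next
  assume a: "\<And>k. L2 (a k)" and b: "L2 b" and h: "L2 h"
    and lim: "(\<lambda>k. L2_norm (\<lambda>z. b z - a k z)) \<longlonglongrightarrow> 0"
  show "(\<lambda>k. LINT z|leb_D. a k z *\<^sub>R h z) \<longlonglongrightarrow> (LINT z|leb_D. b z *\<^sub>R h z)"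
  proof (rule Lim_transform2[OF tendsto_const], rule Lim_null_comparison)
    show "\<forall>\<^sub>F k in sequentially. norm ((LINT z|leb_D. b z *\<^sub>R h z) - (LINT z|leb_D. a k z *\<^sub>R h z))
        \<le> L2_norm (\<lambda>z. b z - a k z) * L2_norm h"
    proof (intro always_eventually allI)
      fix k
      have "(LINT z|leb_D. b z *\<^sub>R h z) - (LINT z|leb_D. a k z *\<^sub>R h z) = (LINT z|leb_D. (b z - a k z) *\<^sub>R h z)"
        using L2_scaleR_integral(1)[OF b h] L2_scaleR_integral(1)[OF a h]
        by (simp add: scaleR_diff_left)
      then show "norm ((LINT z|leb_D. b z *\<^sub>R h z) - (LINT z|leb_D. a k z *\<^sub>R h z))
          \<le> L2_norm (\<lambda>z. b z - a k z) * L2_norm h"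
        using L2_scaleR_integral(2)[OF L2_diff[OF b a] h] by simp
    qed
    show "(\<lambda>k. L2_norm (\<lambda>z. b z - a k z) * L2_norm h) \<longlonglongrightarrow> 0"
      using tendsto_mult_right[OF lim, of "L2_norm h"] by simp
  qed
qed

lemma weak_gradient_unique:
  assumes "L2 g" "L2 h" "weak_gradient p g" "weak_gradient p h"
  shows "AE z in leb_D. g z = h z"
proof -
  have "AE z in leb_D. g z - h z = 0"
  proof (rule AE_eq_0_if_test_integrals_0[OF L2_integrable(1)[OF L2_diff[OF assms(1,2)]]])
    fix \<phi> assume \<phi>: "test_function \<phi>"
    then obtain \<psi> where \<psi>: "\<And>z. GDERIV \<phi> z :> \<psi> z"
      using test_function_gradient by blast
    have L2: "L2 \<phi>"
      using test_functionE[OF \<phi> \<psi>] L2_continuous by metis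
    moreover have "(LINT z|leb_D. p z *\<^sub>R \<psi> z) = - (LINT z|leb_D. \<phi> z *\<^sub>R g z)"
      "(LINT z|leb_D. p z *\<^sub>R \<psi> z) = - (LINT z|leb_D. \<phi> z *\<^sub>R h z)"
      using assms(3,4) \<phi> \<psi> unfolding weak_gradient_def by blast+
    ultimately show "(LINT z|leb_D. \<phi> z *\<^sub>R (g z - h z)) = 0"
      using L2_scaleR_integral(1)[OF L2 assms(1)] L2_scaleR_integral(1)[OF L2 assms(2)]
      by (simp add: scaleR_diff_right)
  qed
  then show ?thesis by simp
qed

lemma grad_eqI:
  assumes "L2 g" "weak_gradient p g"
  shows "L2 (grad p)" "weak_gradient p (grad p)" "AE z in leb_D. grad p z = g z"
proof -
  have *: "L2 (grad p) \<and> weak_gradient p (grad p)"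
    unfolding grad_def by (rule someI[of _ g]) (use assms in blast)
  then show "L2 (grad p)" "weak_gradient p (grad p)" by auto
  show "AE z in leb_D. grad p z = g z"
    using * assms by (intro weak_gradient_unique[of _ _ p]) auto
qed

text \<open>
  The closure of the graph of the gradient on test functions. Its domain is \<open>H10\<close>, and linearity,
  completeness and the Poincare inequality pass to the closure.
\<close>

definition H10_graph :: "(real \<times> real \<Rightarrow> real) \<Rightarrow> (real \<times> real \<Rightarrow> real \<times> real) \<Rightarrow> bool" where
  "H10_graph p g \<longleftrightarrow> L2 p \<and> L2 g \<and> (\<forall>e>0. \<exists>\<phi> \<psi>. test_function \<phi> \<and> (\<forall>z. GDERIV \<phi> z :> \<psi> z) \<and>
     L2_norm (\<lambda>z. p z - \<phi> z) < e \<and> L2_norm (\<lambda>z. g z - \<psi> z) < e)"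

lemma test_function_L2:
  assumes "test_function \<phi>" "\<forall>z. GDERIV \<phi> z :> \<psi> z"
  shows "L2 \<phi>" "L2 \<psi>"
  using test_functionE[of \<phi> \<psi>] assms L2_continuous by metis+

lemma H10_graph_sequence:
  assumes "H10_graph p g"
  shows "\<exists>\<phi> \<psi>. (\<forall>k. test_function (\<phi> k)) \<and> (\<forall>k. \<forall>z. GDERIV (\<phi> k) z :> \<psi> k z) \<and>
    (\<lambda>k. L2_norm (\<lambda>z. p z - \<phi> k z)) \<longlonglongrightarrow> 0 \<and> (\<lambda>k. L2_norm (\<lambda>z. g z - \<psi> k z)) \<longlonglongrightarrow> 0"
proof -
  have "\<forall>k. \<exists>q. test_function (fst q) \<and> (\<forall>z. GDERIV (fst q) z :> snd q z) \<and>
      L2_norm (\<lambda>z. p z - fst q z) < inverse (real (Suc k)) \<and>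
      L2_norm (\<lambda>z. g z - snd q z) < inverse (real (Suc k))"
  proof
    fix k
    have "0 < inverse (real (Suc k))" by simp
    then obtain \<phi> \<psi> where "test_function \<phi>" "\<forall>z. GDERIV \<phi> z :> \<psi> z"
      "L2_norm (\<lambda>z. p z - \<phi> z) < inverse (real (Suc k))"
      "L2_norm (\<lambda>z. g z - \<psi> z) < inverse (real (Suc k))"
      using assms unfolding H10_graph_def by blast
    then show "\<exists>q. test_function (fst q) \<and> (\<forall>z. GDERIV (fst q) z :> snd q z) \<and>
      L2_norm (\<lambda>z. p z - fst q z) < inverse (real (Suc k)) \<and>
      L2_norm (\<lambda>z. g z - snd q z) < inverse (real (Suc k))"
      by (intro exI[of _ "(\<phi>, \<psi>)"]) simp
  qed
  from choice[OF this] obtain s where s: "\<forall>k. test_function (fst (s k)) \<and>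
      (\<forall>z. GDERIV (fst (s k)) z :> snd (s k) z) \<and>
      L2_norm (\<lambda>z. p z - fst (s k) z) < inverse (real (Suc k)) \<and>
      L2_norm (\<lambda>z. g z - snd (s k) z) < inverse (real (Suc k))" ..
  define \<phi> where "\<phi> k = fst (s k)" for k
  define \<psi> where "\<psi> k = snd (s k)" for k
  have *: "\<And>k. test_function (\<phi> k)" "\<And>k. \<forall>z. GDERIV (\<phi> k) z :> \<psi> k z"
    "\<And>k. L2_norm (\<lambda>z. p z - \<phi> k z) \<le> inverse (real (Suc k))"
    "\<And>k. L2_norm (\<lambda>z. g z - \<psi> k z) \<le> inverse (real (Suc k))"
    using s by (auto simp: \<phi>_def \<psi>_def less_imp_le)
  have "(\<lambda>k. L2_norm (\<lambda>z. p z - \<phi> k z)) \<longlonglongrightarrow> 0" "(\<lambda>k. L2_norm (\<lambda>z. g z - \<psi> k z)) \<longlonglongrightarrow> 0"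
    by (rule tendsto_sandwich[OF always_eventually always_eventually tendsto_const
          LIMSEQ_inverse_real_of_nat], intro allI L2_norm_nonneg, intro allI *)+
  with *(1,2) show ?thesis
    by blast
qed

lemma H10_graph_weak_gradient:
  assumes "H10_graph p g"
  shows "weak_gradient p g"
proof -
  obtain \<phi> \<psi> where *: "\<And>k. test_function (\<phi> k)" "\<And>k. \<forall>z. GDERIV (\<phi> k) z :> \<psi> k z"
    "(\<lambda>k. L2_norm (\<lambda>z. p z - \<phi> k z)) \<longlonglongrightarrow> 0" "(\<lambda>k. L2_norm (\<lambda>z. g z - \<psi> k z)) \<longlonglongrightarrow> 0"
    using H10_graph_sequence[OF assms] by blast
  have L2: "L2 p" "L2 g" "\<And>k. L2 (\<phi> k)" "\<And>k. L2 (\<psi> k)"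
    using assms test_function_L2[OF *(1,2)] by (auto simp: H10_graph_def)
  show ?thesis
    unfolding weak_gradient_def
  proof (intro allI impI)
    fix \<eta> \<zeta> assume \<eta>: "test_function \<eta> \<and> (\<forall>z. GDERIV \<eta> z :> \<zeta> z)"
    have L2': "L2 \<eta>" "L2 \<zeta>"
      using test_function_L2[of \<eta> \<zeta>] \<eta> by auto
    have lim: "(\<lambda>k. LINT z|leb_D. \<phi> k z *\<^sub>R \<zeta> z) \<longlonglongrightarrow> (LINT z|leb_D. p z *\<^sub>R \<zeta> z)"
      by (rule integral_scaleR_tendsto(2)[OF L2(3,1) L2'(2) *(3)])
    have "(LINT z|leb_D. \<phi> k z *\<^sub>R \<zeta> z) = - (LINT z|leb_D. \<eta> z *\<^sub>R \<psi> k z)" for k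
      using weak_gradient_test_function[of "\<phi> k" "\<psi> k"] *(1,2) \<eta> unfolding weak_gradient_def by blast
    moreover have "(\<lambda>k. - (LINT z|leb_D. \<eta> z *\<^sub>R \<psi> k z)) \<longlonglongrightarrow> - (LINT z|leb_D. \<eta> z *\<^sub>R g z)"
      by (intro tendsto_minus integral_scaleR_tendsto(1)[OF L2(4,2) L2'(1) *(4)])
    ultimately have "(\<lambda>k. LINT z|leb_D. \<phi> k z *\<^sub>R \<zeta> z) \<longlonglongrightarrow> - (LINT z|leb_D. \<eta> z *\<^sub>R g z)"
      by simp
    with lim show "(LINT z|leb_D. p z *\<^sub>R \<zeta> z) = - (LINT z|leb_D. \<eta> z *\<^sub>R g z)"
      by (rule LIMSEQ_unique)
  qed
qed

lemma L2_norm_triangle_diff: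
  fixes g h f :: "real \<times> real \<Rightarrow> 'a::euclidean_space"
  assumes "L2 g" "L2 h" "L2 f"
  shows "L2_norm (\<lambda>z. g z - f z) \<le> L2_norm (\<lambda>z. g z - h z) + L2_norm (\<lambda>z. h z - f z)"
  using L2_add(2)[OF L2_diff[OF assms(1,2)] L2_diff[OF assms(2,3)]] by simp

lemma H10_graph_Poincare:
  assumes "H10_graph p g"
  shows "L2_norm p \<le> 2 * L2_norm g"
proof (rule field_le_epsilon)
  fix e :: real assume "0 < e"
  then obtain \<phi> \<psi> where *: "test_function \<phi>" "\<forall>z. GDERIV \<phi> z :> \<psi> z"
    "L2_norm (\<lambda>z. p z - \<phi> z) < e / 3" "L2_norm (\<lambda>z. g z - \<psi> z) < e / 3"
    using assms unfolding H10_graph_def by (meson divide_pos_pos zero_less_numeral)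
  have L2: "L2 p" "L2 g" "L2 \<phi>" "L2 \<psi>"
    using assms test_function_L2[OF *(1,2)] by (auto simp: H10_graph_def)
  have "L2_norm p \<le> L2_norm (\<lambda>z. p z - \<phi> z) + L2_norm \<phi>"
    using L2_add(2)[OF L2_diff[OF L2(1,3)] L2(3)] by simp
  moreover have "L2_norm \<psi> \<le> L2_norm (\<lambda>z. g z - \<psi> z) + L2_norm g"
    using L2_add(2)[OF L2_diff[OF L2(4,2)] L2(2)] L2_norm_minus_commute[of g \<psi>] by simp
  moreover have "L2_norm \<phi> \<le> 2 * L2_norm \<psi>"
    using *(1,2) by (intro Poincare_test_function) auto
  ultimately show "L2_norm p \<le> 2 * L2_norm g + e"
    using *(3,4) by linarith
qed

lemma H10_graph_add:
  assumes "H10_graph p g" "H10_graph q h"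
  shows "H10_graph (\<lambda>z. p z + q z) (\<lambda>z. g z + h z)"
  unfolding H10_graph_def
proof (intro conjI allI impI)
  have L2: "L2 p" "L2 g" "L2 q" "L2 h"
    using assms by (auto simp: H10_graph_def)
  show "L2 (\<lambda>z. p z + q z)" "L2 (\<lambda>z. g z + h z)"
    using L2 by (auto intro: L2_add(1))
  fix e :: real assume "0 < e"
  then have e: "0 < e / 2" by simp
  obtain \<phi> \<psi> where 1: "test_function \<phi>" "\<forall>z. GDERIV \<phi> z :> \<psi> z"
    "L2_norm (\<lambda>z. p z - \<phi> z) < e / 2" "L2_norm (\<lambda>z. g z - \<psi> z) < e / 2"
    using assms(1) e unfolding H10_graph_def by meson
  obtain \<eta> \<zeta> where 2: "test_function \<eta>" "\<forall>z. GDERIV \<eta> z :> \<zeta> z"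
    "L2_norm (\<lambda>z. q z - \<eta> z) < e / 2" "L2_norm (\<lambda>z. h z - \<zeta> z) < e / 2"
    using assms(2) e unfolding H10_graph_def by meson
  have L2': "L2 \<phi>" "L2 \<psi>" "L2 \<eta>" "L2 \<zeta>"
    using test_function_L2[OF 1(1,2)] test_function_L2[OF 2(1,2)] by auto
  show "\<exists>\<phi> \<psi>. test_function \<phi> \<and> (\<forall>z. GDERIV \<phi> z :> \<psi> z) \<and>
      L2_norm (\<lambda>z. (p z + q z) - \<phi> z) < e \<and> L2_norm (\<lambda>z. (g z + h z) - \<psi> z) < e"
  proof (intro exI conjI)
    show "test_function (\<lambda>z. \<phi> z + \<eta> z)"
      using 1 2 by (intro test_function_add)
    show "\<forall>z. GDERIV (\<lambda>z. \<phi> z + \<eta> z) z :> \<psi> z + \<zeta> z"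
      using 1(2) 2(2) by (blast intro: GDERIV_add)
    show "L2_norm (\<lambda>z. (p z + q z) - (\<phi> z + \<eta> z)) < e"
      using L2_add(2)[OF L2_diff[OF L2(1) L2'(1)] L2_diff[OF L2(3) L2'(3)]] 1(3) 2(3)
      by (simp add: add_diff_add)
    show "L2_norm (\<lambda>z. (g z + h z) - (\<psi> z + \<zeta> z)) < e"
      using L2_add(2)[OF L2_diff[OF L2(2) L2'(2)] L2_diff[OF L2(4) L2'(4)]] 1(4) 2(4)
      by (simp add: add_diff_add)
  qed
qed

lemma H10_graph_cmult:
  assumes "H10_graph p g"
  shows "H10_graph (\<lambda>z. c * p z) (\<lambda>z. c *\<^sub>R g z)"
  unfolding H10_graph_def
proof (intro conjI allI impI)
  have L2: "L2 p" "L2 g"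
    using assms by (auto simp: H10_graph_def)
  show "L2 (\<lambda>z. c * p z)" "L2 (\<lambda>z. c *\<^sub>R g z)"
    using L2 L2_scaleR(1)[of p c] L2_scaleR(1)[of g c] by auto
  fix e :: real assume "0 < e"
  then have e: "0 < e / (\<bar>c\<bar> + 1)" by simp
  obtain \<phi> \<psi> where 1: "test_function \<phi>" "\<forall>z. GDERIV \<phi> z :> \<psi> z"
    "L2_norm (\<lambda>z. p z - \<phi> z) < e / (\<bar>c\<bar> + 1)" "L2_norm (\<lambda>z. g z - \<psi> z) < e / (\<bar>c\<bar> + 1)"
    using assms(1) e unfolding H10_graph_def by meson
  have L2': "L2 \<phi>" "L2 \<psi>"
    using test_function_L2[OF 1(1,2)] by auto
  have less: "\<bar>c\<bar> * t < e" if "t < e / (\<bar>c\<bar> + 1)" "0 \<le> t" for t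
  proof -
    have "\<bar>c\<bar> * t \<le> (\<bar>c\<bar> + 1) * t"
      using that by (simp add: mult_right_mono)
    also have "\<dots> < e"
      using that(1) by (simp add: pos_less_divide_eq mult.commute)
    finally show ?thesis .
  qed
  show "\<exists>\<phi> \<psi>. test_function \<phi> \<and> (\<forall>z. GDERIV \<phi> z :> \<psi> z) \<and>
      L2_norm (\<lambda>z. c * p z - \<phi> z) < e \<and> L2_norm (\<lambda>z. c *\<^sub>R g z - \<psi> z) < e"
  proof (intro exI conjI)
    show "test_function (\<lambda>z. c * \<phi> z)"
      using 1 by (intro test_function_cmult)
    show "\<forall>z. GDERIV (\<lambda>z. c * \<phi> z) z :> c *\<^sub>R \<psi> z"
      using 1(2) by (blast intro: GDERIV_cmult)
    show "L2_norm (\<lambda>z. c * p z - c * \<phi> z) < e"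
      using L2_scaleR(2)[OF L2_diff[OF L2(1) L2'(1)], of c] less[OF 1(3) L2_norm_nonneg]
      by (simp add: right_diff_distrib)
    show "L2_norm (\<lambda>z. c *\<^sub>R g z - c *\<^sub>R \<psi> z) < e"
      using L2_scaleR(2)[OF L2_diff[OF L2(2) L2'(2)], of c] less[OF 1(4) L2_norm_nonneg]
      by (simp add: scaleR_diff_right)
  qed
qed

lemma H10_graph_diff:
  assumes "H10_graph p g" "H10_graph q h"
  shows "H10_graph (\<lambda>z. p z - q z) (\<lambda>z. g z - h z)"
  using H10_graph_add[OF assms(1) H10_graph_cmult[OF assms(2), of "-1"]] by simp

lemma H10_graph_limit:
  assumes graph: "\<And>k. H10_graph (p k) (g k)" and L2: "L2 q" "L2 h"
    and lim: "(\<lambda>k. L2_norm (\<lambda>z. p k z - q z)) \<longlonglongrightarrow> 0" "(\<lambda>k. L2_norm (\<lambda>z. g k z - h z)) \<longlonglongrightarrow> 0"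
  shows "H10_graph q h"
  unfolding H10_graph_def
proof (intro conjI allI impI L2)
  fix e :: real assume "0 < e"
  then have e: "0 < e / 2" by simp
  have "\<forall>\<^sub>F k in sequentially. L2_norm (\<lambda>z. p k z - q z) < e / 2 \<and> L2_norm (\<lambda>z. g k z - h z) < e / 2"
    using lim e by (intro eventually_conj order_tendstoD(2))
  then obtain k where k: "L2_norm (\<lambda>z. p k z - q z) < e / 2" "L2_norm (\<lambda>z. g k z - h z) < e / 2"
    by (auto dest: eventually_happens)
  obtain \<phi> \<psi> where 1: "test_function \<phi>" "\<forall>z. GDERIV \<phi> z :> \<psi> z"
    "L2_norm (\<lambda>z. p k z - \<phi> z) < e / 2" "L2_norm (\<lambda>z. g k z - \<psi> z) < e / 2"
    using graph[of k] e unfolding H10_graph_def by meson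
  have "L2 (p k)" "L2 (g k)" "L2 \<phi>" "L2 \<psi>"
    using graph[of k] test_function_L2[OF 1(1,2)] by (auto simp: H10_graph_def)
  then have "L2_norm (\<lambda>z. q z - \<phi> z) < e" "L2_norm (\<lambda>z. h z - \<psi> z) < e"
    using L2_norm_triangle_diff[of q "p k" \<phi>] L2_norm_triangle_diff[of h "g k" \<psi>] L2 1(3,4) k
      L2_norm_minus_commute[of q "p k"] L2_norm_minus_commute[of h "g k"] by auto
  with 1 show "\<exists>\<phi> \<psi>. test_function \<phi> \<and> (\<forall>z. GDERIV \<phi> z :> \<psi> z) \<and>
      L2_norm (\<lambda>z. q z - \<phi> z) < e \<and> L2_norm (\<lambda>z. h z - \<psi> z) < e"
    by blast
qed

lemma H10_graph_cong_AE:
  assumes "H10_graph p g" "L2 h" "AE z in leb_D. g z = h z"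
  shows "H10_graph p h"
proof (rule H10_graph_limit[where p = "\<lambda>_. p" and g = "\<lambda>_. g"])
  have p: "L2 p" and g: "L2 g"
    using assms by (auto simp: H10_graph_def)
  show "L2 p" by (rule p)
  have 0: "L2_norm (\<lambda>z. 0 :: real \<times> real) = 0" "L2_norm (\<lambda>z. 0 :: real) = 0"
    by (auto simp: L2_norm_def)
  have L20: "L2 (\<lambda>z. 0 :: real \<times> real)"
    by (simp add: L2_def)
  have "L2_norm (\<lambda>z. g z - h z) = 0"
    using L2_norm_cong_AE[OF L2_diff[OF g assms(2)] L20] assms(3) 0 by auto
  then show "(\<lambda>k. L2_norm (\<lambda>z. g z - h z)) \<longlonglongrightarrow> 0" "(\<lambda>k. L2_norm (\<lambda>z. p z - p z)) \<longlonglongrightarrow> 0"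
    using 0 by simp_all
qed (use assms in auto)

text \<open>
  As weak gradients are unique, \<open>grad (p - \<phi>\<^sub>k)\<close> is the difference of the gradients, and convergence in
  \<open>H1_norm\<close> splits into the convergence of functions and of gradients.
\<close>

lemma H10_iff_graph: "p \<in> H10 \<longleftrightarrow> (\<exists>g. H10_graph p g)"
proof
  assume "p \<in> H10"
  then obtain g \<phi> where g: "L2 p" "L2 g" "weak_gradient p g" and \<phi>: "\<And>k::nat. test_function (\<phi> k)"
    and lim: "(\<lambda>k. H1_norm (\<lambda>z. p z - \<phi> k z)) \<longlonglongrightarrow> 0"
    by (auto simp: H10_def H1_def)
  have "\<forall>k. \<exists>\<psi>. \<forall>z. GDERIV (\<phi> k) z :> \<psi> z"
    using test_function_gradient[OF \<phi>] by blast
  from choice[OF this] obtain \<psi> where \<psi>: "\<And>k z. GDERIV (\<phi> k) z :> \<psi> k z"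
    by blast
  have L2: "L2 (\<phi> k)" "L2 (\<psi> k)" for k
    using test_function_L2[OF \<phi>] \<psi> by blast+
  have "weak_gradient (\<lambda>z. p z - \<phi> k z) (\<lambda>z. g z - \<psi> k z)" for k
    unfolding weak_gradient_def
  proof (intro allI impI)
    fix \<eta> \<zeta> assume \<eta>: "test_function \<eta> \<and> (\<forall>z. GDERIV \<eta> z :> \<zeta> z)"
    have L2': "L2 \<eta>" "L2 \<zeta>"
      using test_function_L2[of \<eta> \<zeta>] \<eta> by auto
    have "(LINT z|leb_D. p z *\<^sub>R \<zeta> z) = - (LINT z|leb_D. \<eta> z *\<^sub>R g z)"
      "(LINT z|leb_D. \<phi> k z *\<^sub>R \<zeta> z) = - (LINT z|leb_D. \<eta> z *\<^sub>R \<psi> k z)"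
      using g(3) weak_gradient_test_function[OF \<phi> \<psi>, of k] \<eta> unfolding weak_gradient_def by blast+
    then show "(LINT z|leb_D. (p z - \<phi> k z) *\<^sub>R \<zeta> z) = - (LINT z|leb_D. \<eta> z *\<^sub>R (g z - \<psi> k z))"
      using L2_scaleR_integral(1)[OF g(1) L2'(2)] L2_scaleR_integral(1)[OF L2(1) L2'(2), of k]
        L2_scaleR_integral(1)[OF L2'(1) g(2)] L2_scaleR_integral(1)[OF L2'(1) L2(2), of k]
      by (simp add: scaleR_diff_left scaleR_diff_right)
  qed
  then have grad: "L2 (grad (\<lambda>z. p z - \<phi> k z))" "AE z in leb_D. grad (\<lambda>z. p z - \<phi> k z) z = g z - \<psi> k z" for k
    using grad_eqI[OF L2_diff[OF g(2) L2(2)]] by blast+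
  have norm_grad: "L2_norm (grad (\<lambda>z. p z - \<phi> k z)) = L2_norm (\<lambda>z. g z - \<psi> k z)" for k
    by (rule L2_norm_cong_AE[OF grad(1) L2_diff[OF g(2) L2(2)] grad(2)])
  have "H10_graph p g"
    unfolding H10_graph_def
  proof (intro conjI allI impI g)
    fix e :: real assume "0 < e"
    then have "\<forall>\<^sub>F k in sequentially. H1_norm (\<lambda>z. p z - \<phi> k z) < e"
      by (rule order_tendstoD(2)[OF lim])
    then obtain k where k: "H1_norm (\<lambda>z. p z - \<phi> k z) < e"
      by (auto dest: eventually_happens)
    have "L2_norm (\<lambda>z. p z - \<phi> k z) < e" "L2_norm (\<lambda>z. g z - \<psi> k z) < e"
      using k real_sqrt_sum_squares_ge1[of "L2_norm (\<lambda>z. p z - \<phi> k z)" "L2_norm (\<lambda>z. g z - \<psi> k z)"]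
        real_sqrt_sum_squares_ge2[of "L2_norm (\<lambda>z. g z - \<psi> k z)" "L2_norm (\<lambda>z. p z - \<phi> k z)"]
      unfolding H1_norm_def norm_grad by linarith+
    then show "\<exists>\<phi> \<psi>. test_function \<phi> \<and> (\<forall>z. GDERIV \<phi> z :> \<psi> z) \<and>
        L2_norm (\<lambda>z. p z - \<phi> z) < e \<and> L2_norm (\<lambda>z. g z - \<psi> z) < e"
      using \<phi> \<psi> by blast
  qed
  then show "\<exists>g. H10_graph p g"
    by blast
next
  assume "\<exists>g. H10_graph p g"
  then obtain g where g: "H10_graph p g"
    by blast
  then have L2: "L2 p" "L2 g" and wg: "weak_gradient p g"
    using H10_graph_weak_gradient by (auto simp: H10_graph_def)
  obtain \<phi> \<psi> where *: "\<And>k. test_function (\<phi> k)" "\<And>k. \<forall>z. GDERIV (\<phi> k) z :> \<psi> k z"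
    "(\<lambda>k. L2_norm (\<lambda>z. p z - \<phi> k z)) \<longlonglongrightarrow> 0" "(\<lambda>k. L2_norm (\<lambda>z. g z - \<psi> k z)) \<longlonglongrightarrow> 0"
    using H10_graph_sequence[OF g] by blast
  have "H10_graph (\<phi> k) (\<psi> k)" for k
  proof -
    have "L2_norm (\<lambda>z. \<phi> k z - \<phi> k z) = 0" "L2_norm (\<lambda>z. \<psi> k z - \<psi> k z) = 0"
      by (auto simp: L2_norm_def)
    then show ?thesis
      unfolding H10_graph_def using *(1,2) test_function_L2[OF *(1,2), of k] by metis
  qed
  then have diff: "H10_graph (\<lambda>z. p z - \<phi> k z) (\<lambda>z. g z - \<psi> k z)" for k
    by (intro H10_graph_diff g)
  then have L2': "L2 (\<lambda>z. g z - \<psi> k z)" for k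
    unfolding H10_graph_def by blast
  have "L2_norm (grad (\<lambda>z. p z - \<phi> k z)) = L2_norm (\<lambda>z. g z - \<psi> k z)" for k
    using grad_eqI[OF L2' H10_graph_weak_gradient[OF diff], of k] L2'[of k]
    by (intro L2_norm_cong_AE)
  then have "H1_norm (\<lambda>z. p z - \<phi> k z)
      = sqrt ((L2_norm (\<lambda>z. p z - \<phi> k z))\<^sup>2 + (L2_norm (\<lambda>z. g z - \<psi> k z))\<^sup>2)" for k
    by (simp add: H1_norm_def)
  moreover have "(\<lambda>k. sqrt ((L2_norm (\<lambda>z. p z - \<phi> k z))\<^sup>2 + (L2_norm (\<lambda>z. g z - \<psi> k z))\<^sup>2))
      \<longlonglongrightarrow> sqrt (0\<^sup>2 + 0\<^sup>2)"
    by (intro tendsto_intros *(3,4))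
  ultimately have "(\<lambda>k. H1_norm (\<lambda>z. p z - \<phi> k z)) \<longlonglongrightarrow> 0"
    by simp
  then show "p \<in> H10"
    unfolding H10_def H1_def using L2 wg *(1) by auto
qed

lemma H10_graph_grad:
  assumes "p \<in> H10"
  shows "H10_graph p (grad p)"
proof -
  obtain g where g: "H10_graph p g"
    using assms H10_iff_graph by blast
  then have "L2 g"
    by (simp add: H10_graph_def)
  note grad = grad_eqI[OF this H10_graph_weak_gradient[OF g]]
  show ?thesis
    using grad(3) by (intro H10_graph_cong_AE[OF g grad(1)]) auto
qed

lemma H10_graph_AE_grad:
  assumes "H10_graph p g"
  shows "p \<in> H10" "AE z in leb_D. grad p z = g z"
  using assms H10_iff_graph grad_eqI(3)[OF _ H10_graph_weak_gradient[OF assms]]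
  by (auto simp: H10_graph_def)

lemma L2_grad: "p \<in> H10 \<Longrightarrow> L2 (grad p)"
  using H10_graph_grad by (auto simp: H10_graph_def)

lemma H10_add:
  assumes "p \<in> H10" "q \<in> H10"
  shows "(\<lambda>z. p z + q z) \<in> H10" "AE z in leb_D. grad (\<lambda>z. p z + q z) z = grad p z + grad q z"
  using H10_graph_AE_grad[OF H10_graph_add[OF H10_graph_grad[OF assms(1)] H10_graph_grad[OF assms(2)]]] by auto

lemma H10_cmult:
  assumes "p \<in> H10"
  shows "(\<lambda>z. c * p z) \<in> H10" "AE z in leb_D. grad (\<lambda>z. c * p z) z = c *\<^sub>R grad p z"
  using H10_graph_AE_grad[OF H10_graph_cmult[OF H10_graph_grad[OF assms]]] by auto

lemma H10_diff:
  assumes "p \<in> H10" "q \<in> H10"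
  shows "(\<lambda>z. p z - q z) \<in> H10" "AE z in leb_D. grad (\<lambda>z. p z - q z) z = grad p z - grad q z"
  using H10_graph_AE_grad[OF H10_graph_diff[OF H10_graph_grad[OF assms(1)] H10_graph_grad[OF assms(2)]]] by auto

lemma V_norm_diff:
  assumes "p \<in> H10" "q \<in> H10"
  shows "V_norm (\<lambda>z. p z - q z) = L2_norm (\<lambda>z. grad p z - grad q z)"
  unfolding V_norm_def
  by (rule L2_norm_cong_AE[OF L2_grad[OF H10_diff(1)[OF assms]]
        L2_diff[OF L2_grad[OF assms(1)] L2_grad[OF assms(2)]] H10_diff(2)[OF assms]])

lemma Poincare: "p \<in> H10 \<Longrightarrow> L2_norm p \<le> 2 * V_norm p"
  unfolding V_norm_def by (rule H10_graph_Poincare[OF H10_graph_grad])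

text \<open>
  The Poincare inequality is what makes the functions themselves, and not only their gradients,
  converge.
\<close>

lemma V_complete:
  assumes p: "\<And>k. p k \<in> H10"
    and Cauchy: "\<And>e. 0 < e \<Longrightarrow> \<exists>N. \<forall>m\<ge>N. \<forall>n\<ge>N. V_norm (\<lambda>z. p m z - p n z) < e"
  shows "\<exists>q\<in>H10. (\<lambda>k. V_norm (\<lambda>z. p k z - q z)) \<longlonglongrightarrow> 0"
proof -
  have L2: "L2 (p k)" "L2 (grad (p k))" for k
    using H10_graph_grad[OF p[of k]] unfolding H10_graph_def by blast+
  have "\<exists>N. \<forall>m\<ge>N. \<forall>n\<ge>N. L2_norm (\<lambda>z. grad (p m) z - grad (p n) z) < e" if "0 < e" for e
    using Cauchy[OF that] V_norm_diff[OF p p] by simp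
  then obtain h where h: "L2 h" "(\<lambda>k. L2_norm (\<lambda>z. grad (p k) z - h z)) \<longlonglongrightarrow> 0"
    using L2_complete[of "\<lambda>k. grad (p k)"] L2(2) by blast
  have "\<exists>N. \<forall>m\<ge>N. \<forall>n\<ge>N. L2_norm (\<lambda>z. p m z - p n z) < e" if "0 < e" for e
  proof -
    obtain N where N: "\<And>m n. N \<le> m \<Longrightarrow> N \<le> n \<Longrightarrow> V_norm (\<lambda>z. p m z - p n z) < e / 2"
      using Cauchy[of "e / 2"] \<open>0 < e\<close> by auto
    have "L2_norm (\<lambda>z. p m z - p n z) < e" if "N \<le> m" "N \<le> n" for m n
      using Poincare[OF H10_diff(1)[OF p p], of m n] N[OF that] by linarith
    then show ?thesis by blast
  qed
  then obtain q where q: "L2 q" "(\<lambda>k. L2_norm (\<lambda>z. p k z - q z)) \<longlonglongrightarrow> 0"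
    using L2_complete[of p] L2(1) by blast
  have graph: "H10_graph q h"
    by (rule H10_graph_limit[OF H10_graph_grad[OF p] q(1) h(1) q(2) h(2)])
  have "V_norm (\<lambda>z. p k z - q z) = L2_norm (\<lambda>z. grad (p k) z - h z)" for k
    using H10_graph_AE_grad(2)[OF graph]
    unfolding V_norm_diff[OF p H10_graph_AE_grad(1)[OF graph]]
    by (intro L2_norm_cong_AE L2_diff L2 h L2_grad H10_graph_AE_grad(1)[OF graph]) auto
  then have "(\<lambda>k. V_norm (\<lambda>z. p k z - q z)) \<longlonglongrightarrow> 0"
    using h(2) by simp
  with H10_graph_AE_grad(1)[OF graph] show ?thesis
    by blast
qed

section \<open>Weak solutions: existence and stability\<close>

text \<open>
  A minimising sequence of \<open>1/2 B v v - F v\<close> is Cauchy by the parallelogram identity, and the first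
  variation vanishes at its limit.
\<close>

lemma Riesz_representation_coercive:
  fixes S :: "('x \<Rightarrow> real) set" and B :: "('x \<Rightarrow> real) \<Rightarrow> ('x \<Rightarrow> real) \<Rightarrow> real"
    and F N :: "('x \<Rightarrow> real) \<Rightarrow> real"
  assumes zero: "p0 \<in> S"
    and add: "\<And>p q. p \<in> S \<Longrightarrow> q \<in> S \<Longrightarrow> (\<lambda>z. p z + q z) \<in> S"
    and cmult: "\<And>p t. p \<in> S \<Longrightarrow> (\<lambda>z. t * p z) \<in> S"
    and B_sym: "\<And>p q. p \<in> S \<Longrightarrow> q \<in> S \<Longrightarrow> B p q = B q p"
    and B_add: "\<And>p q r. p \<in> S \<Longrightarrow> q \<in> S \<Longrightarrow> r \<in> S \<Longrightarrow> B (\<lambda>z. p z + q z) r = B p r + B q r"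
    and B_cmult: "\<And>p r t. p \<in> S \<Longrightarrow> r \<in> S \<Longrightarrow> B (\<lambda>z. t * p z) r = t * B p r"
    and F_add: "\<And>p q. p \<in> S \<Longrightarrow> q \<in> S \<Longrightarrow> F (\<lambda>z. p z + q z) = F p + F q"
    and F_cmult: "\<And>p t. p \<in> S \<Longrightarrow> F (\<lambda>z. t * p z) = t * F p"
    and c: "0 < c" and coercive: "\<And>p. p \<in> S \<Longrightarrow> c * (N p)\<^sup>2 \<le> B p p"
    and B_bound: "\<And>p q. p \<in> S \<Longrightarrow> q \<in> S \<Longrightarrow> \<bar>B p q\<bar> \<le> K * N p * N q"
    and F_bound: "\<And>p. p \<in> S \<Longrightarrow> \<bar>F p\<bar> \<le> b * N p"
    and complete: "\<And>v. (\<And>k::nat. v k \<in> S) \<Longrightarrow>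
      (\<And>e. 0 < e \<Longrightarrow> \<exists>M. \<forall>m\<ge>M. \<forall>n\<ge>M. N (\<lambda>z. v m z - v n z) < e) \<Longrightarrow>
      \<exists>p\<in>S. (\<lambda>k. N (\<lambda>z. v k z - p z)) \<longlonglongrightarrow> 0"
  shows "\<exists>p\<in>S. \<forall>v\<in>S. B p v = F v"
proof -
  define J where "J v = B v v / 2 - F v" for v
  have diff: "(\<lambda>z. p z - q z) \<in> S" if "p \<in> S" "q \<in> S" for p q
    using add[OF that(1) cmult[OF that(2), of "-1"]] by simp
  have J_line: "J (\<lambda>z. p z + t * v z) = J p + t * (B p v - F v) + t\<^sup>2 * B v v / 2"
    if "p \<in> S" "v \<in> S" for p v t
  proof -
    let ?tv = "\<lambda>z. t * v z"
    have S: "?tv \<in> S" "(\<lambda>z. p z + ?tv z) \<in> S"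
      using that by (auto intro: add cmult)
    have "B (\<lambda>z. p z + ?tv z) (\<lambda>z. p z + ?tv z) = B p (\<lambda>z. p z + ?tv z) + B ?tv (\<lambda>z. p z + ?tv z)"
      by (rule B_add[OF that(1) S])
    also have "B p (\<lambda>z. p z + ?tv z) = B p p + t * B v p"
      using B_sym[OF that(1) S(2)] B_add[OF that(1) S(1) that(1)] B_cmult[OF that(2,1)] by simp
    also have "B ?tv (\<lambda>z. p z + ?tv z) = B p ?tv + B ?tv ?tv"
      using B_sym[OF S] B_add[OF that(1) S(1) S(1)] by simp
    also have "B p ?tv = t * B v p"
      using B_sym[OF that(1) S(1)] B_cmult[OF that(2,1)] by simp
    also have "B ?tv ?tv = t * (t * B v v)"
      using B_cmult[OF that(2) S(1)] B_sym[OF that(2) S(1)] B_cmult[OF that(2,2)] by simp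
    finally have "B (\<lambda>z. p z + ?tv z) (\<lambda>z. p z + ?tv z) = B p p + 2 * t * B p v + t\<^sup>2 * B v v"
      using B_sym[OF that] by (simp add: power2_eq_square)
    moreover have "F (\<lambda>z. p z + ?tv z) = F p + t * F v"
      using F_add[OF that(1) S(1)] F_cmult[OF that(2)] by simp
    ultimately show ?thesis
      by (simp add: J_def field_simps)
  qed
  have J_lower: "- (b\<^sup>2 / (2 * c)) \<le> J v" if "v \<in> S" for v
  proof -
    have "0 \<le> (c * N v - b)\<^sup>2 / (2 * c)"
      using c by simp
    then have "b * N v - b\<^sup>2 / (2 * c) \<le> c * (N v)\<^sup>2 / 2"
      using c by (simp add: field_simps power2_eq_square)
    then show ?thesis
      using coercive[OF that] F_bound[OF that] by (simp add: J_def)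
  qed
  define m where "m = (INF v\<in>S. J v)"
  have bdd: "bdd_below (J ` S)"
    using J_lower by (intro bdd_belowI2)
  have m_le: "m \<le> J v" if "v \<in> S" for v
    unfolding m_def using that by (intro cINF_lower bdd)
  have "\<forall>k. \<exists>v. v \<in> S \<and> J v < m + inverse (real (Suc k))"
  proof
    fix k
    have "m < m + inverse (real (Suc k))" by simp
    then show "\<exists>v. v \<in> S \<and> J v < m + inverse (real (Suc k))"
      using zero unfolding m_def by (subst (asm) cINF_less_iff) (use bdd in auto)
  qed
  from choice[OF this] obtain v where v: "\<And>k. v k \<in> S" "\<And>k. J (v k) < m + inverse (real (Suc k))"
    by blast
  have N_diff: "c * (N (\<lambda>z. v k z - v l z))\<^sup>2 \<le> 4 * (inverse (real (Suc k)) + inverse (real (Suc l)))" for k l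
  proof -
    \<comment> \<open>Parallelogram identity: \<open>v k\<close> and \<open>v l\<close> lie symmetrically around their midpoint \<open>?a\<close>, where
      \<open>J\<close> is at least \<open>m\<close>.\<close>
    let ?d = "\<lambda>z. v k z - v l z" and ?a = "\<lambda>z. 1/2 * (v k z + v l z)"
    have S: "?d \<in> S" "?a \<in> S"
      by (intro diff cmult[OF add] v)+
    have "v k = (\<lambda>z. ?a z + 1/2 * ?d z)" "v l = (\<lambda>z. ?a z + (- 1/2) * ?d z)"
      by (auto simp: field_simps)
    then have "J (v k) + J (v l) = 2 * J ?a + B ?d ?d / 4"
      using J_line[OF S(2,1), of "1/2"] J_line[OF S(2,1), of "-1/2"]
      by (simp add: power2_eq_square field_simps)
    moreover have "J (v k) + J (v l) < 2 * m + (inverse (real (Suc k)) + inverse (real (Suc l)))"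
      using add_strict_mono[OF v(2) v(2), of k l] by simp
    ultimately have "B ?d ?d / 4 < inverse (real (Suc k)) + inverse (real (Suc l))"
      using m_le[OF S(2)] by linarith
    then have "B ?d ?d \<le> 4 * (inverse (real (Suc k)) + inverse (real (Suc l)))"
      by simp
    then show ?thesis
      using coercive[OF S(1)] by linarith
  qed
  have "\<exists>M. \<forall>k\<ge>M. \<forall>l\<ge>M. N (\<lambda>z. v k z - v l z) < e" if e: "0 < e" for e
  proof -
    obtain M where M: "inverse (real (Suc M)) < c * e\<^sup>2 / 8"
      using reals_Archimedean[of "c * e\<^sup>2 / 8"] c e by auto
    have "N (\<lambda>z. v k z - v l z) < e" if "M \<le> k" "M \<le> l" for k l
    proof -
      have "inverse (real (Suc k)) \<le> inverse (real (Suc M))" "inverse (real (Suc l)) \<le> inverse (real (Suc M))"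
        using that by (auto intro!: le_imp_inverse_le)
      then have "4 * (inverse (real (Suc k)) + inverse (real (Suc l)))
          \<le> 4 * (inverse (real (Suc M)) + inverse (real (Suc M)))"
        by (intro mult_left_mono add_mono) auto
      also have "\<dots> < c * e\<^sup>2"
        using M by simp
      finally have "c * (N (\<lambda>z. v k z - v l z))\<^sup>2 < c * e\<^sup>2"
        by (rule le_less_trans[OF N_diff])
      then have "(N (\<lambda>z. v k z - v l z))\<^sup>2 < e\<^sup>2"
        using c by simp
      then show ?thesis
        using e by (auto intro: power_less_imp_less_base)
    qed
    then show ?thesis by blast
  qed
  then obtain p where p: "p \<in> S" "(\<lambda>k. N (\<lambda>z. v k z - p z)) \<longlonglongrightarrow> 0"
    using complete[of v] v(1) by blast
  have "B p w = F w" if w: "w \<in> S" for w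
  proof -
    have "(\<lambda>k. B (v k) w) \<longlonglongrightarrow> B p w"
    proof (rule Lim_transform2[OF tendsto_const], rule Lim_null_comparison)
      show "\<forall>\<^sub>F k in sequentially. norm (B p w - B (v k) w) \<le> K * N (\<lambda>z. v k z - p z) * N w"
      proof (intro always_eventually allI)
        fix k
        have "B (v k) w = B (\<lambda>z. p z + (v k z - p z)) w"
          by simp
        also have "\<dots> = B p w + B (\<lambda>z. v k z - p z) w"
          by (rule B_add[OF p(1) diff[OF v(1) p(1)] w])
        finally show "norm (B p w - B (v k) w) \<le> K * N (\<lambda>z. v k z - p z) * N w"
          using B_bound[OF diff[OF v(1) p(1)] w, of k] by simp
      qed
      show "(\<lambda>k. K * N (\<lambda>z. v k z - p z) * N w) \<longlonglongrightarrow> 0"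
        using tendsto_mult_left[OF tendsto_mult_right[OF p(2), of "N w"], of K] by (simp add: mult.assoc)
    qed
    \<comment> \<open>First variation: \<open>J\<close> at \<open>v k + t w\<close> is at least \<open>m\<close>, and \<open>J (v k)\<close> tends to \<open>m\<close>.\<close>
    have "0 \<le> 0 - 2 * t * (F w - B p w) + t\<^sup>2 * B w w" for t
    proof -
      have "- inverse (real (Suc k)) \<le> t * (B (v k) w - F w) + t\<^sup>2 * B w w / 2" for k
        using m_le[OF add[OF v(1) cmult[OF w]], of k t] v(2)[of k] J_line[OF v(1) w, of k t] by linarith
      moreover have "(\<lambda>k. - inverse (real (Suc k))) \<longlonglongrightarrow> - 0"
        by (intro tendsto_minus LIMSEQ_inverse_real_of_nat)
      moreover have "(\<lambda>k. t * (B (v k) w - F w) + t\<^sup>2 * B w w / 2) \<longlonglongrightarrow> t * (B p w - F w) + t\<^sup>2 * B w w / 2"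
        by (intro tendsto_intros) fact
      ultimately have "- 0 \<le> t * (B p w - F w) + t\<^sup>2 * B w w / 2"
        by (intro LIMSEQ_le) auto
      then show ?thesis
        by (simp add: algebra_simps)
    qed
    moreover have "0 \<le> B w w"
      using coercive[OF w] c by (meson mult_nonneg_nonneg less_imp_le order_trans zero_le_power2)
    ultimately have "(F w - B p w)\<^sup>2 \<le> 0 * B w w"
      by (rule quadratic_nonneg_imp)
    then show ?thesis by simp
  qed
  then show ?thesis
    using p(1) by blast
qed

lemma zero_in_H10: "(\<lambda>z. 0) \<in> H10"
proof -
  have "H10_graph (\<lambda>z. 0) (\<lambda>z. 0)"
    unfolding H10_graph_def
  proof (intro conjI allI impI)
    show "L2 (\<lambda>z. 0 :: real)" "L2 (\<lambda>z. 0 :: real \<times> real)"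
      by (auto intro: L2_continuous)
    fix e :: real assume "0 < e"
    moreover have "test_function (\<lambda>z. 0)"
      using test_function_cmult[OF test_function_box_bump[of 0 0 1], of 0] by simp
    moreover have "GDERIV (\<lambda>z::real \<times> real. 0) z :> 0" for z
      by (rule GDERIV_const)
    ultimately show "\<exists>\<phi> \<psi>. test_function \<phi> \<and> (\<forall>z. GDERIV \<phi> z :> \<psi> z) \<and>
        L2_norm (\<lambda>z. 0 - \<phi> z) < e \<and> L2_norm (\<lambda>z. 0 - \<psi> z) < e"
      by (intro exI[of _ "\<lambda>z. 0"]) (auto simp: L2_norm_def)
  qed
  then show ?thesis
    using H10_iff_graph by blast
qed

lemma V_dual_add: "l \<in> V_dual \<Longrightarrow> p \<in> H10 \<Longrightarrow> q \<in> H10 \<Longrightarrow> l (\<lambda>z. p z + q z) = l p + l q"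
  unfolding V_dual_def by blast

lemma V_dual_cmult: "l \<in> V_dual \<Longrightarrow> p \<in> H10 \<Longrightarrow> l (\<lambda>z. t * p z) = t * l p"
  unfolding V_dual_def by blast

lemma V_dual_diff:
  assumes "l \<in> V_dual" "p \<in> H10" "q \<in> H10"
  shows "l (\<lambda>z. p z - q z) = l p - l q"
  using V_dual_add[OF assms(1,2) H10_cmult(1)[OF assms(3), of "-1"]]
    V_dual_cmult[OF assms(1,3), of "-1"] by simp

text \<open>These bounds make the energy form bounded and coercive on \<open>V\<close>.\<close>

definition elliptic :: "real \<Rightarrow> real \<Rightarrow> (real \<times> real \<Rightarrow> real) \<Rightarrow> bool" where
  "elliptic c K \<kappa> \<longleftrightarrow> 0 < c \<and> c \<le> K \<and> \<kappa> \<in> borel_measurable leb_D \<and>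
     (AE z in leb_D. c \<le> \<kappa> z \<and> \<kappa> z \<le> K)"

lemma elliptic_L2:
  fixes g :: "real \<times> real \<Rightarrow> 'a::euclidean_space"
  assumes "elliptic c K \<kappa>" "L2 g"
  shows "L2 (\<lambda>z. \<kappa> z *\<^sub>R g z)" "L2_norm (\<lambda>z. \<kappa> z *\<^sub>R g z) \<le> K * L2_norm g"
proof -
  have c: "0 < c" "c \<le> K" and m: "\<kappa> \<in> borel_measurable leb_D"
    and AE: "AE z in leb_D. c \<le> \<kappa> z \<and> \<kappa> z \<le> K"
    using assms(1) by (auto simp: elliptic_def)
  have le: "AE z in leb_D. norm (\<kappa> z *\<^sub>R g z) \<le> K * norm (g z)"
    using AE by eventually_elim (use c in \<open>auto intro!: mult_right_mono\<close>)
  show L2: "L2 (\<lambda>z. \<kappa> z *\<^sub>R g z)"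
    by (rule L2_dominated[OF assms(2) borel_measurable_scaleR[OF m L2_measurable[OF assms(2)]] le])
  show "L2_norm (\<lambda>z. \<kappa> z *\<^sub>R g z) \<le> K * L2_norm g"
    using c by (intro L2_norm_mono[OF L2 assms(2) le]) simp
qed

definition energy :: "(real \<times> real \<Rightarrow> real) \<Rightarrow> (real \<times> real \<Rightarrow> real) \<Rightarrow> (real \<times> real \<Rightarrow> real) \<Rightarrow> real" where
  "energy \<kappa> p q = (LINT z|leb_D. \<kappa> z * (grad p z \<bullet> grad q z))"

lemma energy_integrable:
  assumes "elliptic c K \<kappa>" "L2 g" "L2 h"
  shows "integrable leb_D (\<lambda>z. \<kappa> z * (g z \<bullet> h z))"
  using L2_inner_integral(1)[OF elliptic_L2(1)[OF assms(1,2)] assms(3)] by simp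

lemma energy_sym: "energy \<kappa> p q = energy \<kappa> q p"
  by (simp add: energy_def inner_commute)

lemma energy_eqI:
  assumes "elliptic c K \<kappa>" "p \<in> H10" "q \<in> H10" "AE z in leb_D. grad p z = g z" "L2 g"
  shows "energy \<kappa> p q = (LINT z|leb_D. \<kappa> z * (g z \<bullet> grad q z))"
  unfolding energy_def
proof (rule integral_cong_AE)
  show "(\<lambda>z. \<kappa> z * (grad p z \<bullet> grad q z)) \<in> borel_measurable leb_D"
    "(\<lambda>z. \<kappa> z * (g z \<bullet> grad q z)) \<in> borel_measurable leb_D"
    using energy_integrable[OF assms(1) L2_grad[OF assms(2)] L2_grad[OF assms(3)]]
      energy_integrable[OF assms(1,5) L2_grad[OF assms(3)]] by simp_all
qed (use assms(4) in auto)

lemma energy_add: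
  assumes "elliptic c K \<kappa>" "p \<in> H10" "q \<in> H10" "r \<in> H10"
  shows "energy \<kappa> (\<lambda>z. p z + q z) r = energy \<kappa> p r + energy \<kappa> q r"
proof -
  have "energy \<kappa> (\<lambda>z. p z + q z) r
      = (LINT z|leb_D. \<kappa> z * (grad p z \<bullet> grad r z) + \<kappa> z * (grad q z \<bullet> grad r z))"
    by (subst energy_eqI[OF assms(1) H10_add(1)[OF assms(2,3)] assms(4) H10_add(2)[OF assms(2,3)]
          L2_add(1)[OF L2_grad[OF assms(2)] L2_grad[OF assms(3)]]])
      (simp add: inner_add_left distrib_left)
  also have "\<dots> = energy \<kappa> p r + energy \<kappa> q r"
    unfolding energy_def
    by (intro Bochner_Integration.integral_add energy_integrable[OF assms(1)] L2_grad assms(2-))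
  finally show ?thesis .
qed

lemma energy_cmult:
  assumes "elliptic c K \<kappa>" "p \<in> H10" "r \<in> H10"
  shows "energy \<kappa> (\<lambda>z. t * p z) r = t * energy \<kappa> p r"
proof -
  have "energy \<kappa> (\<lambda>z. t * p z) r = (LINT z|leb_D. t * (\<kappa> z * (grad p z \<bullet> grad r z)))"
    by (subst energy_eqI[OF assms(1) H10_cmult(1)[OF assms(2)] assms(3) H10_cmult(2)[OF assms(2)]
          L2_scaleR(1)[OF L2_grad[OF assms(2)]]])
      (simp add: mult.left_commute)
  then show ?thesis
    by (simp add: energy_def)
qed

lemma energy_diff:
  assumes "elliptic c K \<kappa>" "p \<in> H10" "q \<in> H10" "r \<in> H10"
  shows "energy \<kappa> (\<lambda>z. p z - q z) r = energy \<kappa> p r - energy \<kappa> q r"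
  using energy_add[OF assms(1,2) H10_cmult(1)[OF assms(3), of "-1"] assms(4)]
    energy_cmult[OF assms(1,3,4), of "-1"] by simp

lemma energy_bound:
  assumes "elliptic c K \<kappa>" "p \<in> H10" "q \<in> H10"
  shows "\<bar>energy \<kappa> p q\<bar> \<le> K * V_norm p * V_norm q"
proof -
  note L2 = L2_grad[OF assms(2)] L2_grad[OF assms(3)]
  have "energy \<kappa> p q = (LINT z|leb_D. (\<kappa> z *\<^sub>R grad p z) \<bullet> grad q z)"
    by (simp add: energy_def)
  also have "\<bar>\<dots>\<bar> \<le> L2_norm (\<lambda>z. \<kappa> z *\<^sub>R grad p z) * L2_norm (grad q)"
    by (rule L2_inner_integral(2)[OF elliptic_L2(1)[OF assms(1) L2(1)] L2(2)])
  also have "\<dots> \<le> K * V_norm p * V_norm q"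
    unfolding V_norm_def by (intro mult_right_mono elliptic_L2(2)[OF assms(1) L2(1)] L2_norm_nonneg)
  finally show ?thesis .
qed

lemma energy_coercive:
  assumes "elliptic c K \<kappa>" "p \<in> H10"
  shows "c * (V_norm p)\<^sup>2 \<le> energy \<kappa> p p"
proof -
  note L2 = L2_grad[OF assms(2)]
  have "c * (V_norm p)\<^sup>2 = (LINT z|leb_D. c * (norm (grad p z))\<^sup>2)"
    by (simp add: V_norm_def power2_L2_norm)
  also have "\<dots> \<le> energy \<kappa> p p"
    unfolding energy_def
  proof (rule integral_mono_AE[OF _ energy_integrable[OF assms(1) L2 L2]])
    show "integrable leb_D (\<lambda>z. c * (norm (grad p z))\<^sup>2)"
      using L2_integrable_power2[OF L2] by simp
    have "AE z in leb_D. c \<le> \<kappa> z \<and> \<kappa> z \<le> K"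
      using assms(1) by (simp add: elliptic_def)
    then show "AE z in leb_D. c * (norm (grad p z))\<^sup>2 \<le> \<kappa> z * (grad p z \<bullet> grad p z)"
      by eventually_elim (simp add: power2_norm_eq_inner mult_right_mono)
  qed
  finally show ?thesis .
qed

lemma V_dual_bound:
  assumes "l \<in> V_dual"
  obtains b where "\<And>p. p \<in> H10 \<Longrightarrow> \<bar>l p\<bar> \<le> b * V_norm p"
  using assms unfolding V_dual_def by blast

lemma weak_solution_exists:
  assumes f: "f \<in> V_dual" and \<kappa>: "elliptic c K \<kappa>"
  shows "\<exists>p. weak_solution f \<kappa> p"
proof -
  obtain b where b: "\<And>p. p \<in> H10 \<Longrightarrow> \<bar>f p\<bar> \<le> b * V_norm p"
    using V_dual_bound[OF f] by blast
  have "\<exists>p\<in>H10. \<forall>v\<in>H10. energy \<kappa> p v = f v"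
  proof (rule Riesz_representation_coercive[where B = "energy \<kappa>" and N = V_norm and c = c and K = K and b = b])
    show "0 < c" using \<kappa> by (simp add: elliptic_def)
    show "\<exists>p\<in>H10. (\<lambda>k. V_norm (\<lambda>z. v k z - p z)) \<longlonglongrightarrow> 0"
      if "\<And>k::nat. v k \<in> H10"
        "\<And>e. 0 < e \<Longrightarrow> \<exists>M. \<forall>m\<ge>M. \<forall>n\<ge>M. V_norm (\<lambda>z. v m z - v n z) < e" for v
      using V_complete[OF that] .
  qed (rule zero_in_H10 H10_add(1) H10_cmult(1) energy_sym energy_add[OF \<kappa>] energy_cmult[OF \<kappa>]
        V_dual_add[OF f] V_dual_cmult[OF f] energy_bound[OF \<kappa>] energy_coercive[OF \<kappa>] b; assumption)+
  then show ?thesis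
    unfolding weak_solution_def energy_def by blast
qed

lemma G_map_weak_solution:
  assumes "f \<in> V_dual" "elliptic c K \<kappa>"
  shows "weak_solution f \<kappa> (G_map f \<kappa>)"
  unfolding G_map_def using weak_solution_exists[OF assms] by (rule someI_ex)

text \<open>
  Testing the difference of the two equations with \<open>e = p - q\<close> gives
  \<open>c * (V_norm e)\<^sup>2 \<le> \<integral> (\<kappa>' - \<kappa>) * (grad q \<bullet> grad e)\<close>: the coefficients need to be close only in
  the space with weight \<open>(norm (grad q))\<^sup>2\<close>, for which convergence almost everywhere within
  uniform bounds suffices.
\<close>

lemma weak_solution_difference:
  assumes f: "f \<in> V_dual" and \<kappa>: "elliptic c K \<kappa>" and \<kappa>': "elliptic c K \<kappa>'"
    and p: "weak_solution f \<kappa> p" and q: "weak_solution f \<kappa>' q"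
  shows "c * V_norm (\<lambda>z. p z - q z) \<le> L2_norm (\<lambda>z. (\<kappa>' z - \<kappa> z) *\<^sub>R grad q z)"
proof -
  have c: "0 < c" using \<kappa> by (simp add: elliptic_def)
  have H: "p \<in> H10" "q \<in> H10"
    using p q by (auto simp: weak_solution_def)
  let ?e = "\<lambda>z. p z - q z"
  have e: "?e \<in> H10"
    by (rule H10_diff(1)[OF H])
  have "c * (V_norm ?e)\<^sup>2 \<le> energy \<kappa> ?e ?e"
    by (rule energy_coercive[OF \<kappa> e])
  also have "\<dots> = energy \<kappa> p ?e - energy \<kappa> q ?e"
    by (rule energy_diff[OF \<kappa> H e])
  also have "\<dots> = energy \<kappa>' q ?e - energy \<kappa> q ?e"
    using p q e by (simp add: weak_solution_def energy_def)
  also have "\<dots> = (LINT z|leb_D. ((\<kappa>' z - \<kappa> z) *\<^sub>R grad q z) \<bullet> grad ?e z)"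
    unfolding energy_def
    using energy_integrable[OF \<kappa> L2_grad[OF H(2)] L2_grad[OF e]]
      energy_integrable[OF \<kappa>' L2_grad[OF H(2)] L2_grad[OF e]]
    by (simp add: left_diff_distrib)
  also have "\<dots> \<le> L2_norm (\<lambda>z. (\<kappa>' z - \<kappa> z) *\<^sub>R grad q z) * V_norm ?e"
  proof -
    have "L2 (\<lambda>z. (\<kappa>' z - \<kappa> z) *\<^sub>R grad q z)"
      using L2_diff[OF elliptic_L2(1)[OF \<kappa>' L2_grad[OF H(2)]] elliptic_L2(1)[OF \<kappa> L2_grad[OF H(2)]]]
      by (simp add: scaleR_diff_left)
    then show ?thesis
      unfolding V_norm_def using L2_inner_integral(2)[OF _ L2_grad[OF e]] by fastforce
  qed
  finally have "V_norm ?e * (c * V_norm ?e) \<le> V_norm ?e * L2_norm (\<lambda>z. (\<kappa>' z - \<kappa> z) *\<^sub>R grad q z)"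
    by (simp add: power2_eq_square mult_ac)
  moreover have "0 \<le> V_norm ?e"
    by (simp add: V_norm_def L2_norm_nonneg)
  ultimately show ?thesis
    by (cases "V_norm ?e = 0") (auto simp: L2_norm_nonneg mult_le_cancel_left)
qed

lemma weak_solution_functional_tendsto:
  assumes f: "f \<in> V_dual" and l: "l \<in> V_dual"
    and \<kappa>: "\<And>k. elliptic c K (\<kappa> k)" and \<kappa>': "elliptic c K \<kappa>'"
    and p: "\<And>k. weak_solution f (\<kappa> k) (p k)" and q: "weak_solution f \<kappa>' q"
    and lim: "AE z in leb_D. (\<lambda>k. \<kappa> k z) \<longlonglongrightarrow> \<kappa>' z"
  shows "(\<lambda>k. l (p k)) \<longlonglongrightarrow> l q"
proof -
  have c: "0 < c" using \<kappa>' by (simp add: elliptic_def)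
  have H: "p k \<in> H10" "q \<in> H10" for k
    using p[of k] q by (auto simp: weak_solution_def)
  note Lq = L2_grad[OF H(2)]
  let ?r = "\<lambda>k z. (\<kappa>' z - \<kappa> k z) *\<^sub>R grad q z"
  have L2r: "L2 (?r k)" for k
    using L2_diff[OF elliptic_L2(1)[OF \<kappa>' Lq] elliptic_L2(1)[OF \<kappa> Lq]]
    by (simp add: scaleR_diff_left)
  have "(\<lambda>k. LINT z|leb_D. (norm (?r k z))\<^sup>2) \<longlonglongrightarrow> (LINT z|leb_D. 0)"
  proof (rule integral_dominated_convergence[where w = "\<lambda>z. (2 * K)\<^sup>2 * (norm (grad q z))\<^sup>2"])
    show "integrable leb_D (\<lambda>z. (2 * K)\<^sup>2 * (norm (grad q z))\<^sup>2)"
      using L2_integrable_power2[OF Lq] by simp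
    show "(\<lambda>z. (norm (?r k z))\<^sup>2) \<in> borel_measurable leb_D" for k
      by (rule borel_measurable_integrable[OF L2_integrable_power2[OF L2r]])
    show "AE z in leb_D. (\<lambda>k. (norm (?r k z))\<^sup>2) \<longlonglongrightarrow> 0"
      using lim
    proof eventually_elim
      case (elim z)
      then have "(\<lambda>k. (norm (?r k z))\<^sup>2) \<longlonglongrightarrow> (norm ((\<kappa>' z - \<kappa>' z) *\<^sub>R grad q z))\<^sup>2"
        by (intro tendsto_intros)
      then show ?case by simp
    qed
    show "AE z in leb_D. norm ((norm (?r k z))\<^sup>2) \<le> (2 * K)\<^sup>2 * (norm (grad q z))\<^sup>2" for k
    proof -
      have "AE z in leb_D. c \<le> \<kappa> k z \<and> \<kappa> k z \<le> K" "AE z in leb_D. c \<le> \<kappa>' z \<and> \<kappa>' z \<le> K"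
        using \<kappa>[of k] \<kappa>' by (auto simp: elliptic_def)
      then show ?thesis
      proof eventually_elim
        case (elim z)
        then have "(norm (?r k z))\<^sup>2 \<le> (2 * K * norm (grad q z))\<^sup>2"
          using c by (intro power_mono) (auto intro!: mult_right_mono)
        then show ?case
          by (simp add: power_mult_distrib)
      qed
    qed
  qed simp
  then have "(\<lambda>k. sqrt ((L2_norm (?r k))\<^sup>2)) \<longlonglongrightarrow> sqrt 0"
    unfolding power2_L2_norm by (intro tendsto_real_sqrt) simp
  then have r0: "(\<lambda>k. L2_norm (?r k)) \<longlonglongrightarrow> 0"
    by (simp add: L2_norm_nonneg)
  obtain b where b: "\<And>p. p \<in> H10 \<Longrightarrow> \<bar>l p\<bar> \<le> b * V_norm p"
    using V_dual_bound[OF l] by blast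
  have "(\<lambda>k. l (p k) - l q) \<longlonglongrightarrow> 0"
  proof (rule Lim_null_comparison)
    show "\<forall>\<^sub>F k in sequentially. norm (l (p k) - l q) \<le> \<bar>b\<bar> / c * L2_norm (?r k)"
    proof (intro always_eventually allI)
      fix k
      have "norm (l (p k) - l q) \<le> b * V_norm (\<lambda>z. p k z - q z)"
        using b[OF H10_diff(1)[OF H], of k] V_dual_diff[OF l H, of k] by simp
      also have "\<dots> \<le> \<bar>b\<bar> * V_norm (\<lambda>z. p k z - q z)"
        by (intro mult_right_mono) (auto simp: V_norm_def L2_norm_nonneg)
      also have "\<dots> \<le> \<bar>b\<bar> * (L2_norm (?r k) / c)"
        using weak_solution_difference[OF f \<kappa> \<kappa>' p q, of k] c
        by (intro mult_left_mono) (auto simp: field_simps)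
      finally show "norm (l (p k) - l q) \<le> \<bar>b\<bar> / c * L2_norm (?r k)"
        by simp
    qed
    show "(\<lambda>k. \<bar>b\<bar> / c * L2_norm (?r k)) \<longlonglongrightarrow> 0"
      using tendsto_mult_left[OF r0, of "\<bar>b\<bar> / c"] by simp
  qed
  then show ?thesis
    by (rule LIM_zero_cancel)
qed

section \<open>Continuity of the observation map\<close>

lemma comp_field_tendsto:
  assumes "v \<longlonglongrightarrow> w"
  shows "(\<lambda>k. apply_bcontfun (comp_field i (v k)) s) \<longlonglongrightarrow> apply_bcontfun (comp_field i w) s"
proof -
  have "(\<lambda>k. apply_bcontfun (v k) s) \<longlonglongrightarrow> apply_bcontfun w s"
  proof (rule tendstoI)
    fix e :: real assume "0 < e"
    with assms have "\<forall>\<^sub>F k in sequentially. dist (v k) w < e"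
      by (rule tendstoD)
    then show "\<forall>\<^sub>F k in sequentially. dist (apply_bcontfun (v k) s) (apply_bcontfun w s) < e"
      by eventually_elim (meson dist_bounded le_less_trans)
  qed
  then show ?thesis
    unfolding apply_comp_field by (rule tendsto_vec_nth)
qed

lemma comp_field_bound: "\<bar>apply_bcontfun (comp_field i v) s\<bar> \<le> norm v"
  unfolding apply_comp_field
  using component_le_norm_cart[of "apply_bcontfun v s" i] norm_bounded[of v s] by linarith

lemma continuous_on_at_point: "continuous_on (closure dom_D) at_point"
  unfolding continuous_on_iff by (auto simp: dist_closed_square_def at_point_inverse)

lemma F_map_measurable:
  assumes "\<And>i. R (fst u) i \<in> sets borel"
  shows "F_map R u \<in> borel_measurable leb_D"
proof -
  have "(\<lambda>z. apply_bcontfun (comp_field i (snd u)) (at_point z)) \<in> borel_measurable leb_D" for i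
  proof (rule continuous_imp_measurable_on_sets_lebesgue)
    show "continuous_on dom_D (\<lambda>z. apply_bcontfun (comp_field i (snd u)) (at_point z))"
    proof (rule continuous_on_compose2[where g = "apply_bcontfun (comp_field i (snd u))"])
      show "continuous_on UNIV (apply_bcontfun (comp_field i (snd u)))"
        by (rule continuous_on_apply_bcontfun)
      show "continuous_on dom_D at_point"
        by (rule continuous_on_subset[OF continuous_on_at_point closure_subset])
    qed simp
  qed simp
  moreover have "(indicator (R (fst u) i) :: real \<times> real \<Rightarrow> real) \<in> borel_measurable leb_D" for i
    using assms by (intro borel_measurable_leb_D) simp
  ultimately show ?thesis
    unfolding F_map_def by measurable
qed

lemma elliptic_F_map:
  fixes R :: "'g \<Rightarrow> 'n::finite \<Rightarrow> (real \<times> real) set"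
  assumes "\<And>i. R (fst u) i \<in> sets borel" "AE z in leb_D. \<exists>i. z \<in> R (fst u) i" "norm (snd u) \<le> M"
  shows "elliptic (exp (- M)) (CARD('n) * exp M) (F_map R u)"
  unfolding elliptic_def
proof (intro conjI F_map_measurable assms(1))
  have M: "0 \<le> M"
    using assms(3) norm_ge_zero order_trans by blast
  have "exp (- M) \<le> 1 * exp M"
    using M by simp
  also have "\<dots> \<le> CARD('n) * exp M"
    by (intro mult_right_mono) (auto simp: Suc_le_eq)
  finally show "exp (- M) \<le> CARD('n) * exp M" .
  let ?t = "\<lambda>z i. exp (apply_bcontfun (comp_field i (snd u)) (at_point z)) * indicator (R (fst u) i) z"
  have bound: "- M \<le> apply_bcontfun (comp_field i (snd u)) s" "apply_bcontfun (comp_field i (snd u)) s \<le> M" for i s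
    using comp_field_bound[of i "snd u" s] assms(3) by linarith+
  show "AE z in leb_D. exp (- M) \<le> F_map R u z \<and> F_map R u z \<le> CARD('n) * exp M"
    using assms(2)
  proof eventually_elim
    case (elim z)
    then obtain i where "z \<in> R (fst u) i" ..
    then have "exp (- M) \<le> ?t z i"
      using bound(1) by simp
    also have "\<dots> \<le> (\<Sum>j\<in>UNIV. ?t z j)"
      by (rule member_le_sum) auto
    finally have lower: "exp (- M) \<le> F_map R u z"
      by (simp add: F_map_def)
    have "?t z j \<le> exp M" for j
      using bound(2)[of j "at_point z"] by (auto simp: indicator_def)
    then have "(\<Sum>j\<in>UNIV. ?t z j) \<le> (\<Sum>j\<in>(UNIV :: 'n set). exp M)"
      by (intro sum_mono)
    then have "F_map R u z \<le> CARD('n) * exp M"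
      by (simp add: F_map_def)
    with lower show ?case ..
  qed
qed simp

text \<open>
  The regions of nearby geometries agree at almost every fixed point of \<open>D\<close>, so the coefficient
  converges almost everywhere along every convergent sequence of parameters, and within uniform
  ellipticity bounds.
\<close>

lemma continuous_on_obs_map:
  fixes R :: "'g::metric_space \<Rightarrow> 'n::finite \<Rightarrow> (real \<times> real) set"
    and l :: "'j::finite \<Rightarrow> (real \<times> real \<Rightarrow> real) \<Rightarrow> real"
  assumes f: "f \<in> V_dual" and l: "\<And>j. l j \<in> V_dual"
    and borel: "\<And>g i. g \<in> Ug \<Longrightarrow> R g i \<in> sets borel"
    and cover: "\<And>g. g \<in> Ug \<Longrightarrow> AE z in leb_D. \<exists>i. z \<in> R g i"
    and stable: "\<And>g. g \<in> Ug \<Longrightarrow> AE z in leb_D. \<forall>i. \<forall>\<^sub>F g' in nhds g. z \<in> R g' i \<longleftrightarrow> z \<in> R g i"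
  shows "continuous_on (Ug \<times> UNIV) (obs_map f l R)"
  unfolding continuous_on_sequentially
proof (intro allI ballI impI, elim conjE)
  fix u :: "nat \<Rightarrow> 'g \<times> (closed_square \<Rightarrow>\<^sub>C (real^'n))" and w
  assume w: "w \<in> Ug \<times> UNIV" and u: "\<forall>k. u k \<in> Ug \<times> UNIV" and lim: "u \<longlonglongrightarrow> w"
  have lim1: "(\<lambda>k. fst (u k)) \<longlonglongrightarrow> fst w" and lim2: "(\<lambda>k. snd (u k)) \<longlonglongrightarrow> snd w"
    using lim by (auto intro: tendsto_fst tendsto_snd)
  have Ug: "fst w \<in> Ug" "fst (u k) \<in> Ug" for k
    using w u by (auto simp: mem_Times_iff)
  obtain M' where M': "\<And>k. norm (snd (u k)) \<le> M'"
    using convergent_imp_Bseq[OF convergentI[OF lim2]] unfolding Bseq_def by blast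
  define M where "M = max M' (norm (snd w))"
  have M: "norm (snd (u k)) \<le> M" "norm (snd w) \<le> M" for k
    using M'[of k] by (auto simp: M_def)
  have ell: "elliptic (exp (- M)) (CARD('n) * exp M) (F_map R (u k))"
    "elliptic (exp (- M)) (CARD('n) * exp M) (F_map R w)" for k
    by (intro elliptic_F_map borel cover Ug M)+
  have "AE z in leb_D. (\<lambda>k. F_map R (u k) z) \<longlonglongrightarrow> F_map R w z"
    using stable[OF Ug(1)]
  proof eventually_elim
    case (elim z)
    have "(\<lambda>k. indicator (R (fst (u k)) i) z :: real) \<longlonglongrightarrow> indicator (R (fst w) i) z" for i
    proof (rule tendsto_eventually)
      have "\<forall>\<^sub>F k in sequentially. z \<in> R (fst (u k)) i \<longleftrightarrow> z \<in> R (fst w) i"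
        using lim1 elim by (auto simp: filterlim_iff)
      then show "\<forall>\<^sub>F k in sequentially. (indicator (R (fst (u k)) i) z :: real) = indicator (R (fst w) i) z"
        by eventually_elim (simp add: indicator_def)
    qed
    then show ?case
      unfolding F_map_def by (intro tendsto_sum tendsto_mult tendsto_exp comp_field_tendsto lim2)
  qed
  then have "(\<lambda>k. l j (G_map f (F_map R (u k)))) \<longlonglongrightarrow> l j (G_map f (F_map R w))" for j
    by (rule weak_solution_functional_tendsto[OF f l ell G_map_weak_solution[OF f ell(1)]
          G_map_weak_solution[OF f ell(2)]])
  then show "(obs_map f l R \<circ> u) \<longlonglongrightarrow> obs_map f l R w"
    unfolding obs_map_def comp_def by (intro vec_tendstoI) simp
qed

section \<open>The two geometries\<close>

lemma AE_leb_D_not_graph: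
  assumes [measurable]: "(h :: real \<Rightarrow> real) \<in> borel_measurable borel"
  shows "AE z in leb_D. snd z \<noteq> h (fst z)"
proof (rule AE_leb_D_lborel)
  have "AE z in lborel \<Otimes>\<^sub>M lborel. snd z \<noteq> h (fst z)"
  proof (rule lborel_pair.AE_pair_measure)
    show "{z \<in> space (lborel \<Otimes>\<^sub>M lborel). snd z \<noteq> h (fst z)} \<in> sets (lborel \<Otimes>\<^sub>M lborel)"
      by measurable
    show "AE x in lborel. AE y in lborel. snd (x, y) \<noteq> h (fst (x, y))"
      by (rule AE_I2) (simp add: AE_lborel_singleton)
  qed
  then show "AE z in lborel. snd z \<noteq> h (fst z)"
    unfolding lborel_prod .
qed

lemma AE_leb_D_fst_neq: "AE z in leb_D. fst z \<noteq> c"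
proof (rule AE_leb_D_lborel)
  have "AE z in lborel \<Otimes>\<^sub>M lborel. fst z \<noteq> (c::real)"
  proof (rule lborel_pair.AE_pair_measure)
    show "{z \<in> space (lborel \<Otimes>\<^sub>M lborel). fst z \<noteq> c} \<in> sets (lborel \<Otimes>\<^sub>M lborel)"
      by measurable
    show "AE x in lborel. AE y in lborel. fst (x, y) \<noteq> c"
      using AE_lborel_singleton[of c] by eventually_elim simp
  qed
  then show "AE z in lborel. fst z \<noteq> c"
    unfolding lborel_prod .
qed

text \<open>
  Here \<open>h\<close> is the position of an interface at a fixed abscissa, as a function of the geometric
  parameter: a point off the interface stays on its side.
\<close>

lemma eventually_same_side:
  assumes "(h \<longlongrightarrow> h g) (nhds g)" "h g \<noteq> (r::real)"
  shows "\<forall>\<^sub>F v in nhds g. (h v < r \<longleftrightarrow> h g < r) \<and> (r < h v \<longleftrightarrow> r < h g)"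
proof (cases "h g < r")
  case True
  show ?thesis
    using order_tendstoD(2)[OF assms(1) True] by eventually_elim (use True in auto)
next
  case False
  then have "r < h g" using assms(2) by simp
  show ?thesis
    using order_tendstoD(1)[OF assms(1) \<open>r < h g\<close>] by eventually_elim (use \<open>r < h g\<close> in auto)
qed

lemma number_surj:
  assumes "1 \<le> m" "m \<le> CARD('i)"
  shows "\<exists>i::'i::{finite,linorder}. number i = m"
proof -
  have "number i < number j" if "i < j" for i j :: 'i
  proof -
    have "{k. k \<le> i} \<subseteq> {k. k \<le> j}" "j \<in> {k. k \<le> j}" "j \<notin> {k. k \<le> i}"
      using that by auto
    then show ?thesis
      unfolding number_def by (intro psubset_card_mono) auto
  qed
  then have "inj (number :: 'i \<Rightarrow> nat)"
    by (intro linorder_injI) (metis less_irrefl)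
  then have "card (range (number :: 'i \<Rightarrow> nat)) = card {1..CARD('i)}"
    by (simp add: card_image)
  moreover have "range (number :: 'i \<Rightarrow> nat) \<subseteq> {1..CARD('i)}"
  proof
    fix k assume "k \<in> range (number :: 'i \<Rightarrow> nat)"
    then obtain i :: 'i where "k = card {j. j \<le> i}"
      by (auto simp: number_def)
    moreover have "card {i} \<le> card {j. j \<le> i}" "card {j. j \<le> i} \<le> CARD('i)"
      by (intro card_mono; simp)+
    ultimately show "k \<in> {1..CARD('i)}" by simp
  qed
  ultimately have "range (number :: 'i \<Rightarrow> nat) = {1..CARD('i)}"
    by (intro card_subset_eq) auto
  then show ?thesis
    using assms by (metis atLeastAtMost_iff rangeE)
qed

text \<open>
  The finite branch of \<open>interface_depth\<close>, extended to all indices \<open>m\<close> so that one null set serves all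
  interfaces.
\<close>

definition interface_height :: "'k::{finite,linorder} layer_param \<Rightarrow> nat \<Rightarrow> real \<Rightarrow> real" where
  "interface_height g m x =
     layer_height (fst g) (fst (snd g)) m x + (if x < 1/2 then snd (snd g) else 0)"

lemma interface_depth_height:
  fixes g :: "'k::{finite,linorder} layer_param"
  assumes "m \<noteq> 0" "m \<noteq> CARD('k) + 1"
  shows "interface_depth g m x = ereal (interface_height g m x)"
  using assms by (cases g) (auto simp: interface_depth_def interface_height_def)

lemma interface_depth_0: "interface_depth g 0 x = - \<infinity>"
  by (cases g) (simp add: interface_depth_def)

lemma interface_depth_last: "interface_depth (g :: 'k::{finite,linorder} layer_param) (Suc CARD('k)) x = \<infinity>"
  by (cases g) (simp add: interface_depth_def)

lemma interface_height_measurable [measurable]: "interface_height g m \<in> borel_measurable borel"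
  unfolding interface_height_def layer_height_def by measurable

lemma interface_depth_measurable [measurable]: "interface_depth g m \<in> borel_measurable borel"
proof -
  have e: "interface_depth (g :: 'a layer_param) m = (\<lambda>x. if m = 0 then - \<infinity> else if m = CARD('a) + 1 then \<infinity>
      else ereal (interface_height g m x))" for g m
    using interface_depth_height[of m g] interface_depth_0[of g] interface_depth_last[of g] by auto
  show ?thesis
    unfolding e by measurable
qed

lemma interface_height_tendsto: "((\<lambda>v. interface_height v m x) \<longlongrightarrow> interface_height g m x) (nhds g)"
proof -
  have id: "((\<lambda>v. v) \<longlongrightarrow> g) (nhds g)"
    by (rule filterlim_ident)
  show ?thesis
    unfolding interface_height_def layer_height_def
    by (auto intro!: tendsto_intros tendsto_fst[OF id] tendsto_snd[OF tendsto_snd[OF id]]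
        tendsto_fst[OF tendsto_snd[OF id]])
qed

lemma layer_region_borel: "layer_region g i \<in> sets borel"
proof -
  have "layer_region g i = {z \<in> space (borel \<Otimes>\<^sub>M borel). z \<in> dom_D \<and> fst z \<noteq> 1/2 \<and>
      interface_depth g (number i - 1) (fst z) < ereal (1 - snd z) \<and>
      ereal (1 - snd z) < interface_depth g (number i) (fst z)}"
    by (auto simp: layer_region_def space_pair_measure)
  also have "\<dots> \<in> sets (borel \<Otimes>\<^sub>M borel)"
    using dom_D_borel unfolding borel_prod[symmetric] by measurable
  finally show ?thesis
    unfolding borel_prod .
qed

lemma AE_off_interfaces:
  "AE z in leb_D. z \<in> dom_D \<and> fst z \<noteq> 1/2 \<and> (\<forall>m. interface_height g m (fst z) \<noteq> 1 - snd z)"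
proof -
  have "AE z in leb_D. snd z \<noteq> 1 - interface_height g m (fst z)" for m
    by (rule AE_leb_D_not_graph) measurable
  then have "AE z in leb_D. \<forall>m. snd z \<noteq> 1 - interface_height g m (fst z)"
    by (simp add: AE_all_countable)
  moreover have "AE z in leb_D. z \<in> dom_D"
    by (rule AE_I2) simp
  ultimately show ?thesis
    using AE_leb_D_fst_neq[of "1/2"] by eventually_elim (auto simp: algebra_simps)
qed

text \<open>A point off the interfaces lies in the layer above the first interface that is below it.\<close>

lemma layer_region_cover:
  fixes g :: "'k::{finite,linorder} layer_param"
  assumes card: "CARD('n) = CARD('k) + 1"
  shows "AE z in leb_D. \<exists>i::'n::{finite,linorder}. z \<in> layer_region g i"
  using AE_off_interfaces[of g]
proof eventually_elim
  case (elim z)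
  let ?P = "\<lambda>m. ereal (1 - snd z) < interface_depth g m (fst z)"
  define m where "m = (LEAST m. ?P m)"
  have "?P (Suc CARD('k))"
    by (simp add: interface_depth_last)
  then have m: "?P m" "m \<le> Suc CARD('k)"
    unfolding m_def by (rule LeastI, rule Least_le)
  have "m \<noteq> 0"
  proof
    assume "m = 0"
    with m(1) show False
      by (simp add: interface_depth_0)
  qed
  then have "\<not> ?P (m - 1)"
    unfolding m_def by (intro not_less_Least) (simp add: m_def)
  moreover have "interface_depth g (m - 1) (fst z) \<noteq> ereal (1 - snd z)"
    using elim interface_depth_0[of g] interface_depth_height[of "m - 1" g "fst z"] m(2)
    by (cases "m - 1 = 0") auto
  ultimately have "interface_depth g (m - 1) (fst z) < ereal (1 - snd z)"
    by simp
  moreover obtain i :: 'n where "number i = m"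
    using number_surj[where 'i = 'n, of m] \<open>m \<noteq> 0\<close> m(2) card by auto
  ultimately have "z \<in> layer_region g i"
    using elim m(1) by (auto simp: layer_region_def case_prod_unfold)
  then show ?case ..
qed

lemma layer_region_stable:
  fixes g :: "'k::{finite,linorder} layer_param"
  shows "AE z in leb_D. \<forall>i::'n::{finite,linorder}. \<forall>\<^sub>F g' in nhds g.
    z \<in> layer_region g' i \<longleftrightarrow> z \<in> layer_region g i"
  using AE_off_interfaces[of g]
proof eventually_elim
  case (elim z)
  have side: "\<forall>\<^sub>F v in nhds g.
      (interface_depth v m (fst z) < ereal (1 - snd z) \<longleftrightarrow> interface_depth g m (fst z) < ereal (1 - snd z)) \<and>
      (ereal (1 - snd z) < interface_depth v m (fst z) \<longleftrightarrow> ereal (1 - snd z) < interface_depth g m (fst z))" for m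
  proof (cases "m = 0 \<or> m = CARD('k) + 1")
    case True
    then show ?thesis
      by (auto simp: interface_depth_0 interface_depth_last)
  next
    case False
    then have "interface_depth v m x = ereal (interface_height v m x)" for v :: "'k layer_param" and x
      by (intro interface_depth_height) auto
    then show ?thesis
      using eventually_same_side[OF interface_height_tendsto[of m "fst z" g], of "1 - snd z"] elim by simp
  qed
  show ?case
  proof
    fix i :: 'n
    show "\<forall>\<^sub>F g' in nhds g. z \<in> layer_region g' i \<longleftrightarrow> z \<in> layer_region g i"
      using side[of "number i - 1"] side[of "number i"]
      by eventually_elim (auto simp: layer_region_def case_prod_unfold)
  qed
qed

lemma channel_curve_continuous: "continuous_on UNIV (channel_curve d)"
  unfolding channel_curve_def by (intro continuous_intros)

lemma channel_curve_measurable [measurable]: "channel_curve d \<in> borel_measurable borel"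
  by (rule borel_measurable_continuous_onI[OF channel_curve_continuous])

lemma channel_region_borel: "channel_region d i \<in> sets borel"
proof -
  have "channel d = {z \<in> space (borel \<Otimes>\<^sub>M borel). z \<in> dom_D \<and>
      channel_curve d (fst z) < snd z \<and> snd z < channel_curve d (fst z) + d $ 5}"
    by (auto simp: channel_def space_pair_measure)
  also have "\<dots> \<in> sets (borel \<Otimes>\<^sub>M borel)"
    using dom_D_borel unfolding borel_prod[symmetric] by measurable
  finally have "channel d \<in> sets borel"
    unfolding borel_prod .
  then show ?thesis
    by (simp add: channel_region_def)
qed

lemma closure_channel_subset:
  "closure (channel d) \<subseteq> {z. channel_curve d (fst z) \<le> snd z \<and> snd z \<le> channel_curve d (fst z) + d $ 5}"
proof (rule closure_minimal)
  have "continuous_on UNIV (\<lambda>z. channel_curve d (fst z))"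
    by (rule continuous_on_compose2[OF channel_curve_continuous]) (auto intro: continuous_intros)
  then show "closed {z. channel_curve d (fst z) \<le> snd z \<and> snd z \<le> channel_curve d (fst z) + d $ 5}"
    by (intro closed_Collect_conj closed_Collect_le continuous_intros)
qed (auto simp: channel_def)

text \<open>Off the two boundary curves the closure in the definition of the second region is invisible.\<close>

lemma channel_region_iff:
  assumes "z \<in> dom_D" "channel_curve d (fst z) \<noteq> snd z" "channel_curve d (fst z) + d $ 5 \<noteq> snd z"
  shows "z \<in> channel_region d i \<longleftrightarrow>
    (i = 1 \<longleftrightarrow> channel_curve d (fst z) < snd z \<and> snd z < channel_curve d (fst z) + d $ 5)"
proof -
  have ch: "z \<in> channel d \<longleftrightarrow> channel_curve d (fst z) < snd z \<and> snd z < channel_curve d (fst z) + d $ 5"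
    using assms(1) by (auto simp: channel_def)
  have "z \<in> closure (channel d) \<longleftrightarrow> z \<in> channel d"
    using closure_channel_subset[of d] closure_subset[of "channel d"] assms ch by force
  then show ?thesis
    using ch assms(1) by (auto simp: channel_region_def)
qed

lemma AE_off_channel_boundary:
  "AE z in leb_D. z \<in> dom_D \<and> channel_curve d (fst z) \<noteq> snd z \<and> channel_curve d (fst z) + d $ 5 \<noteq> snd z"
proof -
  have "AE z in leb_D. snd z \<noteq> channel_curve d (fst z)" "AE z in leb_D. snd z \<noteq> channel_curve d (fst z) + d $ 5"
    by (rule AE_leb_D_not_graph, measurable)+
  moreover have "AE z in leb_D. z \<in> dom_D"
    by (rule AE_I2) simp
  ultimately show ?thesis
    by eventually_elim auto
qed

lemma channel_region_cover: "AE z in leb_D. \<exists>i. z \<in> channel_region d i"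
  using AE_off_channel_boundary[of d]
proof eventually_elim
  case (elim z)
  have "(2 :: 2) \<noteq> 1" by simp
  then have "z \<in> channel_region d 1 \<or> z \<in> channel_region d 2"
    using channel_region_iff[of z d] elim by metis
  then show ?case by blast
qed

lemma channel_region_stable:
  assumes "cos (d $ 3) \<noteq> 0"
  shows "AE z in leb_D. \<forall>i. \<forall>\<^sub>F d' in nhds d. z \<in> channel_region d' i \<longleftrightarrow> z \<in> channel_region d i"
  using AE_off_channel_boundary[of d]
proof eventually_elim
  case (elim z)
  have nth: "((\<lambda>v. v $ i) \<longlongrightarrow> d $ i) (nhds d)" for i
    by (intro tendsto_vec_nth filterlim_ident)
  have tan: "((\<lambda>v. tan (v $ 3)) \<longlongrightarrow> tan (d $ 3)) (nhds d)"
    by (rule isCont_tendsto_compose[OF isCont_tan[OF assms] nth])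
  have curve: "((\<lambda>v. channel_curve v (fst z)) \<longlongrightarrow> channel_curve d (fst z)) (nhds d)"
    unfolding channel_curve_def
    by (intro tendsto_add tendsto_mult tendsto_sin tan tendsto_const nth)
  have 1: "\<forall>\<^sub>F v in nhds d. (channel_curve v (fst z) < snd z \<longleftrightarrow> channel_curve d (fst z) < snd z) \<and>
      (snd z < channel_curve v (fst z) \<longleftrightarrow> snd z < channel_curve d (fst z))"
    using elim by (intro eventually_same_side curve) auto
  have 2: "\<forall>\<^sub>F v in nhds d.
      (channel_curve v (fst z) + v $ 5 < snd z \<longleftrightarrow> channel_curve d (fst z) + d $ 5 < snd z) \<and>
      (snd z < channel_curve v (fst z) + v $ 5 \<longleftrightarrow> snd z < channel_curve d (fst z) + d $ 5)"
    using elim by (intro eventually_same_side tendsto_add curve nth) auto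
  show ?case
  proof
    fix i
    show "\<forall>\<^sub>F d' in nhds d. z \<in> channel_region d' i \<longleftrightarrow> z \<in> channel_region d i"
      using 1 2
    proof eventually_elim
      case (elim d')
      then show ?case
        using channel_region_iff[of z d i] channel_region_iff[of z d' i]
          \<open>z \<in> dom_D \<and> channel_curve d (fst z) \<noteq> snd z \<and> channel_curve d (fst z) + d $ 5 \<noteq> snd z\<close>
        by (metis linorder_neq_iff)
    qed
  qed
qed

section \<open>Dependence of the posterior on the data\<close>

text \<open>
  The derivative \<open>- a s exp (- a s\<^sup>2 / 2)\<close> is bounded because \<open>exp t \<ge> 1 + t\<close>. So the likelihood is
  Lipschitz in the misfit \<open>s\<close> with a constant that does not see the size of the forward map.
\<close>

lemma gaussian_kernel_Lipschitz:
  fixes s t a :: real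
  assumes "0 \<le> a" "a \<le> 1"
  shows "\<bar>exp (- (a * s\<^sup>2 / 2)) - exp (- (a * t\<^sup>2 / 2))\<bar> \<le> \<bar>s - t\<bar>"
proof -
  have "norm (exp (- (a * s\<^sup>2 / 2)) - exp (- (a * t\<^sup>2 / 2))) \<le> 1 * norm (s - t)"
  proof (rule field_differentiable_bound[where S = UNIV and f' = "\<lambda>s. - (a * s * exp (- (a * s\<^sup>2 / 2)))"])
    fix x :: real
    show "((\<lambda>s. exp (- (a * s\<^sup>2 / 2))) has_real_derivative - (a * x * exp (- (a * x\<^sup>2 / 2)))) (at x within UNIV)"
      by (auto intro!: derivative_eq_intros)
    have "2 * \<bar>x\<bar> \<le> 1 + x\<^sup>2"
      using sum_squares_bound[of 1 "\<bar>x\<bar>"] by simp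
    then have "a * (2 * \<bar>x\<bar>) \<le> a * (1 + x\<^sup>2)"
      using assms(1) by (rule mult_left_mono)
    then have "a * \<bar>x\<bar> \<le> 1 + a * x\<^sup>2 / 2"
      using assms by (simp add: distrib_left)
    also have "\<dots> \<le> exp (a * x\<^sup>2 / 2)"
      by (rule exp_ge_add_one_self)
    finally show "norm (- (a * x * exp (- (a * x\<^sup>2 / 2)))) \<le> 1"
      using assms(1) by (simp add: abs_mult exp_minus field_simps)
  qed auto
  then show ?thesis by simp
qed

text \<open>Applied with the likelihood over the evidence, and with the square roots of both.\<close>

lemma quotient_difference_bound:
  fixes a a' b b' \<beta> \<delta> \<epsilon> :: real
  assumes "0 < \<beta>" "\<beta> \<le> b" "\<beta> \<le> b'" "0 \<le> a'" "a' \<le> 1" "\<bar>a - a'\<bar> \<le> \<delta>" "\<bar>b - b'\<bar> \<le> \<epsilon>"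
  shows "\<bar>a / b - a' / b'\<bar> \<le> \<delta> / \<beta> + \<epsilon> / \<beta>\<^sup>2"
proof -
  have pos: "0 < b" "0 < b'"
    using assms by linarith+
  have "a / b - a' / b' = (a - a') / b + a' * ((b' - b) / (b * b'))"
    using pos by (simp add: field_simps)
  also have "\<bar>\<dots>\<bar> \<le> \<bar>a - a'\<bar> / b + a' * (\<bar>b' - b\<bar> / (b * b'))"
    using assms pos by (intro order_trans[OF abs_triangle_ineq]) (simp add: abs_mult)
  also have "\<dots> \<le> \<delta> / \<beta> + 1 * (\<epsilon> / (\<beta> * \<beta>))"
    using assms pos by (intro add_mono mult_mono frac_le) auto
  finally show ?thesis
    by (simp add: power2_eq_square)
qed

lemma norm_wrt_nonneg: "0 \<le> norm_wrt \<Gamma> v"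
  by (simp add: norm_wrt_def)

lemma norm_wrt_triangle: "norm_wrt \<Gamma> (v + w) \<le> norm_wrt \<Gamma> v + norm_wrt \<Gamma> w"
  unfolding norm_wrt_def matrix_vector_right_distrib by (rule norm_triangle_ineq)

lemma norm_wrt_minus: "norm_wrt \<Gamma> (- v) = norm_wrt \<Gamma> v"
  using matrix_vector_mult_diff_distrib[of "matrix_inv (matrix_sqrt \<Gamma>)" 0 v]
  by (simp add: norm_wrt_def)

lemma norm_wrt_diff_le: "\<bar>norm_wrt \<Gamma> v - norm_wrt \<Gamma> w\<bar> \<le> norm_wrt \<Gamma> (v - w)"
  using norm_wrt_triangle[of \<Gamma> "v - w" w] norm_wrt_triangle[of \<Gamma> "w - v" v] norm_wrt_minus[of \<Gamma> "v - w"]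
  by simp

lemma norm_wrt_measurable [measurable]:
  "norm_wrt \<Gamma> \<in> borel_measurable borel"
  unfolding norm_wrt_def
  by (intro borel_measurable_continuous_onI continuous_on_norm matrix_vector_mult_linear_continuous_on)

text \<open>
  Both posteriors have positive densities with respect to \<open>\<mu>0\<close>, so any common reference measure also
  dominates \<open>\<mu>0\<close>, and the factor \<open>d\<mu>0/d\<nu>\<close> can be pulled out of both integrals.
\<close>

lemma distances_via_prior:
  fixes \<rho> \<rho>' :: "'u \<Rightarrow> real"
  assumes prob: "prob_space \<mu>0"
    and \<rho>: "\<rho> \<in> borel_measurable \<mu>0" "\<And>u. 0 < \<rho> u"
    and \<rho>': "\<rho>' \<in> borel_measurable \<mu>0" "\<And>u. 0 < \<rho>' u"
    and ref: "common_reference \<nu> (density \<mu>0 (\<lambda>u. ennreal (\<rho> u))) (density \<mu>0 (\<lambda>u. ennreal (\<rho>' u)))"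
  shows "d_TV \<nu> (density \<mu>0 (\<lambda>u. ennreal (\<rho> u))) (density \<mu>0 (\<lambda>u. ennreal (\<rho>' u)))
      = 1/2 * (LINT u|\<mu>0. \<bar>\<rho> u - \<rho>' u\<bar>)"
    and "d_Hell \<nu> (density \<mu>0 (\<lambda>u. ennreal (\<rho> u))) (density \<mu>0 (\<lambda>u. ennreal (\<rho>' u)))
      = sqrt (1/2 * (LINT u|\<mu>0. (sqrt (\<rho> u) - sqrt (\<rho>' u))\<^sup>2))"
proof -
  interpret prob_space \<mu>0 by (rule prob)
  interpret \<nu>: sigma_finite_measure \<nu>
    using ref by (simp add: common_reference_def)
  have sets: "sets \<mu>0 = sets \<nu>"
    using ref by (simp add: common_reference_def)
  have meas: "k \<in> borel_measurable \<nu>" if "k \<in> borel_measurable \<mu>0" for k :: "'u \<Rightarrow> real"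
    using that measurable_cong_sets[OF sets refl] by blast
  have ac: "absolutely_continuous \<nu> \<mu>0"
    unfolding absolutely_continuous_def
  proof
    fix A assume "A \<in> null_sets \<nu>"
    then have "A \<in> null_sets (density \<mu>0 (\<lambda>u. ennreal (\<rho> u)))"
      using ref by (auto simp: common_reference_def absolutely_continuous_def)
    then have "A \<in> sets \<mu>0" "AE u in \<mu>0. u \<in> A \<longrightarrow> ennreal (\<rho> u) = 0"
      using \<rho>(1) by (auto simp: null_sets_density_iff)
    moreover have "AE u in \<mu>0. u \<notin> A"
      using calculation(2) by eventually_elim (metis \<rho>(2) ennreal_eq_0_iff not_le)
    ultimately show "A \<in> null_sets \<mu>0"
      by (simp add: AE_iff_null_sets)
  qed
  define h where "h u = enn2real (RN_deriv \<nu> \<mu>0 u)" for u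
  have h_meas: "h \<in> borel_measurable \<nu>"
    unfolding h_def by measurable
  have h0: "0 \<le> h u" for u
    by (simp add: h_def)
  have h: "AE u in \<nu>. RN_deriv \<nu> \<mu>0 u = ennreal (h u)"
    using \<nu>.RN_deriv_finite[OF sigma_finite_measure_axioms ac sets]
    by eventually_elim (simp add: h_def less_top)
  have \<mu>0: "\<mu>0 = density \<nu> (\<lambda>u. ennreal (h u))"
  proof -
    have "density \<nu> (\<lambda>u. ennreal (h u)) = density \<nu> (RN_deriv \<nu> \<mu>0)"
      using h h_meas by (intro density_cong) auto
    then show ?thesis
      using \<nu>.density_RN_deriv[OF ac sets] by simp
  qed
  have RN: "AE u in \<nu>. enn2real (RN_deriv \<nu> (density \<mu>0 (\<lambda>u. ennreal (\<sigma> u))) u) = h u * \<sigma> u"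
    if \<sigma>: "\<sigma> \<in> borel_measurable \<mu>0" "\<And>u. 0 < \<sigma> u" for \<sigma>
  proof -
    have \<sigma>_meas: "\<sigma> \<in> borel_measurable \<nu>"
      by (rule meas[OF \<sigma>(1)])
    have "density \<nu> (\<lambda>u. ennreal (h u) * ennreal (\<sigma> u)) = density \<mu>0 (\<lambda>u. ennreal (\<sigma> u))"
      unfolding \<mu>0 using h_meas \<sigma>_meas by (intro density_density_eq[symmetric]) auto
    then have "AE u in \<nu>. ennreal (h u) * ennreal (\<sigma> u) = RN_deriv \<nu> (density \<mu>0 (\<lambda>u. ennreal (\<sigma> u))) u"
      using h_meas \<sigma>_meas by (intro \<nu>.RN_deriv_unique) auto
    then show ?thesis
    proof eventually_elim
      case (elim u)
      then show ?case
        using h0[of u] \<sigma>(2)[of u] by (simp add: ennreal_mult[symmetric] flip: elim)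
    qed
  qed
  have RN_meas: "(\<lambda>u. enn2real (RN_deriv \<nu> M u)) \<in> borel_measurable \<nu>" for M
    by measurable
  have \<rho>_meas: "\<rho> \<in> borel_measurable \<nu>" "\<rho>' \<in> borel_measurable \<nu>"
    by (rule meas[OF \<rho>(1)], rule meas[OF \<rho>'(1)])
  have change: "(LINT u|\<mu>0. k u) = (LINT u|\<nu>. h u * k u)" if "k \<in> borel_measurable \<nu>" for k :: "'u \<Rightarrow> real"
    unfolding \<mu>0 using that h_meas h0 by (subst integral_density) auto
  have "(LINT u|\<nu>. \<bar>enn2real (RN_deriv \<nu> (density \<mu>0 (\<lambda>u. ennreal (\<rho> u))) u)
        - enn2real (RN_deriv \<nu> (density \<mu>0 (\<lambda>u. ennreal (\<rho>' u))) u)\<bar>)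
      = (LINT u|\<nu>. h u * \<bar>\<rho> u - \<rho>' u\<bar>)"
  proof (rule integral_cong_AE)
    show "AE u in \<nu>. \<bar>enn2real (RN_deriv \<nu> (density \<mu>0 (\<lambda>u. ennreal (\<rho> u))) u)
        - enn2real (RN_deriv \<nu> (density \<mu>0 (\<lambda>u. ennreal (\<rho>' u))) u)\<bar> = h u * \<bar>\<rho> u - \<rho>' u\<bar>"
      using RN[OF \<rho>] RN[OF \<rho>']
      by eventually_elim (use h0 in \<open>simp add: abs_mult flip: right_diff_distrib\<close>)
  qed (use RN_meas h_meas \<rho>_meas in measurable)
  then show "d_TV \<nu> (density \<mu>0 (\<lambda>u. ennreal (\<rho> u))) (density \<mu>0 (\<lambda>u. ennreal (\<rho>' u)))
      = 1/2 * (LINT u|\<mu>0. \<bar>\<rho> u - \<rho>' u\<bar>)"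
    unfolding d_TV_def using \<rho>_meas by (subst change) auto
  have "(LINT u|\<nu>. (sqrt (enn2real (RN_deriv \<nu> (density \<mu>0 (\<lambda>u. ennreal (\<rho> u))) u))
        - sqrt (enn2real (RN_deriv \<nu> (density \<mu>0 (\<lambda>u. ennreal (\<rho>' u))) u)))\<^sup>2)
      = (LINT u|\<nu>. h u * (sqrt (\<rho> u) - sqrt (\<rho>' u))\<^sup>2)"
  proof (rule integral_cong_AE)
    show "AE u in \<nu>. (sqrt (enn2real (RN_deriv \<nu> (density \<mu>0 (\<lambda>u. ennreal (\<rho> u))) u))
        - sqrt (enn2real (RN_deriv \<nu> (density \<mu>0 (\<lambda>u. ennreal (\<rho>' u))) u)))\<^sup>2
        = h u * (sqrt (\<rho> u) - sqrt (\<rho>' u))\<^sup>2"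
      using RN[OF \<rho>] RN[OF \<rho>']
      by eventually_elim
        (use h0 in \<open>simp add: real_sqrt_mult power_mult_distrib flip: right_diff_distrib\<close>)
  qed (use RN_meas h_meas \<rho>_meas in measurable)
  then show "d_Hell \<nu> (density \<mu>0 (\<lambda>u. ennreal (\<rho> u))) (density \<mu>0 (\<lambda>u. ennreal (\<rho>' u)))
      = sqrt (1/2 * (LINT u|\<mu>0. (sqrt (\<rho> u) - sqrt (\<rho>' u))\<^sup>2))"
    unfolding d_Hell_def using \<rho>_meas by (subst change) auto
qed

text \<open>
  For data with \<open>norm_wrt \<Gamma> y < r\<close> every likelihood is at least
  \<open>exp (- (r + norm_wrt \<Gamma> (\<G> u))\<^sup>2 / 2)\<close>, a positive function of \<open>u\<close>; its integral \<open>z0\<close> is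
  therefore a positive lower bound for the evidence, and both constants are functions of \<open>z0\<close>.
\<close>

lemma posterior_Lipschitz:
  fixes \<G> :: "'u \<Rightarrow> real^'j::finite"
  assumes prob: "prob_space \<mu>0" and \<G>: "\<G> \<in> borel_measurable \<mu>0"
  shows "\<exists>C1 C2. \<forall>y y'. max (norm_wrt \<Gamma> y) (norm_wrt \<Gamma> y') < r \<longrightarrow>
    (let \<mu> = posterior \<Gamma> \<G> \<mu>0 y; \<mu>' = posterior \<Gamma> \<G> \<mu>0 y'
     in \<forall>\<nu>. common_reference \<nu> \<mu> \<mu>' \<longrightarrow>
       d_TV \<nu> \<mu> \<mu>' \<le> C1 * norm_wrt \<Gamma> (y - y') \<and> d_Hell \<nu> \<mu> \<mu>' \<le> C2 * norm_wrt \<Gamma> (y - y'))"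
proof -
  interpret prob_space \<mu>0 by (rule prob)
  note \<G> [measurable]
  let ?N = "norm_wrt \<Gamma>"
  let ?Z = "evidence \<Gamma> \<G> \<mu>0"
  define e where "e y u = exp (- potential \<Gamma> \<G> u y)" for y u
  have e_eq: "e y u = exp (- (1 * (?N (y - \<G> u))\<^sup>2 / 2))" for y u
    by (simp add: e_def potential_def)
  have sqrt_e: "sqrt (e y u) = exp (- (1/2 * (?N (y - \<G> u))\<^sup>2 / 2))" for y u
    by (rule real_sqrt_unique) (simp_all add: e_eq power2_eq_square flip: exp_add)
  have e_meas [measurable]: "e y \<in> borel_measurable \<mu>0" for y
    unfolding e_eq by measurable
  have e_bounds: "0 < e y u" "e y u \<le> 1" for y u
    by (simp_all add: e_eq)
  have e_int: "integrable \<mu>0 (e y)" for y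
    by (rule integrable_const_bound[where B = 1]) (auto simp: less_imp_le e_bounds)
  have misfit: "\<bar>?N (y - \<G> u) - ?N (y' - \<G> u)\<bar> \<le> ?N (y - y')" for y y' u
    using norm_wrt_diff_le[of \<Gamma> "y - \<G> u" "y' - \<G> u"] by simp
  have e_Lip: "\<bar>e y u - e y' u\<bar> \<le> ?N (y - y')" for y y' u
    unfolding e_eq by (rule order_trans[OF gaussian_kernel_Lipschitz misfit]) auto
  have sqrt_Lip: "\<bar>sqrt (e y u) - sqrt (e y' u)\<bar> \<le> ?N (y - y')" for y y' u
    unfolding sqrt_e by (rule order_trans[OF gaussian_kernel_Lipschitz misfit]) auto
  have Z_eq: "?Z y = (LINT u|\<mu>0. e y u)" for y
    by (simp add: evidence_def e_def)
  have Z_Lip: "\<bar>?Z y - ?Z y'\<bar> \<le> ?N (y - y')" for y y'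
  proof -
    have "\<bar>?Z y - ?Z y'\<bar> = \<bar>LINT u|\<mu>0. e y u - e y' u\<bar>"
      by (simp add: Z_eq e_int)
    also have "\<dots> \<le> (LINT u|\<mu>0. \<bar>e y u - e y' u\<bar>)"
      by (rule integral_abs_bound)
    also have "\<dots> \<le> ?N (y - y')"
      by (intro integral_le_const integrable_abs Bochner_Integration.integrable_diff e_int AE_I2 e_Lip)
    finally show ?thesis .
  qed
  define g where "g u = exp (- ((r + ?N (\<G> u))\<^sup>2 / 2))" for u
  define z0 where "z0 = (LINT u|\<mu>0. g u)"
  have g_int: "integrable \<mu>0 g"
    unfolding g_def by (rule integrable_const_bound[where B = 1]) auto
  have z0: "0 < z0"
  proof -
    have "z0 \<noteq> 0"
    proof
      assume "z0 = 0"
      then have "AE u in \<mu>0. g u = 0"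
        using g_int unfolding z0_def by (subst (asm) integral_nonneg_eq_0_iff_AE) (auto simp: g_def)
      then have "AE u in \<mu>0. False"
        by eventually_elim (simp add: g_def)
      then show False by simp
    qed
    moreover have "0 \<le> z0"
      unfolding z0_def by (rule integral_nonneg_AE) (simp add: g_def)
    ultimately show ?thesis by simp
  qed
  have z0_le: "z0 \<le> ?Z y" if "?N y < r" for y
    unfolding z0_def Z_eq
  proof (rule integral_mono[OF g_int e_int])
    fix u
    have "?N (y - \<G> u) \<le> r + ?N (\<G> u)"
      using norm_wrt_triangle[of \<Gamma> y "- \<G> u"] norm_wrt_minus[of \<Gamma> "\<G> u"] that by simp
    then have "(?N (y - \<G> u))\<^sup>2 \<le> (r + ?N (\<G> u))\<^sup>2"
      by (rule power_mono) (rule norm_wrt_nonneg)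
    then show "g u \<le> e y u"
      by (simp add: g_def e_eq)
  qed
  define K1 where "K1 = 1 / z0 + 1 / z0\<^sup>2"
  define K2 where "K2 = 1 / sqrt z0 + 1 / sqrt z0 / (sqrt z0)\<^sup>2"
  have K2: "0 \<le> K2"
    using z0 by (simp add: K2_def)
  have "d_TV \<nu> (posterior \<Gamma> \<G> \<mu>0 y) (posterior \<Gamma> \<G> \<mu>0 y') \<le> K1 * ?N (y - y') \<and>
      d_Hell \<nu> (posterior \<Gamma> \<G> \<mu>0 y) (posterior \<Gamma> \<G> \<mu>0 y') \<le> K2 * ?N (y - y')"
    if r: "max (?N y) (?N y') < r"
      and ref: "common_reference \<nu> (posterior \<Gamma> \<G> \<mu>0 y) (posterior \<Gamma> \<G> \<mu>0 y')" for y y' \<nu>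
  proof -
    let ?\<delta> = "?N (y - y')"
    have \<delta>: "0 \<le> ?\<delta>" by (rule norm_wrt_nonneg)
    have Z: "z0 \<le> ?Z y" "z0 \<le> ?Z y'"
      using r by (auto intro: z0_le)
    then have Z_pos: "0 < ?Z y" "0 < ?Z y'"
      using z0 by linarith+
    define \<rho> where "\<rho> = (\<lambda>u. e y u / ?Z y)"
    define \<rho>' where "\<rho>' = (\<lambda>u. e y' u / ?Z y')"
    have \<rho>: "\<rho> \<in> borel_measurable \<mu>0" "\<And>u. 0 < \<rho> u"
      using Z_pos e_bounds by (auto simp: \<rho>_def)
    have \<rho>': "\<rho>' \<in> borel_measurable \<mu>0" "\<And>u. 0 < \<rho>' u"
      using Z_pos e_bounds by (auto simp: \<rho>'_def)
    have post: "posterior \<Gamma> \<G> \<mu>0 y = density \<mu>0 (\<lambda>u. ennreal (\<rho> u))"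
      "posterior \<Gamma> \<G> \<mu>0 y' = density \<mu>0 (\<lambda>u. ennreal (\<rho>' u))"
      by (simp_all add: posterior_def \<rho>_def \<rho>'_def e_def)
    note dist = distances_via_prior[OF prob \<rho> \<rho>' ref[unfolded post]]
    have TV_bound: "\<bar>\<rho> u - \<rho>' u\<bar> \<le> K1 * ?\<delta>" for u
    proof -
      have "\<bar>\<rho> u - \<rho>' u\<bar> \<le> ?\<delta> / z0 + ?\<delta> / z0\<^sup>2"
        unfolding \<rho>_def \<rho>'_def
        by (rule quotient_difference_bound[OF z0 Z less_imp_le[OF e_bounds(1)] e_bounds(2) e_Lip Z_Lip])
      then show ?thesis
        by (simp add: K1_def field_simps)
    qed
    have sqrt_Z_Lip: "\<bar>sqrt (?Z y) - sqrt (?Z y')\<bar> \<le> ?\<delta> / sqrt z0"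
    proof -
      have "\<bar>sqrt (?Z y) - sqrt (?Z y')\<bar> * sqrt z0
          \<le> \<bar>sqrt (?Z y) - sqrt (?Z y')\<bar> * (sqrt (?Z y) + sqrt (?Z y'))"
        using Z Z_pos by (intro mult_left_mono) (auto simp: add_increasing2)
      also have "\<dots> = \<bar>(sqrt (?Z y) - sqrt (?Z y')) * (sqrt (?Z y) + sqrt (?Z y'))\<bar>"
        using Z_pos by (simp add: abs_mult)
      also have "(sqrt (?Z y) - sqrt (?Z y')) * (sqrt (?Z y) + sqrt (?Z y')) = ?Z y - ?Z y'"
        using Z_pos by (simp add: algebra_simps)
      also have "\<bar>\<dots>\<bar> \<le> ?\<delta>"
        by (rule Z_Lip)
      finally show ?thesis
        using z0 by (simp add: pos_le_divide_eq)
    qed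
    have Hell_bound: "(sqrt (\<rho> u) - sqrt (\<rho>' u))\<^sup>2 \<le> (K2 * ?\<delta>)\<^sup>2" for u
    proof -
      have "\<bar>sqrt (\<rho> u) - sqrt (\<rho>' u)\<bar> \<le> ?\<delta> / sqrt z0 + ?\<delta> / sqrt z0 / (sqrt z0)\<^sup>2"
        unfolding \<rho>_def \<rho>'_def real_sqrt_divide
        using z0 Z e_bounds(1)[of y' u] e_bounds(2)[of y' u]
        by (intro quotient_difference_bound sqrt_Lip sqrt_Z_Lip) (auto simp: less_imp_le)
      also have "\<dots> = K2 * ?\<delta>"
        by (simp add: K2_def field_simps)
      finally show ?thesis
        by (metis abs_ge_zero power2_abs power_mono)
    qed
    have "d_TV \<nu> (posterior \<Gamma> \<G> \<mu>0 y) (posterior \<Gamma> \<G> \<mu>0 y') \<le> 1/2 * (K1 * ?\<delta>)"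
      unfolding post dist(1)
    proof (intro mult_left_mono integral_le_const AE_I2 TV_bound)
      show "integrable \<mu>0 (\<lambda>u. \<bar>\<rho> u - \<rho>' u\<bar>)"
        using \<rho>(1) \<rho>'(1) TV_bound by (intro integrable_const_bound[where B = "K1 * ?\<delta>"]) auto
    qed simp
    also have "\<dots> \<le> K1 * ?\<delta>"
      using z0 \<delta> by (simp add: K1_def)
    finally have TV: "d_TV \<nu> (posterior \<Gamma> \<G> \<mu>0 y) (posterior \<Gamma> \<G> \<mu>0 y') \<le> K1 * ?\<delta>" .
    have "(LINT u|\<mu>0. (sqrt (\<rho> u) - sqrt (\<rho>' u))\<^sup>2) \<le> (K2 * ?\<delta>)\<^sup>2"
    proof (intro integral_le_const AE_I2 Hell_bound)
      show "integrable \<mu>0 (\<lambda>u. (sqrt (\<rho> u) - sqrt (\<rho>' u))\<^sup>2)"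
        using \<rho>(1) \<rho>'(1) Hell_bound by (intro integrable_const_bound[where B = "(K2 * ?\<delta>)\<^sup>2"]) auto
    qed
    then have "1/2 * (LINT u|\<mu>0. (sqrt (\<rho> u) - sqrt (\<rho>' u))\<^sup>2) \<le> (K2 * ?\<delta>)\<^sup>2"
      using zero_le_power2[of "K2 * ?\<delta>"] by linarith
    then have "d_Hell \<nu> (posterior \<Gamma> \<G> \<mu>0 y) (posterior \<Gamma> \<G> \<mu>0 y') \<le> K2 * ?\<delta>"
      unfolding post dist(2) using K2 \<delta> by (intro real_le_lsqrt) auto
    with TV show ?thesis ..
  qed
  then show ?thesis
    by (intro exI[of _ K1] exI[of _ K2]) (simp add: Let_def)
qed

section \<open>Lipschitz dependence of the posterior on the data for the two geometries\<close>

lemma posterior_Lipschitz_if_continuous: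
  assumes prior: "is_prior Ug m C \<mu>0" and cont: "continuous_on (Ug \<times> UNIV) (obs_map f l R)"
  shows "\<exists>C1 C2. \<forall>y y'. max (norm_wrt \<Gamma> y) (norm_wrt \<Gamma> y') < r \<longrightarrow>
    (let \<mu> = posterior \<Gamma> (obs_map f l R) \<mu>0 y; \<mu>' = posterior \<Gamma> (obs_map f l R) \<mu>0 y'
     in \<forall>\<nu>. common_reference \<nu> \<mu> \<mu>' \<longrightarrow>
       d_TV \<nu> \<mu> \<mu>' \<le> C1 * norm_wrt \<Gamma> (y - y') \<and> d_Hell \<nu> \<mu> \<mu>' \<le> C2 * norm_wrt \<Gamma> (y - y'))"
proof (rule posterior_Lipschitz)
  show "prob_space \<mu>0"
    using prior by (simp add: is_prior_def)
  have "obs_map f l R \<in> borel_measurable (restrict_space borel (Ug \<times> UNIV))"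
    by (rule borel_measurable_continuous_on_restrict[OF cont])
  moreover have "sets \<mu>0 = sets (restrict_space borel (Ug \<times> UNIV))"
    using prior by (simp add: is_prior_def)
  ultimately show "obs_map f l R \<in> borel_measurable \<mu>0"
    using measurable_cong_sets[OF _ refl] by blast
qed

theorem theorem3p7:
  fixes f :: "(real \<times> real \<Rightarrow> real) \<Rightarrow> real"
    and l :: "'j::finite \<Rightarrow> (real \<times> real \<Rightarrow> real) \<Rightarrow> real"
    and \<Gamma> :: "real^'j^'j"
  assumes "f \<in> V_dual" and "\<And>j. l j \<in> V_dual" and "spd \<Gamma>"
  shows
    "(\<forall>(cstar::real)
        (m :: 'n::{finite,linorder} \<Rightarrow> closed_square \<Rightarrow>\<^sub>C real)
        (C :: 'n \<Rightarrow> ((closed_square \<Rightarrow>\<^sub>C real) \<Rightarrow>\<^sub>L real) \<Rightarrow>\<^sub>L (closed_square \<Rightarrow>\<^sub>C real))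
        (\<mu>0 :: ('k::{finite,linorder} layer_param \<times> (closed_square \<Rightarrow>\<^sub>C (real^'n::{finite,linorder}))) measure).
        CARD('n) = CARD('k) + 1 \<and> cstar > 0 \<and> is_prior (layer_params cstar) m C \<mu>0 \<longrightarrow>
        (\<forall>r>0. \<exists>C1 C2. \<forall>y y'. max (norm_wrt \<Gamma> y) (norm_wrt \<Gamma> y') < r \<longrightarrow>
          (let \<mu> = posterior \<Gamma> (obs_map f l layer_region) \<mu>0 y;
               \<mu>' = posterior \<Gamma> (obs_map f l layer_region) \<mu>0 y'
           in \<forall>\<nu>. common_reference \<nu> \<mu> \<mu>' \<longrightarrow>
             d_TV \<nu> \<mu> \<mu>' \<le> C1 * norm_wrt \<Gamma> (y - y') \<and>
             d_Hell \<nu> \<mu> \<mu>' \<le> C2 * norm_wrt \<Gamma> (y - y'))))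
     \<and>
     (\<forall>(dm::real^5) (dp::real^5)
        (m :: 2 \<Rightarrow> closed_square \<Rightarrow>\<^sub>C real)
        (C :: 2 \<Rightarrow> ((closed_square \<Rightarrow>\<^sub>C real) \<Rightarrow>\<^sub>L real) \<Rightarrow>\<^sub>L (closed_square \<Rightarrow>\<^sub>C real))
        (\<mu>0 :: ((real^5) \<times> (closed_square \<Rightarrow>\<^sub>C (real^2))) measure).
        (\<forall>i. dm $ i \<le> dp $ i) \<and> {dm $ 3..dp $ 3} \<subseteq> {-pi/2<..<pi/2} \<and> 0 \<le> dm $ 5 \<and>
        is_prior (channel_params dm dp) m C \<mu>0 \<longrightarrow>
        (\<forall>r>0. \<exists>C1 C2. \<forall>y y'. max (norm_wrt \<Gamma> y) (norm_wrt \<Gamma> y') < r \<longrightarrow>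
          (let \<mu> = posterior \<Gamma> (obs_map f l channel_region) \<mu>0 y;
               \<mu>' = posterior \<Gamma> (obs_map f l channel_region) \<mu>0 y'
           in \<forall>\<nu>. common_reference \<nu> \<mu> \<mu>' \<longrightarrow>
             d_TV \<nu> \<mu> \<mu>' \<le> C1 * norm_wrt \<Gamma> (y - y') \<and>
             d_Hell \<nu> \<mu> \<mu>' \<le> C2 * norm_wrt \<Gamma> (y - y'))))"
proof (intro conjI allI impI; elim conjE)
  fix cstar r and m :: "'n::{finite,linorder} \<Rightarrow> closed_square \<Rightarrow>\<^sub>C real"
    and C :: "'n::{finite,linorder} \<Rightarrow> ((closed_square \<Rightarrow>\<^sub>C real) \<Rightarrow>\<^sub>L real) \<Rightarrow>\<^sub>L (closed_square \<Rightarrow>\<^sub>C real)"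
    and \<mu>0 :: "('k::{finite,linorder} layer_param \<times>
        (closed_square \<Rightarrow>\<^sub>C (real^'n::{finite,linorder}))) measure"
  assume card: "CARD('n) = CARD('k) + 1" and prior: "is_prior (layer_params cstar) m C \<mu>0"
  have "continuous_on (layer_params cstar \<times> UNIV)
      (obs_map f l (layer_region :: 'k layer_param \<Rightarrow> 'n \<Rightarrow> (real \<times> real) set))"
    by (intro continuous_on_obs_map assms layer_region_borel layer_region_cover card layer_region_stable)
  then show "\<exists>C1 C2. \<forall>y y'. max (norm_wrt \<Gamma> y) (norm_wrt \<Gamma> y') < r \<longrightarrow>
      (let \<mu> = posterior \<Gamma> (obs_map f l layer_region) \<mu>0 y;
           \<mu>' = posterior \<Gamma> (obs_map f l layer_region) \<mu>0 y'
       in \<forall>\<nu>. common_reference \<nu> \<mu> \<mu>' \<longrightarrow>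
         d_TV \<nu> \<mu> \<mu>' \<le> C1 * norm_wrt \<Gamma> (y - y') \<and>
         d_Hell \<nu> \<mu> \<mu>' \<le> C2 * norm_wrt \<Gamma> (y - y'))"
    by (rule posterior_Lipschitz_if_continuous[OF prior])
next
  fix dm dp r and m :: "2 \<Rightarrow> closed_square \<Rightarrow>\<^sub>C real"
    and C :: "2 \<Rightarrow> ((closed_square \<Rightarrow>\<^sub>C real) \<Rightarrow>\<^sub>L real) \<Rightarrow>\<^sub>L (closed_square \<Rightarrow>\<^sub>C real)"
    and \<mu>0 :: "((real^5) \<times> (closed_square \<Rightarrow>\<^sub>C (real^2))) measure"
  assume angle: "{dm $ 3..dp $ 3} \<subseteq> {-pi/2<..<pi/2}" and prior: "is_prior (channel_params dm dp) m C \<mu>0"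
  have "cos (d $ 3) \<noteq> 0" if "d \<in> channel_params dm dp" for d
  proof -
    have "d $ 3 \<in> {-pi/2<..<pi/2}"
      using that angle unfolding channel_params_def by blast
    then have "0 < cos (d $ 3)"
      by (intro cos_gt_zero_pi) auto
    then show ?thesis by simp
  qed
  then have "continuous_on (channel_params dm dp \<times> UNIV) (obs_map f l channel_region)"
    by (intro continuous_on_obs_map assms channel_region_borel channel_region_cover channel_region_stable)
  then show "\<exists>C1 C2. \<forall>y y'. max (norm_wrt \<Gamma> y) (norm_wrt \<Gamma> y') < r \<longrightarrow>
      (let \<mu> = posterior \<Gamma> (obs_map f l channel_region) \<mu>0 y;
           \<mu>' = posterior \<Gamma> (obs_map f l channel_region) \<mu>0 y'
       in \<forall>\<nu>. common_reference \<nu> \<mu> \<mu>' \<longrightarrow>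
         d_TV \<nu> \<mu> \<mu>' \<le> C1 * norm_wrt \<Gamma> (y - y') \<and>
         d_Hell \<nu> \<mu> \<mu>' \<le> C2 * norm_wrt \<Gamma> (y - y'))"
    by (rule posterior_Lipschitz_if_continuous[OF prior])
qed

end
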